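(* Let $a,b>0$. For every $t>0$ let $h_t\ge 0$ and $\lambda_t>0$. Let $c_t=h_t\sqrt{\lambda_t}$ and assume that $c:=\lim_{t\to\infty}c_t$ exists in $[0,+\infty]$. Then: (i) If $c=0$ and $\sqrt{\lambda_t}\,t\to+\infty$, then $\dfrac{1}{\sqrt{\lambda_t}\,t}L^{\mathbf{h_t},\lambda_t}_{(at,bt)}\to f^{(0,0)}(a,b)$ in probability as $t\to\infty$. (ii) If $c\in(0,+\infty)$ and $\sqrt{\lambda_t}\,t\to+\infty$, then $\dfrac{1}{\sqrt{\lambda_t}\,t}L^{\mathbf{h_t},\lambda_t}_{(at,bt)}\to f^{(c,c)}(a,b)$ in probability as $t\to\infty$. (iii) If $c=+\infty$ and $t/h_t\to+\infty$, then $\dfrac{h_t}{t}L^{\mathbf{h_t},\lambda_t}_{(at,bt)}\to\min\{a,b\}$ in probability as $t\to\infty$.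
   Context: For $\mathbf h=(h_1,h_2)$ with $h_1,h_2\ge 0$ real, write $(y,s)\stackrel{\mathbf h}{\prec}(y',s')$ if $y+h_1\le y'$ and $s+h_2\le s'$. For $\lambda>0$ let $\Xi$ be a homogeneous Poisson point process with intensity $\lambda$ in $(0,+\infty)^2$. For $x,t>0$, $L^{\mathbf h,\lambda}_{(x,t)}$ is the maximal integer $L\ge 0$ such that there are points $(y_1,s_1),\dots,(y_L,s_L)\in\Xi$ with $0<y_1<\dots<y_L<x$, $0<s_1<\dots<s_L<t$ and $(y_1,s_1)\stackrel{\mathbf h}{\prec}(y_2,s_2)\stackrel{\mathbf h}{\prec}\dots\stackrel{\mathbf h}{\prec}(y_L,s_L)$. Here $\mathbf{h_t}=(h_t,h_t)$. For $a,b>0$ and $c\ge 0$, $$f^{(c,c)}(a,b)=\frac{2c(a+b)-2\sqrt{c^2(a-b)^2+ab}}{4c^2-1}\ \text{ if }c\ne \tfrac12,\qquad f^{(1/2,1/2)}(a,b)=\frac{2ab}{a+b};$$ in particular $f^{(0,0)}(a,b)=2\sqrt{ab}$. (This is the almost sure limit of $L^{(c,c),1}_{(at,bt)}/t$ as $t\to\infty$.) *)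

theory Defs
  imports "HOL-Probability.Probability"
begin

definition open_quadrant :: "(real \<times> real) set" where
  "open_quadrant = {0<..} \<times> {0<..}"

text \<open>
  A homogeneous Poisson process as a random locally finite subset of the open quadrant.
  Local finiteness holds for every outcome, so \<open>card\<close> below always counts a finite set.
  The Poisson law is written out because \<^const>\<open>poisson_pmf\<close> requires a positive rate,
  whereas null sets \<open>B\<close> have rate \<open>0\<close> (and \<open>0 ^ 0 = 1\<close> gives the point mass at \<open>0\<close>).
\<close>
locale poisson_process_quadrant = prob_space M
  for M :: "'a measure" and lam :: real and Xi :: "'a \<Rightarrow> (real \<times> real) set" +
  assumes intensity_pos: "lam > 0"
    and subset_quadrant: "\<omega> \<in> space M \<Longrightarrow> Xi \<omega> \<subseteq> open_quadrant"
    and locally_finite: "\<omega> \<in> space M \<Longrightarrow> bounded B \<Longrightarrow> finite (Xi \<omega> \<inter> B)"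
    and count_measurable:
      "B \<in> sets borel \<Longrightarrow> bounded B \<Longrightarrow> B \<subseteq> open_quadrant \<Longrightarrow>
        (\<lambda>\<omega>. card (Xi \<omega> \<inter> B)) \<in> M \<rightarrow>\<^sub>M count_space UNIV"
    and count_poisson:
      "B \<in> sets borel \<Longrightarrow> bounded B \<Longrightarrow> B \<subseteq> open_quadrant \<Longrightarrow>
        prob {\<omega> \<in> space M. card (Xi \<omega> \<inter> B) = k} =
          (lam * measure lborel B) ^ k / fact k * exp (- (lam * measure lborel B))"
    and count_indep:
      "finite \<B> \<Longrightarrow> disjoint \<B> \<Longrightarrow>
        (\<And>B. B \<in> \<B> \<Longrightarrow> B \<in> sets borel \<and> bounded B \<and> B \<subseteq> open_quadrant) \<Longrightarrow>
        indep_vars (\<lambda>_. count_space UNIV) (\<lambda>B \<omega>. card (Xi \<omega> \<inter> B)) \<B>"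

definition hprec :: "real \<times> real \<Rightarrow> real \<times> real \<Rightarrow> real \<times> real \<Rightarrow> bool" where
  "hprec h p q \<longleftrightarrow> fst p + fst h \<le> fst q \<and> snd p + snd h \<le> snd q"

text \<open>
  The strict inequalities are not implied by \<^const>\<open>hprec\<close> when a component of \<open>h\<close> vanishes.
\<close>
definition hchain ::
    "real \<times> real \<Rightarrow> (real \<times> real) set \<Rightarrow> real \<times> real \<Rightarrow> (real \<times> real) list \<Rightarrow> bool" where
  "hchain h S xt ps \<longleftrightarrow>
     set ps \<subseteq> S \<inter> ({0<..<fst xt} \<times> {0<..<snd xt}) \<and>
     successively (\<lambda>p q. fst p < fst q \<and> snd p < snd q \<and> hprec h p q) ps"

definition max_chain :: "real \<times> real \<Rightarrow> (real \<times> real) set \<Rightarrow> real \<times> real \<Rightarrow> nat" where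
  "max_chain h S xt = (GREATEST n. \<exists>ps. hchain h S xt ps \<and> length ps = n)"

definition limit_shape :: "real \<Rightarrow> real \<Rightarrow> real \<Rightarrow> real" where
  "limit_shape c a b =
     (if c = 1 / 2 then 2 * a * b / (a + b)
      else (2 * c * (a + b) - 2 * sqrt (c\<^sup>2 * (a - b)\<^sup>2 + a * b)) / (4 * c\<^sup>2 - 1))"

text \<open>
  Convergence in probability to a constant; the underlying probability space may vary along the
  filter. Measurability is part of the notion, since \<^const>\<open>measure\<close> is \<open>0\<close> on
  non-measurable sets.
\<close>
definition tendsto_in_prob ::
    "('i \<Rightarrow> 'a measure) \<Rightarrow> ('i \<Rightarrow> 'a \<Rightarrow> real) \<Rightarrow> real \<Rightarrow> 'i filter \<Rightarrow> bool" where
  "tendsto_in_prob M X l F \<longleftrightarrow>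
     (\<forall>\<^sub>F t in F. X t \<in> borel_measurable (M t)) \<and>
     (\<forall>\<epsilon>>0. ((\<lambda>t. measure (M t) {\<omega> \<in> space (M t). \<epsilon> < \<bar>X t \<omega> - l\<bar>}) \<longlongrightarrow> 0) F)"

end

theory Submission
  imports Defs "HOL-Real_Asymp.Real_Asymp"
begin

text \<open>
  The process is solved on a fine grid, where everything is a finite product of coin tosses.  Cut the
  quadrant into cells of side \<open>\<delta>\<close>: a cell is occupied with probability \<open>p = 1 - exp (- \<lambda> \<delta>\<^sup>2)\<close>,
  independently of the others, and as \<open>\<delta>\<close> tends to \<open>0\<close> the existence of a chain of \<open>n\<close> Poisson points
  with gaps exceeding \<open>h\<close> turns into the existence of a chain of \<open>n\<close> occupied cells whose indices
  differ by about \<open>h / \<delta>\<close> (\<open>strict_chain_approx\<close>).  Three ideas then give the limit.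

  \<^item> \<^emph>\<open>The gap can be removed.\<close>  Explore a chain level by level: the cells at distance at least one gap
    beyond the first level are untouched by the determination of that level, so they may be
    resampled (\<open>bernoulli_field_refresh\<close>).  Once each level has its own independent environment, the
    excess of the gap over one cell is a mere translation.  Hence a chain of \<open>n + 1\<close> cells with gap
    \<open>d + 1\<close> in a grid enlarged by \<open>n d\<close> in both directions has the same probability as a chain of
    \<open>n + 1\<close> cells with gap \<open>1\<close> in the original grid (\<open>gap_removal\<close>).

  \<^item> \<^emph>\<open>The model with gap one has a stationary version.\<close>  Put Bernoulli sources of density \<open>\<alpha>\<close> below
    the grid and sinks of density \<open>\<beta>\<close> to its left, with \<open>\<alpha> \<beta> = p (1 - \<alpha>) (1 - \<beta>)\<close>.  Then the
    increments of the passage time along the border of the explored cells are again independent Bernoulli variables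
    (\<open>burke_property\<close>), so the passage time to the corner \<open>(N, M)\<close> is a sum of two binomial variables
    with mean \<open>\<alpha> N + \<beta> M\<close> and small variance.  It dominates the passage time without boundary, and
    minimising over \<open>\<alpha>\<close> gives the upper bound \<open>2 sqrt (p N M)\<close> (\<open>lpp_upper_tail\<close>).

  \<^item> \<^emph>\<open>The upper bound implies the lower bound.\<close>  A stationary optimal path leaves the boundary
    somewhere.  If it left at a fraction \<open>s\<close> of the side, its length would be at most
    \<open>(s + 2 sqrt (1 - s)) sqrt (p N M)\<close> by the upper bound for the remaining grid, which is less than
    \<open>2 sqrt (p N M)\<close> by about \<open>s\<^sup>2 / 4\<close>.  So the exit point is close to the corner and the boundary
    contributes almost nothing (\<open>lpp_lower_tail\<close>).

  Undoing the removal of the gap, a level \<open>l\<close> is reached when \<open>l < 2 sqrt ((a - c l) (b - c l))\<close> and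
  missed when the inequality is reversed; the limit shape is the fixed point
  (\<open>limit_shape_fixed_point\<close>).  When \<open>h sqrt \<lambda>\<close> tends to infinity the points are so dense at the scale
  of the gap that a chain along the diagonal loses only a vanishing proportion of the trivial bound
  \<open>min a b t / h\<close> (\<open>diagonal_squares\<close>).
\<close>

section \<open>Chains on the grid and last-passage recursion\<close>

definition grel :: "nat \<Rightarrow> nat \<times> nat \<Rightarrow> nat \<times> nat \<Rightarrow> bool" where
  "grel m p q \<longleftrightarrow> fst p + m \<le> fst q \<and> snd p + m \<le> snd q"

definition has_chain :: "nat \<Rightarrow> nat \<Rightarrow> (nat \<times> nat) set \<Rightarrow> bool" where
  "has_chain m n S \<longleftrightarrow> (\<exists>ps. set ps \<subseteq> S \<and> sorted_wrt (grel m) ps \<and> length ps = n)"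

definition grid :: "nat \<Rightarrow> nat \<Rightarrow> (nat \<times> nat) set" where
  "grid N M = {..<N} \<times> {..<M}"

text \<open>
  Passage time to the corner \<open>(i, j)\<close> of a grid in which cell \<open>(i, j)\<close> occupies the square between the
  corners \<open>(i, j)\<close> and \<open>(i + 1, j + 1)\<close>.  A path may first collect sources \<open>u\<close> along the bottom side or
  sinks \<open>v\<close> along the left side; inside, two collected cells must differ in both coordinates.
\<close>
fun lpp :: "(nat \<Rightarrow> bool) \<Rightarrow> (nat \<Rightarrow> bool) \<Rightarrow> (nat \<times> nat \<Rightarrow> bool) \<Rightarrow> nat \<Rightarrow> nat \<Rightarrow> nat" where
  "lpp u v w i 0 = card {k. k < i \<and> u k}"
| "lpp u v w 0 (Suc j) = card {k. k < Suc j \<and> v k}"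
| "lpp u v w (Suc i) (Suc j) =
     max (max (lpp u v w i (Suc j)) (lpp u v w (Suc i) j)) (lpp u v w i j + of_bool (w (i, j)))"

abbreviation lpp0 :: "(nat \<times> nat \<Rightarrow> bool) \<Rightarrow> nat \<Rightarrow> nat \<Rightarrow> nat" where
  "lpp0 \<equiv> lpp (\<lambda>_. False) (\<lambda>_. False)"

lemma finite_grid [simp]: "finite (grid N M)"
  by (simp add: grid_def)

lemma lpp_0_left [simp]: "lpp u v w 0 j = card {k. k < j \<and> v k}"
  by (cases j) auto

lemma card_less_Suc: "card {k. k < Suc i \<and> u k} = card {k. k < i \<and> u k} + of_bool (u i)"
proof -
  have "{k. k < Suc i \<and> u k} = (if u i then insert i {k. k < i \<and> u k} else {k. k < i \<and> u k})"
    by (auto simp: less_Suc_eq)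
  then show ?thesis by simp
qed

text \<open>
  Horizontal increments in row \<open>j\<close> are \<open>0\<close> or \<open>1\<close>; this bounds the vertical increments above row \<open>j\<close>,
  which in turn bounds the horizontal increments in row \<open>j + 1\<close>.  Hence both claims go together.
\<close>
lemma lpp_step_left:
  "lpp u v w i j \<le> lpp u v w (Suc i) j \<and> lpp u v w (Suc i) j \<le> Suc (lpp u v w i j)"
  and lpp_step_right:
  "lpp u v w i j \<le> lpp u v w i (Suc j) \<and> lpp u v w i (Suc j) \<le> Suc (lpp u v w i j)"
proof -
  have "(\<forall>i. lpp u v w i j \<le> lpp u v w (Suc i) j \<and> lpp u v w (Suc i) j \<le> Suc (lpp u v w i j)) \<and>
        (\<forall>i. lpp u v w i j \<le> lpp u v w i (Suc j) \<and> lpp u v w i (Suc j) \<le> Suc (lpp u v w i j))" for j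
  proof -
    have vert: "lpp u v w i j \<le> lpp u v w i (Suc j) \<and> lpp u v w i (Suc j) \<le> Suc (lpp u v w i j)"
      if hor: "\<forall>i. lpp u v w i j \<le> lpp u v w (Suc i) j \<and> lpp u v w (Suc i) j \<le> Suc (lpp u v w i j)"
      for i j
    proof (induction i)
      case 0
      then show ?case by (simp add: card_less_Suc del: lpp.simps(2))
    next
      case (Suc i)
      then show ?case using hor[rule_format, of i] by (auto simp: max_def)
    qed
    show ?thesis
    proof (induction j)
      case 0
      have "\<forall>i. lpp u v w i 0 \<le> lpp u v w (Suc i) 0 \<and> lpp u v w (Suc i) 0 \<le> Suc (lpp u v w i 0)"
        by (simp add: card_less_Suc)
      then show ?case using vert by blast
    next
      case (Suc j)
      have "lpp u v w i (Suc j) \<le> lpp u v w (Suc i) (Suc j) \<and>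
            lpp u v w (Suc i) (Suc j) \<le> Suc (lpp u v w i (Suc j))" for i
        using Suc[THEN conjunct1, rule_format, of i] Suc[THEN conjunct2, rule_format, of i]
        by (auto simp: max_def)
      then show ?case using vert by blast
    qed
  qed
  then show "lpp u v w i j \<le> lpp u v w (Suc i) j \<and> lpp u v w (Suc i) j \<le> Suc (lpp u v w i j)"
    and "lpp u v w i j \<le> lpp u v w i (Suc j) \<and> lpp u v w i (Suc j) \<le> Suc (lpp u v w i j)"
    by blast+
qed

lemma lpp_mono:
  assumes "i \<le> i'" "j \<le> j'"
  shows "lpp u v w i j \<le> lpp u v w i' j'"
proof -
  have "lpp u v w i j \<le> lpp u v w i' j"
    using assms(1) by (rule lift_Suc_mono_le[rotated]) (use lpp_step_left in blast)
  also have "\<dots> \<le> lpp u v w i' j'"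
    using assms(2) by (rule lift_Suc_mono_le[rotated]) (use lpp_step_right in blast)
  finally show ?thesis .
qed

lemma lpp_boundary_mono: "lpp0 w i j \<le> lpp u v w i j"
  by (induction u v w i j rule: lpp.induct) (auto simp: max_def)

lemma chain_length_le_lpp:
  assumes "set ps \<subseteq> {c. w c}" "set ps \<subseteq> grid N M" "sorted_wrt (grel 1) ps"
  shows "length ps \<le> lpp0 w N M"
  using assms
proof (induction ps arbitrary: N M rule: rev_induct)
  case (snoc c ps)
  obtain i j where c: "c = (i, j)" by fastforce
  have ij: "i < N" "j < M" "w (i, j)" using snoc.prems c by (auto simp: grid_def)
  have "set ps \<subseteq> grid i j"
    using snoc.prems(3) c by (force simp: sorted_wrt_append grel_def grid_def)
  then have "length ps \<le> lpp0 w i j"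
    using snoc.IH snoc.prems by (auto simp: sorted_wrt_append)
  moreover have "lpp0 w i j + 1 \<le> lpp0 w (Suc i) (Suc j)"
    using ij by simp
  moreover have "lpp0 w (Suc i) (Suc j) \<le> lpp0 w N M"
    using ij by (intro lpp_mono) auto
  ultimately have "length ps + 1 \<le> lpp0 w N M" by linarith
  then show ?case by simp
qed simp

lemma lpp_attained:
  "\<exists>ps. set ps \<subseteq> {c. w c} \<inter> grid N M \<and> sorted_wrt (grel 1) ps \<and> length ps = lpp0 w N M"
proof (induction "\<lambda>_::nat. False" "\<lambda>_::nat. False" w N M rule: lpp.induct)
  case (3 w i j)
  let ?P = "\<lambda>N M n. \<exists>ps. set ps \<subseteq> {c. w c} \<inter> grid N M \<and> sorted_wrt (grel 1) ps \<and> length ps = n"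
  have mono: "?P N' M' n" if "?P N M n" "N \<le> N'" "M \<le> M'" for N M N' M' n
  proof -
    have "grid N M \<subseteq> grid N' M'" using that by (auto simp: grid_def)
    with that(1) show ?thesis by blast
  qed
  have a: "?P (Suc i) (Suc j) (lpp0 w i (Suc j))" using 3(1) mono by (meson le_refl lessI less_imp_le)
  have b: "?P (Suc i) (Suc j) (lpp0 w (Suc i) j)" using 3(2) mono by (meson le_refl lessI less_imp_le)
  obtain ps where ps: "set ps \<subseteq> {c. w c} \<inter> grid i j" "sorted_wrt (grel 1) ps" "length ps = lpp0 w i j"
    using 3(3) by blast
  have c: "?P (Suc i) (Suc j) (lpp0 w i j + of_bool (w (i, j)))"
  proof (cases "w (i, j)")
    case True
    have "set (ps @ [(i, j)]) \<subseteq> {c. w c} \<inter> grid (Suc i) (Suc j)"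
      using ps(1) True by (auto simp: grid_def)
    moreover have "sorted_wrt (grel 1) (ps @ [(i, j)])"
      using ps(1,2) by (auto simp: sorted_wrt_append grel_def grid_def)
    ultimately show ?thesis using ps(3) True
      by (intro exI[of _ "ps @ [(i, j)]"]) auto
  next
    case False
    then show ?thesis using mono[of i j] ps by fastforce
  qed
  show ?case using a b c by (simp add: max_def)
qed (auto intro!: exI[of _ "[]"])

lemma has_chain_iff_lpp:
  "has_chain 1 n ({c. w c} \<inter> grid N M) \<longleftrightarrow> n \<le> lpp0 w N M"
proof
  assume "has_chain 1 n ({c. w c} \<inter> grid N M)"
  then show "n \<le> lpp0 w N M"
    using chain_length_le_lpp unfolding has_chain_def by (metis le_inf_iff)
next
  assume "n \<le> lpp0 w N M"
  moreover obtain ps where "set ps \<subseteq> {c. w c} \<inter> grid N M" "sorted_wrt (grel 1) ps"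
    "length ps = lpp0 w N M" using lpp_attained by blast
  ultimately show "has_chain 1 n ({c. w c} \<inter> grid N M)"
    unfolding has_chain_def
    by (intro exI[of _ "take n ps"]) (auto dest: in_set_takeD simp: sorted_wrt_take)
qed

text \<open>
  An optimal path runs along at most one of the two sides and leaves it for good at some point \<open>k\<close>;
  from there on it sees only the part of the grid beyond \<open>k\<close>.
\<close>
lemma lpp_exit_point:
  "(\<exists>k\<le>i. lpp u v w i j \<le> card {l. l < k \<and> u l} + lpp0 (\<lambda>(x, y). w (x + k, y)) (i - k) j) \<or>
   (\<exists>k\<le>j. lpp u v w i j \<le> card {l. l < k \<and> v l} + lpp0 (\<lambda>(x, y). w (x, y + k)) i (j - k))"
  (is "?H i j \<or> ?V i j")
proof (induction u v w i j rule: lpp.induct)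
  case (1 u v w i)
  then show ?case by auto
next
  case (2 u v w j)
  then show ?case by (auto simp del: lpp.simps(2))
next
  case (3 u v w i j)
  let ?Hs = "\<lambda>k i j. card {l. l < k \<and> u l} + lpp0 (\<lambda>(x, y). w (x + k, y)) (i - k) j"
  let ?Vs = "\<lambda>k i j. card {l. l < k \<and> v l} + lpp0 (\<lambda>(x, y). w (x, y + k)) i (j - k)"
  have mono: "?Hs k i j \<le> ?Hs k i' j'" "?Vs k i j \<le> ?Vs k i' j'" if "i \<le> i'" "j \<le> j'" for k i i' j j'
    using that by (auto intro!: lpp_mono)
  let ?goal = "\<lambda>n. (\<exists>k\<le>Suc i. n \<le> ?Hs k (Suc i) (Suc j)) \<or> (\<exists>k\<le>Suc j. n \<le> ?Vs k (Suc i) (Suc j))"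
  have g1: "?goal (lpp u v w i (Suc j))"
    using 3(1) mono[of i "Suc i" "Suc j" "Suc j"] by (meson le_SucI le_refl le_trans lessI less_imp_le)
  have g2: "?goal (lpp u v w (Suc i) j)"
    using 3(2) mono[of "Suc i" "Suc i" "j" "Suc j"] by (meson le_SucI le_refl le_trans lessI less_imp_le)
  have g3: "?goal (lpp u v w i j + of_bool (w (i, j)))"
    using 3(3)
  proof
    assume "\<exists>k\<le>i. lpp u v w i j \<le> ?Hs k i j"
    then obtain k where k: "k \<le> i" "lpp u v w i j \<le> ?Hs k i j" by blast
    have "?Hs k i j + of_bool (w (i, j)) \<le> ?Hs k (Suc i) (Suc j)"
      using k(1) by (simp add: Suc_diff_le)
    with k show ?thesis by (meson add_mono le_SucI le_refl le_trans)
  next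
    assume "\<exists>k\<le>j. lpp u v w i j \<le> ?Vs k i j"
    then obtain k where k: "k \<le> j" "lpp u v w i j \<le> ?Vs k i j" by blast
    have "?Vs k i j + of_bool (w (i, j)) \<le> ?Vs k (Suc i) (Suc j)"
      using k(1) by (simp add: Suc_diff_le)
    with k show ?thesis by (meson add_mono le_SucI le_refl le_trans)
  qed
  have "lpp u v w (Suc i) (Suc j) = lpp u v w i (Suc j) \<or>
      lpp u v w (Suc i) (Suc j) = lpp u v w (Suc i) j \<or>
      lpp u v w (Suc i) (Suc j) = lpp u v w i j + of_bool (w (i, j))"
    by (simp add: max_def)
  then show ?case
  proof (elim disjE)
    assume e: "lpp u v w (Suc i) (Suc j) = lpp u v w i (Suc j)"
    show ?case unfolding e by (rule g1)
  next
    assume e: "lpp u v w (Suc i) (Suc j) = lpp u v w (Suc i) j"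
    show ?case unfolding e by (rule g2)
  next
    assume e: "lpp u v w (Suc i) (Suc j) = lpp u v w i j + of_bool (w (i, j))"
    show ?case unfolding e by (rule g3)
  qed
qed

lemma lpp_shift_mono:
  assumes "k \<le> k'"
  shows "lpp0 (\<lambda>(x, y). w (x + k', y)) (i - k') j \<le> lpp0 (\<lambda>(x, y). w (x + k, y)) (i - k) j"
  and "lpp0 (\<lambda>(x, y). w (x, y + k')) j (i - k') \<le> lpp0 (\<lambda>(x, y). w (x, y + k)) j (i - k)"
proof -
  obtain ps where ps: "set ps \<subseteq> {c. case c of (x, y) \<Rightarrow> w (x + k', y)} \<inter> grid (i - k') j"
     "sorted_wrt (grel 1) ps" "length ps = lpp0 (\<lambda>(x, y). w (x + k', y)) (i - k') j"
    using lpp_attained by blast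
  have "length (map (\<lambda>(x, y). (x + (k' - k), y)) ps) \<le> lpp0 (\<lambda>(x, y). w (x + k, y)) (i - k) j"
    using ps assms by (intro chain_length_le_lpp) (auto simp: sorted_wrt_map grid_def grel_def elim!: sorted_wrt_mono_rel[rotated])
  with ps show "lpp0 (\<lambda>(x, y). w (x + k', y)) (i - k') j \<le> lpp0 (\<lambda>(x, y). w (x + k, y)) (i - k) j"
    by simp
  obtain ps where ps: "set ps \<subseteq> {c. case c of (x, y) \<Rightarrow> w (x, y + k')} \<inter> grid j (i - k')"
     "sorted_wrt (grel 1) ps" "length ps = lpp0 (\<lambda>(x, y). w (x, y + k')) j (i - k')"
    using lpp_attained by blast
  have "length (map (\<lambda>(x, y). (x, y + (k' - k))) ps) \<le> lpp0 (\<lambda>(x, y). w (x, y + k)) j (i - k)"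
    using ps assms by (intro chain_length_le_lpp) (auto simp: sorted_wrt_map grid_def grel_def elim!: sorted_wrt_mono_rel[rotated])
  with ps show "lpp0 (\<lambda>(x, y). w (x, y + k')) j (i - k') \<le> lpp0 (\<lambda>(x, y). w (x, y + k)) j (i - k)"
    by simp
qed

section \<open>The stationary field with sources and sinks\<close>

abbreviation bernoulli_field :: "'c set \<Rightarrow> real \<Rightarrow> ('c \<Rightarrow> bool) pmf" where
  "bernoulli_field A p \<equiv> Pi_pmf A False (\<lambda>_. bernoulli_pmf p)"

definition hstep :: "(nat \<Rightarrow> bool) \<Rightarrow> (nat \<Rightarrow> bool) \<Rightarrow> (nat \<times> nat \<Rightarrow> bool) \<Rightarrow> nat \<Rightarrow> nat \<Rightarrow> bool" where
  "hstep u v w i j \<longleftrightarrow> lpp u v w i j < lpp u v w (Suc i) j"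

definition vstep :: "(nat \<Rightarrow> bool) \<Rightarrow> (nat \<Rightarrow> bool) \<Rightarrow> (nat \<times> nat \<Rightarrow> bool) \<Rightarrow> nat \<Rightarrow> nat \<Rightarrow> bool" where
  "vstep u v w i j \<longleftrightarrow> lpp u v w i j < lpp u v w i (Suc j)"

lemma hstep_0: "hstep u v w i 0 = u i"
  by (simp add: hstep_def card_less_Suc)

lemma vstep_0: "vstep u v w 0 j = v j"
  by (simp add: vstep_def card_less_Suc del: lpp.simps(2))

text \<open>
  The local rule of Hammersley's lines: a horizontal and a vertical step entering a cell annihilate, an
  occupied cell that no step enters emits one of each, and otherwise a step goes straight on.
\<close>
lemma hstep_Suc: "hstep u v w i (Suc j) \<longleftrightarrow> \<not> vstep u v w i j \<and> (hstep u v w i j \<or> w (i, j))"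
  using lpp_step_left[of u v w i j] lpp_step_right[of u v w i j] by (auto simp: hstep_def vstep_def max_def)

lemma vstep_Suc: "vstep u v w (Suc i) j \<longleftrightarrow> \<not> hstep u v w i j \<and> (vstep u v w i j \<or> w (i, j))"
  using lpp_step_left[of u v w i j] lpp_step_right[of u v w i j] by (auto simp: hstep_def vstep_def max_def)

lemma lpp_eq_sum_hstep: "lpp u v w N M = card {j. j < M \<and> v j} + card {i. i < N \<and> hstep u v w i M}"
proof (induction N)
  case (Suc N)
  show ?case
    using Suc lpp_step_left[of u v w N M]
    unfolding card_less_Suc[where i = N and u = "\<lambda>i. hstep u v w i M"] by (auto simp: hstep_def)
qed simp

lemma lpp_cong: "(\<And>c. c \<in> grid i j \<Longrightarrow> w c = w' c) \<Longrightarrow> lpp u v w i j = lpp u v w' i j"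
proof (induction u v w i j rule: lpp.induct)
  case (3 u v w i j)
  have "lpp u v w i (Suc j) = lpp u v w' i (Suc j)" "lpp u v w (Suc i) j = lpp u v w' (Suc i) j"
       "lpp u v w i j = lpp u v w' i j"
    using 3 by (force simp: grid_def)+
  then show ?case using 3(4)[of "(i, j)"] by (simp add: grid_def)
qed auto

text \<open>
  The steps along the staircase that separates the cells already explored from the others, when rows
  below \<open>j\<close> and the first \<open>i\<close> cells of row \<open>j\<close> have been explored.  Indices not crossed by the staircase
  keep the boundary values, so that the map is the identity at the start.
\<close>
definition front where
  "front N s w i j = (case s of (u, v) \<Rightarrow>
     (\<lambda>i'. if i' < i then hstep u v w i' (Suc j) else if i' < N then hstep u v w i' j else u i',
      \<lambda>j'. if j' < j then vstep u v w N j' else if j' = j then vstep u v w i j else v j'))"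

definition update where
  "update i j x s = (case s of (u, v) \<Rightarrow>
     (u(i := \<not> v j \<and> (u i \<or> x)), v(j := \<not> u i \<and> (v j \<or> x))))"

lemma front_0: "front N s w 0 0 = s"
  by (cases s) (auto simp: front_def fun_eq_iff hstep_0 vstep_0)

lemma front_next_row: "front N s w N j = front N s w 0 (Suc j)"
  by (cases s) (auto simp: front_def fun_eq_iff vstep_0 less_Suc_eq)

lemma front_Suc: "i < N \<Longrightarrow> front N s w (Suc i) j = update i j (w (i, j)) (front N s w i j)"
  by (cases s) (auto simp: front_def update_def fun_eq_iff hstep_Suc vstep_Suc less_Suc_eq)

lemma front_upd: "front N s (w((i, j) := x)) i j = front N s w i j"
proof -
  have "lpp u v (w((i, j) := x)) i' j' = lpp u v w i' j'" if "i' \<le> i \<or> j' \<le> j" for u v i' j'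
    using that by (intro lpp_cong) (auto simp: grid_def)
  note * = this
  show ?thesis by (cases s) (auto simp: front_def fun_eq_iff hstep_def vstep_def *)
qed

text \<open>
  The local rule turns two steps into none, turns none into two if the cell is occupied, and fixes
  the mixed pairs.  A product law is therefore invariant as soon as the two exchanges have equal
  probability, which is the assumed equation.
\<close>
lemma burke_local_rule:
  assumes "\<alpha> \<in> {0..1}" "\<beta> \<in> {0..1}" "p \<in> {0..1}" and eq: "\<alpha> * \<beta> = p * (1 - \<alpha>) * (1 - \<beta>)"
  shows "do {x \<leftarrow> bernoulli_pmf \<alpha>; y \<leftarrow> bernoulli_pmf \<beta>; z \<leftarrow> bernoulli_pmf p;
             return_pmf (\<not> y \<and> (x \<or> z), \<not> x \<and> (y \<or> z))} =
         pair_pmf (bernoulli_pmf \<alpha>) (bernoulli_pmf \<beta>)" (is "?L = ?R")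
proof (rule pmf_eqI)
  fix c :: "bool \<times> bool"
  obtain a b where c: "c = (a, b)" by fastforce
  show "pmf ?L c = pmf ?R c"
    using assms(1-3) eq unfolding c
    by (cases a; cases b) (simp_all add: pmf_bind pmf_pair, algebra+)
qed

lemma burke_one_cell:
  assumes "\<alpha> \<in> {0..1}" "\<beta> \<in> {0..1}" "p \<in> {0..1}" and eq: "\<alpha> * \<beta> = p * (1 - \<alpha>) * (1 - \<beta>)"
    and fin: "finite A" "finite B" and ij: "i \<in> A" "j \<in> B"
  shows "do {s \<leftarrow> pair_pmf (bernoulli_field A \<alpha>) (bernoulli_field B \<beta>); x \<leftarrow> bernoulli_pmf p;
             return_pmf (update i j x s)} =
         pair_pmf (bernoulli_field A \<alpha>) (bernoulli_field B \<beta>)"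
proof -
  define A' B' where "A' = A - {i}" "B' = B - {j}"
  define F where "F Q = do {u \<leftarrow> bernoulli_field A' \<alpha>; v \<leftarrow> bernoulli_field B' \<beta>; (a, b) \<leftarrow> Q;
    return_pmf (u(i := a), v(j := b))}" for Q :: "(bool \<times> bool) pmf"
  have A: "A = insert i A'" "i \<notin> A'" "finite A'" and B: "B = insert j B'" "j \<notin> B'" "finite B'"
    using ij fin by (auto simp: A'_B'_def)
  have *: "pair_pmf (bernoulli_field A \<alpha>) (bernoulli_field B \<beta>) \<bind> g =
     do {u \<leftarrow> bernoulli_field A' \<alpha>; v \<leftarrow> bernoulli_field B' \<beta>; a \<leftarrow> bernoulli_pmf \<alpha>; b \<leftarrow> bernoulli_pmf \<beta>;
         g (u(i := a), v(j := b))}" for g :: "_ \<Rightarrow> ((_ \<Rightarrow> bool) \<times> (_ \<Rightarrow> bool)) pmf"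
  proof -
    have "pair_pmf (bernoulli_field A \<alpha>) (bernoulli_field B \<beta>) \<bind> g =
      do {a \<leftarrow> bernoulli_pmf \<alpha>; u \<leftarrow> bernoulli_field A' \<alpha>; b \<leftarrow> bernoulli_pmf \<beta>; v \<leftarrow> bernoulli_field B' \<beta>;
         g (u(i := a), v(j := b))}"
      unfolding A(1) B(1) Pi_pmf_insert'[OF A(3,2)] Pi_pmf_insert'[OF B(3,2)] pair_pmf_def
      by (simp add: bind_assoc_pmf bind_return_pmf)
    also have "\<dots> = do {u \<leftarrow> bernoulli_field A' \<alpha>; a \<leftarrow> bernoulli_pmf \<alpha>; v \<leftarrow> bernoulli_field B' \<beta>; b \<leftarrow> bernoulli_pmf \<beta>;
         g (u(i := a), v(j := b))}"
      by (subst bind_commute_pmf, intro bind_pmf_cong refl, rule bind_commute_pmf)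
    also have "\<dots> = do {u \<leftarrow> bernoulli_field A' \<alpha>; v \<leftarrow> bernoulli_field B' \<beta>; a \<leftarrow> bernoulli_pmf \<alpha>; b \<leftarrow> bernoulli_pmf \<beta>;
         g (u(i := a), v(j := b))}"
      by (intro bind_pmf_cong refl, rule bind_commute_pmf)
    finally show ?thesis .
  qed
  have "do {s \<leftarrow> pair_pmf (bernoulli_field A \<alpha>) (bernoulli_field B \<beta>); x \<leftarrow> bernoulli_pmf p;
             return_pmf (update i j x s)} =
        F (do {x \<leftarrow> bernoulli_pmf \<alpha>; y \<leftarrow> bernoulli_pmf \<beta>; z \<leftarrow> bernoulli_pmf p;
             return_pmf (\<not> y \<and> (x \<or> z), \<not> x \<and> (y \<or> z))})"
    unfolding * F_def by (simp add: update_def bind_assoc_pmf bind_return_pmf)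
  also have "\<dots> = F (pair_pmf (bernoulli_pmf \<alpha>) (bernoulli_pmf \<beta>))"
    using assms by (simp add: burke_local_rule)
  also have "\<dots> = pair_pmf (bernoulli_field A \<alpha>) (bernoulli_field B \<beta>) \<bind> return_pmf"
    unfolding * F_def by (simp add: pair_pmf_def bind_assoc_pmf bind_return_pmf)
  finally show ?thesis by (simp add: bind_return_pmf')
qed

text \<open>
  Exploring one more cell applies the local rule to two independent steps and a cell that has not been
  used before; so the law of the steps on the staircase never changes.
\<close>
lemma burke_property:
  fixes N M i j :: nat
  assumes "\<alpha> \<in> {0..1}" "\<beta> \<in> {0..1}" "p \<in> {0..1}" and eq: "\<alpha> * \<beta> = p * (1 - \<alpha>) * (1 - \<beta>)"
  defines "S \<equiv> pair_pmf (bernoulli_field {..<N} \<alpha>) (bernoulli_field {..<M} \<beta>)"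
  assumes "i \<le> N" "j < M"
  shows "map_pmf (\<lambda>(s, w). front N s w i j)
           (pair_pmf S (bernoulli_field (grid N j \<union> {..<i} \<times> {j}) p)) = S"
proof -
  let ?D = "\<lambda>i j. grid N j \<union> {..<i} \<times> {j}"
  let ?P = "\<lambda>i j. map_pmf (\<lambda>(s, w). front N s w i j) (pair_pmf S (bernoulli_field (?D i j) p)) = S"
  have start: "?P 0 0"
    by (simp add: front_0 grid_def case_prod_unfold map_fst_pair_pmf)
  have step: "?P (Suc i) j" if IH: "?P i j" and ij: "i < N" "j < M" for i j
  proof -
    have ins: "?D (Suc i) j = insert (i, j) (?D i j)" "(i, j) \<notin> ?D i j" "finite (?D i j)"
      by (auto simp: grid_def less_Suc_eq)
    have "map_pmf (\<lambda>(s, w). front N s w (Suc i) j) (pair_pmf S (bernoulli_field (?D (Suc i) j) p)) =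
       do {s \<leftarrow> S; x \<leftarrow> bernoulli_pmf p; w \<leftarrow> bernoulli_field (?D i j) p;
           return_pmf (front N s (w((i, j) := x)) (Suc i) j)}"
      unfolding ins(1) Pi_pmf_insert'[OF ins(3,2)]
      by (simp add: map_pmf_def pair_pmf_def bind_assoc_pmf bind_return_pmf)
    also have "\<dots> = do {s \<leftarrow> S; x \<leftarrow> bernoulli_pmf p; w \<leftarrow> bernoulli_field (?D i j) p;
           return_pmf (update i j x (front N s w i j))}"
      using ij by (simp add: front_Suc front_upd)
    also have "\<dots> = do {s \<leftarrow> S; w \<leftarrow> bernoulli_field (?D i j) p; x \<leftarrow> bernoulli_pmf p;
           return_pmf (update i j x (front N s w i j))}"
      by (intro bind_pmf_cong refl, rule bind_commute_pmf)
    also have "\<dots> = do {s \<leftarrow> map_pmf (\<lambda>(s, w). front N s w i j) (pair_pmf S (bernoulli_field (?D i j) p));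
           x \<leftarrow> bernoulli_pmf p; return_pmf (update i j x s)}"
      by (simp add: map_pmf_def pair_pmf_def bind_assoc_pmf bind_return_pmf)
    also have "\<dots> = S"
      unfolding IH unfolding S_def using assms(1-4) ij by (intro burke_one_cell) auto
    finally show ?thesis .
  qed
  have row: "?P i j" if "?P 0 j" "i \<le> N" "j < M" for i j
    using that(2) by (induction i) (use that step in auto)
  have "?P 0 j" if "j < M" for j
    using that
  proof (induction j)
    case (Suc j)
    have "?D N j = ?D 0 (Suc j)" by (auto simp: grid_def less_Suc_eq)
    then show ?case using row[of j N] Suc by (simp add: front_next_row)
  qed (rule start)
  then show ?thesis using row assms by blast
qed

definition stationary_field where
  "stationary_field N M \<alpha> \<beta> p = pair_pmf (pair_pmf (bernoulli_field {..<N} \<alpha>) (bernoulli_field {..<M} \<beta>))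
     (bernoulli_field (grid N M) p)"

lemma stationary_top_row:
  assumes "\<alpha> \<in> {0..1}" "\<beta> \<in> {0..1}" "p \<in> {0..1}" and eq: "\<alpha> * \<beta> = p * (1 - \<alpha>) * (1 - \<beta>)"
  shows "map_pmf (\<lambda>((u, v), w). card {i. i < N \<and> hstep u v w i M}) (stationary_field N M \<alpha> \<beta> p) = binomial_pmf N \<alpha>"
proof -
  let ?S = "pair_pmf (bernoulli_field {..<N} \<alpha>) (bernoulli_field {..<M} \<beta>)"
  have "binomial_pmf N \<alpha> = map_pmf (\<lambda>u. card {i\<in>{..<N}. u i}) (bernoulli_field {..<N} \<alpha>)"
    using assms by (intro binomial_pmf_altdef') auto
  also have "\<dots> = map_pmf (\<lambda>s. card {i. i < N \<and> fst s i}) ?S"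
    by (subst (2) map_fst_pair_pmf[symmetric, where B = "bernoulli_field {..<M} \<beta>"]) (simp add: pmf.map_comp o_def)
  also have "\<dots> = map_pmf (\<lambda>((u, v), w). card {i. i < N \<and> hstep u v w i M}) (stationary_field N M \<alpha> \<beta> p)"
  proof (cases M)
    case 0
    show ?thesis
      unfolding stationary_field_def 0
      by (subst map_fst_pair_pmf[symmetric, where B = "bernoulli_field (grid N 0) p"])
        (simp add: pmf.map_comp o_def hstep_0 case_prod_unfold del: lpp.simps)
  next
    case (Suc M')
    have D: "grid N M' \<union> {..<N} \<times> {M'} = grid N M"
      by (auto simp: Suc grid_def)
    have "?S = map_pmf (\<lambda>(s, w). front N s w N M') (pair_pmf ?S (bernoulli_field (grid N M) p))"
      using burke_property[OF assms, of N N M' M] by (simp add: D Suc)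
    then have "map_pmf (\<lambda>s. card {i. i < N \<and> fst s i}) ?S =
       map_pmf (\<lambda>s. card {i. i < N \<and> fst s i}) (map_pmf (\<lambda>(s, w). front N s w N M') (stationary_field N M \<alpha> \<beta> p))"
      by (simp add: stationary_field_def)
    also have "\<dots> = map_pmf (\<lambda>((u, v), w). card {i. i < N \<and> hstep u v w i M}) (stationary_field N M \<alpha> \<beta> p)"
      by (simp add: pmf.map_comp o_def case_prod_unfold front_def Suc cong: conj_cong del: lpp.simps)
    finally show ?thesis .
  qed
  finally show ?thesis ..
qed

lemma stationary_marginals:
  shows "map_pmf (\<lambda>((u, v), w). u) (stationary_field N M \<alpha> \<beta> p) = bernoulli_field {..<N} \<alpha>"
  and "map_pmf (\<lambda>((u, v), w). v) (stationary_field N M \<alpha> \<beta> p) = bernoulli_field {..<M} \<beta>"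
  and "map_pmf snd (stationary_field N M \<alpha> \<beta> p) = bernoulli_field (grid N M) p"
proof -
  have "map_pmf (\<lambda>((u, v), w). u) (stationary_field N M \<alpha> \<beta> p) =
    map_pmf fst (map_pmf fst (stationary_field N M \<alpha> \<beta> p))"
    by (simp add: pmf.map_comp o_def case_prod_unfold)
  then show "map_pmf (\<lambda>((u, v), w). u) (stationary_field N M \<alpha> \<beta> p) = bernoulli_field {..<N} \<alpha>"
    by (simp add: stationary_field_def map_fst_pair_pmf)
  have "map_pmf (\<lambda>((u, v), w). v) (stationary_field N M \<alpha> \<beta> p) =
    map_pmf snd (map_pmf fst (stationary_field N M \<alpha> \<beta> p))"
    by (simp add: pmf.map_comp o_def case_prod_unfold)
  then show "map_pmf (\<lambda>((u, v), w). v) (stationary_field N M \<alpha> \<beta> p) = bernoulli_field {..<M} \<beta>"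
    by (simp add: stationary_field_def map_fst_pair_pmf map_snd_pair_pmf)
  show "map_pmf snd (stationary_field N M \<alpha> \<beta> p) = bernoulli_field (grid N M) p"
    by (simp add: stationary_field_def map_snd_pair_pmf)
qed

text \<open>
  Restrictions, translations and prefixes of a field are all instances of this lemma.
\<close>
lemma bernoulli_field_reindex:
  assumes "finite A" "finite B" "inj_on f B" "f ` B \<subseteq> A"
  shows "map_pmf (\<lambda>w x. x \<in> B \<and> w (f x)) (bernoulli_field A p) = bernoulli_field B p"
proof -
  let ?g = "\<lambda>x. if x \<in> B then Some (f x) else None"
  have bij: "bij_betw f B (f ` B)" using assms by (simp add: bij_betw_def)
  obtain h where h: "\<And>x. x \<in> B \<Longrightarrow> h (f x) = x" using assms(3) by (metis inv_into_f_f)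
  have "map_pmf (\<lambda>w x. x \<in> B \<and> w (f x)) (bernoulli_field A p) =
    map_pmf (\<lambda>w x. x \<in> B \<and> w (f x)) (map_pmf (\<lambda>w x. if x \<in> f ` B then w x else False) (bernoulli_field A p))"
    unfolding pmf.map_comp o_def by (intro map_pmf_cong refl) (auto simp: fun_eq_iff)
  also have "\<dots> = map_pmf (\<lambda>w x. x \<in> B \<and> w (f x)) (bernoulli_field (f ` B) p)"
    using Pi_pmf_subset[of A "f ` B" False "\<lambda>_. bernoulli_pmf p"] assms by simp
  also have "\<dots> = bernoulli_field B p"
  proof (rule pmf_eqI)
    fix g :: "'b \<Rightarrow> bool"
    let ?F = "\<lambda>w x. x \<in> B \<and> w (f x)"
    show "pmf (map_pmf ?F (bernoulli_field (f ` B) p)) g = pmf (bernoulli_field B p) g"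
    proof (cases "\<forall>x. x \<notin> B \<longrightarrow> \<not> g x")
      case True
      define g' where "g' y = (y \<in> f ` B \<and> g (h y))" for y
      have "pmf (map_pmf ?F (bernoulli_field (f ` B) p)) g =
         measure_pmf.prob (bernoulli_field (f ` B) p) (?F -` {g})"
        by (simp add: pmf_map)
      also have "\<dots> = measure_pmf.prob (bernoulli_field (f ` B) p) {g'}"
      proof (intro measure_pmf.finite_measure_eq_AE AE_pmfI)
        fix w assume "w \<in> set_pmf (bernoulli_field (f ` B) p)"
        then have out: "\<not> w y" if "y \<notin> f ` B" for y
          using that assms set_Pi_pmf_subset[of "f ` B" False "\<lambda>_. bernoulli_pmf p"] by auto
        have "w = g'" if "?F w = g"
        proof
          fix y
          have "w (f x) = g x" if "x \<in> B" for x using \<open>?F w = g\<close> that by auto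
          then show "w y = g' y" using out by (cases "y \<in> f ` B") (auto simp: g'_def h)
        qed
        moreover have "?F g' x = g x" for x
          using True by (cases "x \<in> B") (auto simp: g'_def h)
        ultimately show "w \<in> ?F -` {g} \<longleftrightarrow> w \<in> {g'}" by auto
      qed auto
      also have "\<dots> = pmf (bernoulli_field (f ` B) p) g'"
        by (simp add: measure_pmf_single)
      also have "\<dots> = (\<Prod>y\<in>f ` B. pmf (bernoulli_pmf p) (g' y))"
        using assms by (subst pmf_Pi') (auto simp: g'_def)
      also have "\<dots> = (\<Prod>x\<in>B. pmf (bernoulli_pmf p) (g x))"
        using assms h by (subst prod.reindex) (auto simp: g'_def intro!: prod.cong)
      also have "\<dots> = pmf (bernoulli_field B p) g"
        using assms True by (subst pmf_Pi') auto
      finally show ?thesis .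
    next
      case False
      then have "pmf (bernoulli_field B p) g = 0" using assms by (subst pmf_Pi) auto
      moreover have "pmf (map_pmf ?F (bernoulli_field (f ` B) p)) g = 0"
        using False by (intro pmf_map_outside) (auto simp: fun_eq_iff)
      ultimately show ?thesis by simp
    qed
  qed
  finally show ?thesis .
qed

lemma binomial_moments:
  assumes p: "p \<in> {0..1}"
  shows "measure_pmf.expectation (binomial_pmf n p) real = n * p \<and>
         measure_pmf.expectation (binomial_pmf n p) (\<lambda>k. (real k - n * p)\<^sup>2) = n * p * (1 - p)"
proof (induction n)
  case 0
  then show ?case using p by (simp add: binomial_pmf_0)
next
  case (Suc n)
  let ?E = "measure_pmf.expectation (binomial_pmf n p)"
  have int: "integrable (measure_pmf (binomial_pmf n p)) f" for f :: "nat \<Rightarrow> real"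
    using p by (intro integrable_measure_pmf_finite) (simp add: set_pmf_binomial_eq)
  have fin: "finite (set_pmf (binomial_pmf n p))" using p by (simp add: set_pmf_binomial_eq)
  have rec: "measure_pmf.expectation (binomial_pmf (Suc n) p) f =
      p * ?E (\<lambda>k. f (Suc k)) + (1 - p) * ?E f" for f :: "nat \<Rightarrow> real"
  proof -
    have "binomial_pmf (Suc n) p = bernoulli_pmf p \<bind> (\<lambda>b. map_pmf (\<lambda>k. (if b then 1 else 0) + k) (binomial_pmf n p))"
      using p by (simp add: binomial_pmf_Suc map_pmf_def)
    then have "measure_pmf.expectation (binomial_pmf (Suc n) p) f =
       (\<Sum>b\<in>UNIV. pmf (bernoulli_pmf p) b *\<^sub>R measure_pmf.expectation (map_pmf (\<lambda>k. (if b then 1 else 0) + k) (binomial_pmf n p)) f)"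
      using fin by (simp only:) (rule pmf_expectation_bind, auto)
    then show ?thesis using p by (simp add: UNIV_bool)
  qed
  have m: "?E real = n * p" and v: "?E (\<lambda>k. (real k - n * p)\<^sup>2) = n * p * (1 - p)" using Suc by auto
  have e1: "measure_pmf.expectation (binomial_pmf (Suc n) p) real = Suc n * p"
    unfolding rec using int m by (simp add: algebra_simps)
  have shift: "?E (\<lambda>k. (real k + s - real (Suc n) * p)\<^sup>2) = n * p * (1 - p) + (s - p)\<^sup>2" for s
  proof -
    have "(real k + s - real (Suc n) * p)\<^sup>2 =
        (real k - n * p)\<^sup>2 + (2 * (s - p) * real k - 2 * (s - p) * (n * p)) + (s - p)\<^sup>2" for k
      by (simp add: power2_eq_square algebra_simps)
    then have "?E (\<lambda>k. (real k + s - real (Suc n) * p)\<^sup>2) =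
        ?E (\<lambda>k. (real k - n * p)\<^sup>2 + (2 * (s - p) * real k - 2 * (s - p) * (n * p)) + (s - p)\<^sup>2)"
      by (simp only:)
    also have "\<dots> = ?E (\<lambda>k. (real k - n * p)\<^sup>2) + (2 * (s - p) * ?E real - 2 * (s - p) * (n * p)) + (s - p)\<^sup>2"
      using int by simp
    finally show ?thesis using m v by simp
  qed
  have up: "?E (\<lambda>k. (real (Suc k) - real (Suc n) * p)\<^sup>2) = n * p * (1 - p) + (1 - p)\<^sup>2"
    using shift[of 1] by (simp add: add_ac)
  have down: "?E (\<lambda>k. (real k - real (Suc n) * p)\<^sup>2) = n * p * (1 - p) + p\<^sup>2"
    using shift[of 0] by simp
  have "measure_pmf.expectation (binomial_pmf (Suc n) p) (\<lambda>k. (real k - Suc n * p)\<^sup>2) = Suc n * p * (1 - p)"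
    unfolding rec up down by (simp add: power2_eq_square algebra_simps)
  with e1 show ?case by blast
qed

text \<open>
  For small \<open>p\<close> the variance matters, not the number of trials: the bound is useful already for
  deviations of order \<open>n p\<close> with \<open>n p\<close> large, where Hoeffding's inequality says nothing.
\<close>
lemma binomial_concentration:
  assumes p: "p \<in> {0..1}" and "x > 0"
  shows "measure_pmf.prob (binomial_pmf n p) {k. x \<le> \<bar>real k - n * p\<bar>} \<le> n * p / x\<^sup>2"
proof -
  have int: "integrable (measure_pmf (binomial_pmf n p)) f" for f :: "nat \<Rightarrow> real"
    using p by (intro integrable_measure_pmf_finite) (simp add: set_pmf_binomial_eq)
  have "measure_pmf.prob (binomial_pmf n p) {k. x \<le> \<bar>real k - n * p\<bar>} \<le> n * p * (1 - p) / x\<^sup>2"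
    using measure_pmf.Chebyshev_inequality[where M = "binomial_pmf n p" and f = real and a = x] int \<open>x > 0\<close> binomial_moments[OF p, of n]
    by simp
  also have "\<dots> \<le> n * p / x\<^sup>2"
    using p \<open>x > 0\<close> by (intro divide_right_mono) (auto simp: mult_left_le)
  finally show ?thesis .
qed

section \<open>The law of large numbers for thin grids without gaps\<close>

text \<open>
  The distribution is allowed to move with the index, as the grids below grow along the filter.
\<close>
definition vanishing :: "('i \<Rightarrow> 'b pmf) \<Rightarrow> ('i \<Rightarrow> 'b set) \<Rightarrow> 'i filter \<Rightarrow> bool" where
  "vanishing P A F \<longleftrightarrow> ((\<lambda>t. measure_pmf.prob (P t) (A t)) \<longlongrightarrow> 0) F"

lemma vanishing_le:
  assumes "vanishing P A F" "\<forall>\<^sub>F t in F. measure_pmf.prob (Q t) (B t) \<le> measure_pmf.prob (P t) (A t)"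
  shows "vanishing Q B F"
  using assms unfolding vanishing_def
  by (intro tendsto_sandwich[OF _ assms(2), of "\<lambda>_. 0"]) auto

lemma vanishing_subset:
  assumes "vanishing P A F" "\<forall>\<^sub>F t in F. B t \<subseteq> A t"
  shows "vanishing P B F"
  using assms(2) by (intro vanishing_le[OF assms(1)]) (auto elim!: eventually_mono intro!: measure_pmf.finite_measure_mono)

lemma vanishing_Un:
  assumes "vanishing P A F" "vanishing P B F"
  shows "vanishing P (\<lambda>t. A t \<union> B t) F"
  unfolding vanishing_def
proof (rule tendsto_sandwich[of "\<lambda>_. 0" _ _ "\<lambda>t. measure_pmf.prob (P t) (A t) + measure_pmf.prob (P t) (B t)"])
  show "((\<lambda>t. measure_pmf.prob (P t) (A t) + measure_pmf.prob (P t) (B t)) \<longlongrightarrow> 0) F"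
    using tendsto_add[OF assms[unfolded vanishing_def]] by simp
qed (auto intro!: always_eventually measure_Un_le)

lemma vanishing_UN:
  assumes "finite I" "\<And>i. i \<in> I \<Longrightarrow> vanishing P (A i) F"
  shows "vanishing P (\<lambda>t. \<Union>i\<in>I. A i t) F"
  using assms by (induction I) (auto intro!: vanishing_Un simp: vanishing_def[of _ "\<lambda>_. {}"])

lemma vanishing_map:
  assumes "vanishing Q A F" "\<forall>\<^sub>F t in F. map_pmf (f t) (P t) = Q t"
  shows "vanishing P (\<lambda>t. f t -` A t) F"
  by (rule vanishing_le[OF assms(1)]) (use assms(2) in \<open>auto elim!: eventually_mono simp flip: measure_map_pmf\<close>)

lemma binomial_vanishing:
  fixes n :: "'i \<Rightarrow> nat" and q \<tau> :: "'i \<Rightarrow> real"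
  assumes lim: "((\<lambda>t. n t * q t / \<tau> t) \<longlongrightarrow> y) F" and \<tau>: "filterlim \<tau> at_top F"
    and q: "\<forall>\<^sub>F t in F. q t \<in> {0..1}" and "\<epsilon> > 0"
  shows "vanishing (\<lambda>t. binomial_pmf (n t) (q t)) (\<lambda>t. {k. \<epsilon> * \<tau> t \<le> \<bar>real k - n t * q t\<bar>}) F"
proof -
  let ?u = "\<lambda>t. (n t * q t / \<tau> t) * (1 / \<epsilon>\<^sup>2) * inverse (\<tau> t)"
  show ?thesis unfolding vanishing_def
  proof (rule tendsto_sandwich[of "\<lambda>_. 0" _ _ ?u])
    have "(?u \<longlongrightarrow> y * (1 / \<epsilon>\<^sup>2) * 0) F"
      by (intro tendsto_intros lim tendsto_inverse_0_at_top \<tau>)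
    then show "(?u \<longlongrightarrow> 0) F" by simp
    have "\<forall>\<^sub>F t in F. \<tau> t > 0" using \<tau> by (simp add: filterlim_at_top_dense)
    then show "\<forall>\<^sub>F t in F. measure_pmf.prob (binomial_pmf (n t) (q t)) {k. \<epsilon> * \<tau> t \<le> \<bar>real k - n t * q t\<bar>}
       \<le> ?u t"
      using q
    proof eventually_elim
      case (elim t)
      have "measure_pmf.prob (binomial_pmf (n t) (q t)) {k. \<epsilon> * \<tau> t \<le> \<bar>real k - n t * q t\<bar>} \<le> n t * q t / (\<epsilon> * \<tau> t)\<^sup>2"
        using elim \<open>\<epsilon> > 0\<close> by (intro binomial_concentration) auto
      also have "\<dots> = ?u t"
        using elim \<open>\<epsilon> > 0\<close> by (simp add: power2_eq_square field_simps)
      finally show ?case .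
    qed
  qed (auto intro!: always_eventually)
qed

lemma binomial_upper_vanishing:
  fixes n :: "'i \<Rightarrow> nat" and q \<tau> :: "'i \<Rightarrow> real"
  assumes lim: "((\<lambda>t. n t * q t / \<tau> t) \<longlongrightarrow> y) F" and \<tau>: "filterlim \<tau> at_top F"
    and q: "\<forall>\<^sub>F t in F. q t \<in> {0..1}" and "x > y"
  shows "vanishing (\<lambda>t. binomial_pmf (n t) (q t)) (\<lambda>t. {k. x * \<tau> t \<le> real k}) F"
proof -
  define z where "z = (x + y) / 2"
  have z: "y < z" "x - z > 0" using \<open>x > y\<close> by (auto simp: z_def)
  have "\<forall>\<^sub>F t in F. n t * q t / \<tau> t < z" using lim z(1) by (rule order_tendstoD)
  moreover have "\<forall>\<^sub>F t in F. \<tau> t > 0" using \<tau> by (simp add: filterlim_at_top_dense)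
  ultimately have "\<forall>\<^sub>F t in F. n t * q t < z * \<tau> t"
    by eventually_elim (simp add: field_simps)
  then have "\<forall>\<^sub>F t in F. {k. x * \<tau> t \<le> real k} \<subseteq> {k. (x - z) * \<tau> t \<le> \<bar>real k - n t * q t\<bar>}"
    by eventually_elim (auto simp: algebra_simps)
  then show ?thesis
    by (rule vanishing_subset[OF binomial_vanishing[OF lim \<tau> q z(2)]])
qed

lemma binomial_lower_vanishing:
  fixes n :: "'i \<Rightarrow> nat" and q \<tau> :: "'i \<Rightarrow> real"
  assumes lim: "((\<lambda>t. n t * q t / \<tau> t) \<longlongrightarrow> y) F" and \<tau>: "filterlim \<tau> at_top F"
    and q: "\<forall>\<^sub>F t in F. q t \<in> {0..1}" and "x < y"
  shows "vanishing (\<lambda>t. binomial_pmf (n t) (q t)) (\<lambda>t. {k. real k \<le> x * \<tau> t}) F"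
proof -
  define z where "z = (x + y) / 2"
  have z: "z < y" "z - x > 0" using \<open>x < y\<close> by (auto simp: z_def)
  have "\<forall>\<^sub>F t in F. z < n t * q t / \<tau> t" using lim z(1) by (rule order_tendstoD)
  moreover have "\<forall>\<^sub>F t in F. \<tau> t > 0" using \<tau> by (simp add: filterlim_at_top_dense)
  ultimately have "\<forall>\<^sub>F t in F. z * \<tau> t < n t * q t"
    by eventually_elim (simp add: field_simps)
  then have "\<forall>\<^sub>F t in F. {k. real k \<le> x * \<tau> t} \<subseteq> {k. (z - x) * \<tau> t \<le> \<bar>real k - n t * q t\<bar>}"
    by eventually_elim (auto simp: algebra_simps)
  then show ?thesis
    by (rule vanishing_subset[OF binomial_vanishing[OF lim \<tau> q z(2)]])
qed

lemma bernoulli_count_prefix: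
  assumes "k \<le> N" "p \<in> {0..1}"
  shows "map_pmf (\<lambda>u. card {l. l < k \<and> u l}) (bernoulli_field {..<N} p) = binomial_pmf k p"
proof -
  have "binomial_pmf k p = map_pmf (\<lambda>u. card {x\<in>{..<k}. u x}) (bernoulli_field {..<k} p)"
    using assms by (intro binomial_pmf_altdef') auto
  also have "bernoulli_field {..<k} p = map_pmf (\<lambda>w x. x \<in> {..<k} \<and> w x) (bernoulli_field {..<N} p)"
    using assms by (intro bernoulli_field_reindex[symmetric, where f = "\<lambda>x. x"]) auto
  finally show ?thesis by (simp add: pmf.map_comp o_def conj_ac)
qed

lemma source_count:
  assumes "k \<le> N" "\<alpha> \<in> {0..1}"
  shows "map_pmf (\<lambda>((u, v), w). card {l. l < k \<and> u l}) (stationary_field N M \<alpha> \<beta> p) = binomial_pmf k \<alpha>"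
proof -
  have "map_pmf (\<lambda>((u, v), w). card {l. l < k \<and> u l}) (stationary_field N M \<alpha> \<beta> p) =
    map_pmf (\<lambda>u. card {l. l < k \<and> u l}) (map_pmf (\<lambda>((u, v), w). u) (stationary_field N M \<alpha> \<beta> p))"
    by (simp add: pmf.map_comp o_def case_prod_unfold)
  then show ?thesis using assms by (simp add: stationary_marginals bernoulli_count_prefix)
qed

lemma sink_count:
  assumes "k \<le> M" "\<beta> \<in> {0..1}"
  shows "map_pmf (\<lambda>((u, v), w). card {l. l < k \<and> v l}) (stationary_field N M \<alpha> \<beta> p) = binomial_pmf k \<beta>"
proof -
  have "map_pmf (\<lambda>((u, v), w). card {l. l < k \<and> v l}) (stationary_field N M \<alpha> \<beta> p) =
    map_pmf (\<lambda>u. card {l. l < k \<and> u l}) (map_pmf (\<lambda>((u, v), w). v) (stationary_field N M \<alpha> \<beta> p))"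
    by (simp add: pmf.map_comp o_def case_prod_unfold)
  then show ?thesis using assms by (simp add: stationary_marginals bernoulli_count_prefix)
qed

lemma prob_bulk:
  "measure_pmf.prob (stationary_field N M \<alpha> \<beta> p) (snd -` X) = measure_pmf.prob (bernoulli_field (grid N M) p) X"
  using stationary_marginals(3)[of N M \<alpha> \<beta> p] by (metis measure_map_pmf)

text \<open>
  The scaling regime: cells become rare, and lengths are counted in units of \<open>\<tau>\<close>.  A side of
  \<open>N\<close> cells has macroscopic length \<open>a\<close> if \<open>sqrt p N\<close> is asymptotic to \<open>a \<tau>\<close>.
\<close>
locale thin_grid =
  fixes F :: "'i filter" and p \<tau> :: "'i \<Rightarrow> real"
  assumes p_pos: "\<forall>\<^sub>F t in F. p t > 0" and p_lim: "(p \<longlongrightarrow> 0) F" and \<tau>_lim: "filterlim \<tau> at_top F"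
begin

definition scales :: "('i \<Rightarrow> nat) \<Rightarrow> real \<Rightarrow> bool" where
  "scales N a \<longleftrightarrow> ((\<lambda>t. sqrt (p t) * N t / \<tau> t) \<longlongrightarrow> a) F"

lemma p_le_1: "\<forall>\<^sub>F t in F. p t \<in> {0<..1}"
  using p_pos order_tendstoD(2)[OF p_lim zero_less_one] by eventually_elim auto

lemma sqrt_p_lim: "((\<lambda>t. sqrt (p t)) \<longlongrightarrow> 0) F"
  using tendsto_real_sqrt[OF p_lim] by simp

lemma \<tau>_pos: "\<forall>\<^sub>F t in F. \<tau> t > 0" using \<tau>_lim by (simp add: filterlim_at_top_dense)

definition source_density :: "real \<Rightarrow> 'i \<Rightarrow> real" where "source_density r t = sqrt (p t) * r"
text \<open>
  The solution \<open>\<beta>\<close> of \<open>\<alpha> \<beta> = p (1 - \<alpha>) (1 - \<beta>)\<close> for the source density \<open>\<alpha> = sqrt p r\<close>.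
\<close>
definition sink_density :: "real \<Rightarrow> 'i \<Rightarrow> real" where
  "sink_density r t = p t * (1 - source_density r t) / (source_density r t + p t * (1 - source_density r t))"

lemma density_properties:
  assumes r: "r > 0"
  shows "\<forall>\<^sub>F t in F. source_density r t \<in> {0..1} \<and> sink_density r t \<in> {0..1} \<and> p t \<in> {0..1} \<and>
           source_density r t * sink_density r t = p t * (1 - source_density r t) * (1 - sink_density r t)"
    and "scales N a \<Longrightarrow> ((\<lambda>t. N t * source_density r t / \<tau> t) \<longlongrightarrow> a * r) F"
    and "scales N a \<Longrightarrow> ((\<lambda>t. N t * sink_density r t / \<tau> t) \<longlongrightarrow> a / r) F"
proof -
  have s0: "(source_density r \<longlongrightarrow> 0) F"
    unfolding source_density_def using tendsto_mult[OF sqrt_p_lim tendsto_const[of r]] by simp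
  have s1: "\<forall>\<^sub>F t in F. source_density r t < 1" using s0 by (rule order_tendstoD) simp
  show "\<forall>\<^sub>F t in F. source_density r t \<in> {0..1} \<and> sink_density r t \<in> {0..1} \<and> p t \<in> {0..1} \<and>
           source_density r t * sink_density r t = p t * (1 - source_density r t) * (1 - sink_density r t)"
    using p_le_1 s1
  proof eventually_elim
    case (elim t)
    define s where "s = source_density r t"
    have s: "0 < s" "s < 1" using elim r by (auto simp: source_density_def s_def)
    have d: "s + p t * (1 - s) > 0" using s elim by (intro add_pos_nonneg) auto
    have "sink_density r t = p t * (1 - s) / (s + p t * (1 - s))" by (simp add: sink_density_def s_def)
    moreover have "p t * (1 - s) / (s + p t * (1 - s)) \<in> {0..1}"
      using s d elim by (auto simp: divide_simps)
    moreover have "s * (p t * (1 - s) / (s + p t * (1 - s))) = p t * (1 - s) * (1 - p t * (1 - s) / (s + p t * (1 - s)))"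
      using d by (simp add: field_simps)
    ultimately show ?case using s elim by (auto simp flip: s_def)
  qed
  show "((\<lambda>t. N t * source_density r t / \<tau> t) \<longlongrightarrow> a * r) F" if "scales N a"
    using tendsto_mult[OF that[unfolded scales_def] tendsto_const[of r]]
    by (simp add: source_density_def field_simps)
  have "((\<lambda>t. (1 - source_density r t) / (r + sqrt (p t) * (1 - source_density r t))) \<longlongrightarrow> (1 - 0) / (r + 0 * (1 - 0))) F"
    using r by (intro tendsto_intros s0 sqrt_p_lim) auto
  then have lim: "((\<lambda>t. (1 - source_density r t) / (r + sqrt (p t) * (1 - source_density r t))) \<longlongrightarrow> 1 / r) F" by simp
  have "\<forall>\<^sub>F t in F. sink_density r t = sqrt (p t) * ((1 - source_density r t) / (r + sqrt (p t) * (1 - source_density r t)))"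
    using p_le_1 s1
  proof eventually_elim
    case (elim t)
    define s q where "s = source_density r t" "q = sqrt (p t)"
    have q: "q > 0" "p t = q * q" "s = q * r" "s < 1" using elim by (auto simp: s_q_def source_density_def)
    have d: "r + q * (1 - s) > 0" using q r by (intro add_pos_nonneg) auto
    have "sink_density r t = q * q * (1 - s) / (q * r + q * q * (1 - s))"
      using q by (simp add: sink_density_def flip: s_q_def)
    also have "\<dots> = q * (q * (1 - s)) / (q * (r + q * (1 - s)))" by (simp add: algebra_simps)
    also have "\<dots> = q * ((1 - s) / (r + q * (1 - s)))" using q d by simp
    finally show ?case by (simp add: s_q_def)
  qed
  note sink_density = this
  show "((\<lambda>t. N t * sink_density r t / \<tau> t) \<longlongrightarrow> a / r) F" if "scales N a"
  proof -
    have "((\<lambda>t. sqrt (p t) * N t / \<tau> t * ((1 - source_density r t) / (r + sqrt (p t) * (1 - source_density r t)))) \<longlongrightarrow> a * (1 / r)) F"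
      by (intro tendsto_mult lim that[unfolded scales_def])
    moreover have "\<forall>\<^sub>F t in F. sqrt (p t) * N t / \<tau> t * ((1 - source_density r t) / (r + sqrt (p t) * (1 - source_density r t))) =
        N t * sink_density r t / \<tau> t"
      by (rule eventually_mono[OF sink_density]) (simp add: mult_ac)
    ultimately have "((\<lambda>t. N t * sink_density r t / \<tau> t) \<longlongrightarrow> a * (1 / r)) F"
      by (rule Lim_transform_eventually)
    then show ?thesis by simp
  qed
qed

text \<open>
  The mean \<open>\<alpha> N + \<beta> M\<close> of the stationary passage time is asymptotically \<open>(a r + b / r) \<tau>\<close>, which is
  smallest for \<open>r = sqrt (b / a)\<close>.  With this choice both binomial terms have mean about
  \<open>sqrt (a b) \<tau>\<close>, so one of them has to exceed half of the bound.
\<close>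
lemma lpp_upper_tail:
  assumes N: "scales N a" and M: "scales M b" and ab: "a > 0" "b > 0" and x: "x > 2 * sqrt (a * b)"
  shows "vanishing (\<lambda>t. bernoulli_field (grid (N t) (M t)) (p t)) (\<lambda>t. {w. x * \<tau> t \<le> lpp0 w (N t) (M t)}) F"
proof -
  define r where "r = sqrt (b / a)"
  have r: "r > 0" "a * r = sqrt (a * b)" "b / r = sqrt (a * b)"
    using ab by (auto simp: r_def real_sqrt_divide real_sqrt_mult field_simps)
  let ?S = "\<lambda>t. stationary_field (N t) (M t) (source_density r t) (sink_density r t) (p t)"
  note ev = density_properties(1)[OF r(1)]
  have q: "\<forall>\<^sub>F t in F. source_density r t \<in> {0..1}" "\<forall>\<^sub>F t in F. sink_density r t \<in> {0..1}"
    using ev by (auto elim: eventually_mono)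
  have top: "vanishing ?S (\<lambda>t. (\<lambda>((u, v), w). card {i. i < N t \<and> hstep u v w i (M t)}) -` {k. x / 2 * \<tau> t \<le> real k}) F"
    using ev by (intro vanishing_map[OF binomial_upper_vanishing[OF density_properties(2)[OF r(1) N] \<tau>_lim q(1)]])
      (use x r in \<open>auto elim!: eventually_mono intro: stationary_top_row\<close>)
  have left: "vanishing ?S (\<lambda>t. (\<lambda>((u, v), w). card {j. j < M t \<and> v j}) -` {k. x / 2 * \<tau> t \<le> real k}) F"
    using q(2) by (intro vanishing_map[OF binomial_upper_vanishing[OF density_properties(3)[OF r(1) M] \<tau>_lim q(2)]])
      (use x r in \<open>auto elim!: eventually_mono intro: sink_count\<close>)
  have "vanishing ?S (\<lambda>t. snd -` {w. x * \<tau> t \<le> lpp0 w (N t) (M t)}) F"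
  proof (rule vanishing_subset[OF vanishing_Un[OF top left]], intro always_eventually allI subsetI)
    fix t and s :: "((nat \<Rightarrow> bool) \<times> (nat \<Rightarrow> bool)) \<times> (nat \<times> nat \<Rightarrow> bool)"
    assume "s \<in> snd -` {w. x * \<tau> t \<le> lpp0 w (N t) (M t)}"
    moreover obtain u v w where s: "s = ((u, v), w)" by (metis surj_pair)
    moreover have "lpp0 w (N t) (M t) \<le> card {j. j < M t \<and> v j} + card {i. i < N t \<and> hstep u v w i (M t)}"
      using lpp_boundary_mono[of w "N t" "M t" u v] by (simp add: lpp_eq_sum_hstep)
    ultimately show "s \<in> (\<lambda>((u, v), w). card {i. i < N t \<and> hstep u v w i (M t)}) -` {k. x / 2 * \<tau> t \<le> real k} \<union>
      (\<lambda>((u, v), w). card {j. j < M t \<and> v j}) -` {k. x / 2 * \<tau> t \<le> real k}"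
      by auto
  qed
  then show ?thesis
    by (rule vanishing_le) (auto simp: prob_bulk simp del: vimage_Collect_eq intro!: always_eventually)
qed

end

text \<open>
  The quantitative form of the strict concavity that keeps the exit point near the corner.
\<close>
lemma sqrt_one_minus_le:
  fixes s :: real
  assumes "0 \<le> s" "s \<le> 1"
  shows "s + 2 * sqrt (1 - s) \<le> 2 - s\<^sup>2 / 4"
proof -
  have "(1 - s / 2 - s\<^sup>2 / 8)\<^sup>2 = 1 - s + s ^ 3 / 8 + s ^ 4 / 64"
    by (simp add: power2_eq_square power3_eq_cube power4_eq_xxxx field_simps)
  then have "1 - s \<le> (1 - s / 2 - s\<^sup>2 / 8)\<^sup>2" using assms by simp
  moreover have "s\<^sup>2 \<le> 1" using assms by (simp add: power_le_one)
  then have "0 \<le> 1 - s / 2 - s\<^sup>2 / 8" using assms by simp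
  ultimately have "sqrt (1 - s) \<le> 1 - s / 2 - s\<^sup>2 / 8" by (intro real_le_lsqrt) auto
  then show ?thesis by simp
qed

text \<open>
  \<open>S k\<close> is what is collected along a side up to the exit point \<open>k\<close>, and \<open>L k\<close> is the passage time from
  there; both are controlled only at \<open>J + 1\<close> equally spaced points, and monotonicity interpolates.
  Beyond the fraction \<open>\<sigma>\<close> of the side the two together fall short of the total, so \<open>k\<close> lies before it;
  then \<open>S k\<close> is at most about \<open>g \<sigma> \<tau>\<close> and nearly everything is due to \<open>L 0\<close>.  The constants are
  chosen such that the grid error \<open>g / J\<close> and the deviations \<open>\<epsilon>\<close> add up to less than \<open>g \<sigma>\<^sup>2 / 4\<close>.
\<close>
lemma exit_point_near_corner:
  fixes S L :: "nat \<Rightarrow> nat" and g \<tau> \<sigma> \<epsilon> :: real and J n k :: nat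
  assumes S: "mono S" and L: "antimono L" and k: "k \<le> n"
    and pos: "g > 0" "\<tau> > 0" "J > 0" and \<sigma>: "0 < \<sigma>" "\<sigma> \<le> 1" "1 / J \<le> \<sigma>\<^sup>2 / 16" "\<epsilon> = g * \<sigma>\<^sup>2 / 32"
    and Sb: "\<And>i. i \<le> J \<Longrightarrow> S (i * n div J) < (g * (i / J) + \<epsilon>) * \<tau>"
    and Lb: "\<And>i. i < J \<Longrightarrow> L (i * n div J) < (2 * g * sqrt (1 - i / J) + \<epsilon>) * \<tau>"
    and tot: "(2 * g - 2 * \<epsilon>) * \<tau> < S k + L k"
  shows "(2 * g - 2 * g * \<sigma>) * \<tau> < L 0"
proof -
  obtain i where i: "i < J" "i * n div J \<le> k" "k \<le> Suc i * n div J"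
  proof -
    have "\<exists>i<J. k \<le> Suc i * n div J"
      using k pos by (intro exI[of _ "J - 1"]) auto
    then obtain i where i: "i < J" "k \<le> Suc i * n div J" "\<And>i'. i' < i \<Longrightarrow> \<not> k \<le> Suc i' * n div J"
      using exists_least_iff[of "\<lambda>i. i < J \<and> k \<le> Suc i * n div J"] by auto
    have "i * n div J \<le> k"
      using i(3)[of "i - 1"] by (cases i) auto
    with i that show ?thesis by blast
  qed
  define s where "s = i / J"
  have s: "0 \<le> s" "s \<le> 1" using i by (auto simp: s_def field_simps)
  have "S k \<le> S (Suc i * n div J)" using S i(3) by (rule monoD)
  moreover have "real (S (Suc i * n div J)) < (g * (Suc i / J) + \<epsilon>) * \<tau>" using i by (intro Sb) auto
  moreover have "(g * (Suc i / J) + \<epsilon>) * \<tau> = (g * s + g * (1 / J) + \<epsilon>) * \<tau>"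
    by (simp add: s_def add_divide_distrib algebra_simps)
  ultimately have Sk: "S k < (g * s + g * (1 / J) + \<epsilon>) * \<tau>" by linarith
  have J: "g * (1 / J) \<le> g * \<sigma>\<^sup>2 / 16" using mult_left_mono[OF \<sigma>(3), of g] pos by simp
  have \<sigma>2: "g * \<sigma>\<^sup>2 \<le> g * \<sigma>" using \<sigma> pos by (simp add: power2_eq_square mult_left_le)
  show ?thesis
  proof (cases "s < \<sigma>")
    case True
    have "(2 * g - 2 * \<epsilon>) * \<tau> < S k + L k" by (rule tot)
    also have "\<dots> \<le> S k + L 0" using antimonoD[OF L, of 0 k] by simp
    finally have "(2 * g - 2 * \<epsilon>) * \<tau> - (g * s + g * (1 / J) + \<epsilon>) * \<tau> < L 0" using Sk by simp
    then have *: "(2 * g - g * s - g * (1 / J) - 3 * \<epsilon>) * \<tau> < L 0" by (simp add: algebra_simps)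
    have "g * s \<le> g * \<sigma>" using True pos by simp
    then have "2 * g - 2 * g * \<sigma> \<le> 2 * g - g * s - g * (1 / J) - 3 * \<epsilon>"
      using J \<sigma>2 \<sigma>(4) mult_pos_pos[OF pos(1) \<sigma>(1)] by linarith
    then have "(2 * g - 2 * g * \<sigma>) * \<tau> \<le> (2 * g - g * s - g * (1 / J) - 3 * \<epsilon>) * \<tau>"
      using pos by (intro mult_right_mono) auto
    with * show ?thesis by linarith
  next
    case False
    have "L k \<le> L (i * n div J)" using L i(2) by (rule antimonoD)
    moreover have "real (L (i * n div J)) < (2 * g * sqrt (1 - s) + \<epsilon>) * \<tau>" using Lb[OF i(1)] by (simp add: s_def)
    ultimately have Lk: "L k < (2 * g * sqrt (1 - s) + \<epsilon>) * \<tau>" by linarith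
    have "(2 * g - 2 * \<epsilon>) * \<tau> < (g * s + g * (1 / J) + \<epsilon>) * \<tau> + (2 * g * sqrt (1 - s) + \<epsilon>) * \<tau>"
      using tot Sk Lk by linarith
    then have "(2 * g - 2 * \<epsilon>) * \<tau> < (g * s + g * (1 / J) + 2 * \<epsilon> + 2 * g * sqrt (1 - s)) * \<tau>"
      by (simp add: algebra_simps)
    then have a: "2 * g - 2 * \<epsilon> < g * s + g * (1 / J) + 2 * \<epsilon> + 2 * g * sqrt (1 - s)"
      using pos by simp
    have "g * (s + 2 * sqrt (1 - s)) \<le> g * (2 - s\<^sup>2 / 4)"
      using pos sqrt_one_minus_le[OF s] by (intro mult_left_mono) auto
    moreover have "g * \<sigma>\<^sup>2 \<le> g * s\<^sup>2" using False \<sigma> pos by (intro mult_left_mono power_mono) auto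
    moreover have "0 \<le> g * \<sigma>\<^sup>2" using pos by simp
    ultimately have False using a J \<sigma>(4) by (simp add: algebra_simps)
    then show ?thesis ..
  qed
qed


lemma antimono_lpp_shift:
  "antimono (\<lambda>k. lpp0 (\<lambda>(x, y). w (x + k, y)) (N - k) M)"
  "antimono (\<lambda>k. lpp0 (\<lambda>(x, y). w (x, y + k)) N (M - k))"
  by (auto intro!: antimonoI lpp_shift_mono)

lemma mono_count: "mono (\<lambda>k. card {l. l < k \<and> u l})" for u :: "nat \<Rightarrow> bool"
  by (auto intro!: monoI card_mono)

context thin_grid
begin

lemma scales_prefix:
  assumes "scales N a" "J > 0"
  shows "scales (\<lambda>t. i * N t div J) (a * (i / J))"
proof -
  let ?k = "\<lambda>t. real (i * N t div J)"
  have z: "((\<lambda>t. sqrt (p t) * inverse (\<tau> t)) \<longlongrightarrow> 0 * 0) F"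
    by (intro tendsto_mult sqrt_p_lim tendsto_inverse_0_at_top \<tau>_lim)
  have m: "((\<lambda>t. sqrt (p t) * N t / \<tau> t * (i / J)) \<longlongrightarrow> a * (i / J)) F"
    by (intro tendsto_mult assms(1)[unfolded scales_def] tendsto_const)
  have k: "N t * (i / J) - 1 \<le> ?k t" "?k t \<le> N t * (i / J)" for t
  proof -
    have "real (i * N t) = J * ?k t + real (i * N t mod J)"
      by (metis div_mult_mod_eq mult.commute of_nat_add of_nat_mult)
    moreover have "real (i * N t mod J) < J" using \<open>J > 0\<close> by simp
    ultimately show "N t * (i / J) - 1 \<le> ?k t" "?k t \<le> N t * (i / J)"
      using \<open>J > 0\<close> by (simp_all add: field_simps)
  qed
  show ?thesis
    unfolding scales_def
  proof (rule tendsto_sandwich)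
    show "\<forall>\<^sub>F t in F. sqrt (p t) * N t / \<tau> t * (i / J) - sqrt (p t) * inverse (\<tau> t) \<le> sqrt (p t) * ?k t / \<tau> t"
      using \<tau>_pos p_pos
    proof eventually_elim
      case (elim t)
      have "sqrt (p t) * (N t * (i / J) - 1) / \<tau> t \<le> sqrt (p t) * ?k t / \<tau> t"
        using elim k[of t] by (intro divide_right_mono mult_left_mono) auto
      moreover have "sqrt (p t) * (N t * (i / J) - 1) / \<tau> t = sqrt (p t) * N t / \<tau> t * (i / J) - sqrt (p t) * inverse (\<tau> t)"
        using elim by (simp add: field_simps)
      ultimately show ?case by simp
    qed
    show "\<forall>\<^sub>F t in F. sqrt (p t) * ?k t / \<tau> t \<le> sqrt (p t) * N t / \<tau> t * (i / J)"
      using \<tau>_pos p_pos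
    proof eventually_elim
      case (elim t)
      have "sqrt (p t) * ?k t / \<tau> t \<le> sqrt (p t) * (N t * (i / J)) / \<tau> t"
        using elim k[of t] by (intro divide_right_mono mult_left_mono) auto
      then show ?case by (simp add: field_simps)
    qed
    show "((\<lambda>t. sqrt (p t) * N t / \<tau> t * (i / J) - sqrt (p t) * inverse (\<tau> t)) \<longlongrightarrow> a * (i / J)) F"
      using tendsto_diff[OF m z] by simp
  qed (rule m)
qed

lemma scales_suffix:
  assumes "scales N a" "J > 0" "i \<le> J"
  shows "scales (\<lambda>t. N t - i * N t div J) (a * (1 - i / J))"
proof -
  have "i * N t div J \<le> N t" for t
    using assms by (metis div_le_mono mult.commute mult_le_mono1 nonzero_mult_div_cancel_left not_gr_zero)
  then have "sqrt (p t) * real (N t) / \<tau> t - sqrt (p t) * real (i * N t div J) / \<tau> t =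
     sqrt (p t) * real (N t - i * N t div J) / \<tau> t" for t
    by (simp only: of_nat_diff) (simp add: algebra_simps diff_divide_distrib)
  then show ?thesis
    using tendsto_diff[OF assms(1)[unfolded scales_def] scales_prefix[OF assms(1,2), of i, unfolded scales_def]]
    by (simp add: scales_def algebra_simps)
qed

text \<open>
  Finitely many bad events are excluded: the stationary passage time is too short, the boundary has too
  many sources or sinks before one of the \<open>J + 1\<close> checkpoints, or the passage time from a checkpoint
  exceeds the upper bound for the remaining grid.  Outside of them the exit point lies near the corner.
\<close>
lemma lpp_lower_tail:
  assumes N: "scales N a" and M: "scales M b" and ab: "a > 0" "b > 0" and x: "x < 2 * sqrt (a * b)"
  shows "vanishing (\<lambda>t. bernoulli_field (grid (N t) (M t)) (p t)) (\<lambda>t. {w. lpp0 w (N t) (M t) \<le> x * \<tau> t}) F"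
proof -
  define r where "r = sqrt (b / a)"
  define g where "g = sqrt (a * b)"
  have r: "r > 0" "a * r = g" "b / r = g"
    using ab by (auto simp: r_def g_def real_sqrt_divide real_sqrt_mult field_simps)
  have g: "g > 0" using ab by (simp add: g_def)
  (* loss of the lower bound: at most 2 g sigma, to be absorbed by 2 g - x *)
  define \<sigma> where "\<sigma> = min 1 ((2 * g - x) / (2 * g))"
  have \<sigma>: "0 < \<sigma>" "\<sigma> \<le> 1" "\<sigma> \<le> (2 * g - x) / (2 * g)" using x g by (auto simp: \<sigma>_def g_def)
  have \<sigma>x: "2 * g * \<sigma> \<le> 2 * g - x" using \<sigma>(3) g by (simp add: field_simps)
  define \<epsilon> where "\<epsilon> = g * \<sigma>\<^sup>2 / 32"
  have \<epsilon>: "\<epsilon> > 0" using g \<sigma> by (simp add: \<epsilon>_def)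
  obtain J :: nat where J: "J > 0" "1 / J \<le> \<sigma>\<^sup>2 / 16"
  proof -
    have "\<sigma>\<^sup>2 / 16 > 0" using \<sigma> by simp
    then obtain n where n: "inverse (real (Suc n)) < \<sigma>\<^sup>2 / 16" using reals_Archimedean by blast
    show ?thesis by (rule that[of "Suc n"]) (use n in \<open>auto simp: field_simps\<close>)
  qed
  let ?S = "\<lambda>t. stationary_field (N t) (M t) (source_density r t) (sink_density r t) (p t)"
  note ev = density_properties(1)[OF r(1)]
  have q: "\<forall>\<^sub>F t in F. source_density r t \<in> {0..1}" "\<forall>\<^sub>F t in F. sink_density r t \<in> {0..1}"
    using ev by (auto elim: eventually_mono)
  have le: "i * n div J \<le> n" if "i \<le> J" for i n
    using that J by (metis div_le_mono mult.commute mult_le_mono1 nonzero_mult_div_cancel_left not_gr_zero)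

  (* T, V: top or left side too short; A, B: too many sources or sinks before checkpoint i; C, D: passage time from checkpoint i too long *)
  define T where "T t = (\<lambda>((u, v), w :: nat \<times> nat \<Rightarrow> bool). card {i. i < N t \<and> hstep u v w i (M t)}) -` {k. k \<le> (g - \<epsilon>) * \<tau> t}" for t
  define V where "V t = (\<lambda>((u :: nat \<Rightarrow> bool, v), w :: nat \<times> nat \<Rightarrow> bool). card {j. j < M t \<and> v j}) -` {k. k \<le> (g - \<epsilon>) * \<tau> t}" for t
  define A where "A i t = (\<lambda>((u, v :: nat \<Rightarrow> bool), w :: nat \<times> nat \<Rightarrow> bool). card {l. l < i * N t div J \<and> u l}) -` {k. (g * (i / J) + \<epsilon>) * \<tau> t \<le> real k}" for i t
  define B where "B i t = (\<lambda>((u :: nat \<Rightarrow> bool, v), w :: nat \<times> nat \<Rightarrow> bool). card {l. l < i * M t div J \<and> v l}) -` {k. (g * (i / J) + \<epsilon>) * \<tau> t \<le> real k}" for i t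
  define C where "C i t = (\<lambda>((u :: nat \<Rightarrow> bool, v :: nat \<Rightarrow> bool), w) c. c \<in> grid (N t - i * N t div J) (M t) \<and> w (fst c + i * N t div J, snd c)) -`
     {w. (2 * g * sqrt (1 - i / J) + \<epsilon>) * \<tau> t \<le> lpp0 w (N t - i * N t div J) (M t)}" for i t
  define D where "D i t = (\<lambda>((u :: nat \<Rightarrow> bool, v :: nat \<Rightarrow> bool), w) c. c \<in> grid (N t) (M t - i * M t div J) \<and> w (fst c, snd c + i * M t div J)) -`
     {w. (2 * g * sqrt (1 - i / J) + \<epsilon>) * \<tau> t \<le> lpp0 w (N t) (M t - i * M t div J)}" for i t

  have vT: "vanishing ?S T F"
    unfolding T_def using ev
    by (intro vanishing_map[OF binomial_lower_vanishing[OF density_properties(2)[OF r(1) N] \<tau>_lim q(1)]])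
      (use r \<epsilon> in \<open>auto elim!: eventually_mono intro: stationary_top_row\<close>)
  have bulk: "map_pmf (\<lambda>((u, v), w) c. c \<in> grid n' m' \<and> w (fst c + k, snd c + l)) (stationary_field n m \<alpha> \<beta> z) = bernoulli_field (grid n' m') z"
    if "n' + k \<le> n" "m' + l \<le> m" for n' k n m' l m \<alpha> \<beta> z
  proof -
    have "map_pmf (\<lambda>((u, v), w) c. c \<in> grid n' m' \<and> w (fst c + k, snd c + l)) (stationary_field n m \<alpha> \<beta> z) =
      map_pmf (\<lambda>w c. c \<in> grid n' m' \<and> w (fst c + k, snd c + l)) (map_pmf snd (stationary_field n m \<alpha> \<beta> z))"
      by (simp add: pmf.map_comp o_def case_prod_unfold)
    also have "\<dots> = bernoulli_field (grid n' m') z"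
      unfolding stationary_marginals using that
      by (intro bernoulli_field_reindex) (auto simp: grid_def inj_on_def)
    finally show ?thesis .
  qed
  have vV: "vanishing ?S V F"
    unfolding V_def using q(2)
    by (intro vanishing_map[OF binomial_lower_vanishing[OF density_properties(3)[OF r(1) M] \<tau>_lim q(2)]])
      (use r \<epsilon> in \<open>auto elim!: eventually_mono intro: sink_count\<close>)
  have vA: "vanishing ?S (A i) F" if "i \<le> J" for i
  proof -
    have "a * (i / J) * r = (a * r) * (i / J)" by simp
    then have "a * (i / J) * r = g * (i / J)" unfolding r(2) .
    then have "a * (i / J) * r < g * (i / J) + \<epsilon>" using \<epsilon> by linarith
    note lim = binomial_upper_vanishing[OF density_properties(2)[OF r(1) scales_prefix[OF N J(1), of i]] \<tau>_lim q(1) this]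
    show ?thesis
      unfolding A_def
    proof (rule vanishing_map[OF lim], rule eventually_mono[OF q(1)])
    qed (intro source_count le that)
  qed
  have vB: "vanishing ?S (B i) F" if "i \<le> J" for i
  proof -
    have "b * (i / J) / r = (b / r) * (i / J)" by simp
    then have "b * (i / J) / r = g * (i / J)" unfolding r(3) .
    then have "b * (i / J) / r < g * (i / J) + \<epsilon>" using \<epsilon> by linarith
    note lim = binomial_upper_vanishing[OF density_properties(3)[OF r(1) scales_prefix[OF M J(1), of i]] \<tau>_lim q(2) this]
    show ?thesis
      unfolding B_def
    proof (rule vanishing_map[OF lim], rule eventually_mono[OF q(2)])
    qed (intro sink_count le that)
  qed
  have vC: "vanishing ?S (C i) F" if "i < J" for i
  proof -
    have "a * (1 - i / J) > 0" using that ab by (simp add: field_simps)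
    moreover have "sqrt (a * (1 - i / J) * b) = g * sqrt (1 - i / J)"
      unfolding g_def real_sqrt_mult[symmetric] by (simp add: mult_ac)
    ultimately show ?thesis
      unfolding C_def
      using bulk[where l = 0] le[of i] that \<epsilon>
      by (intro vanishing_map[OF lpp_upper_tail[OF scales_suffix[OF N J(1)] M]] always_eventually allI) (auto simp: ab)
  qed
  have vD: "vanishing ?S (D i) F" if "i < J" for i
  proof -
    have "b * (1 - i / J) > 0" using that ab by (simp add: field_simps)
    moreover have "sqrt (a * (b * (1 - i / J))) = g * sqrt (1 - i / J)"
      unfolding g_def real_sqrt_mult[symmetric] by (simp add: mult_ac)
    ultimately show ?thesis
      unfolding D_def
      using bulk[where k = 0] le[of i] that \<epsilon>
      by (intro vanishing_map[OF lpp_upper_tail[OF N scales_suffix[OF M J(1)]]] always_eventually allI) (auto simp: ab)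
  qed
  define Bad where "Bad t = (T t \<union> V t) \<union> ((\<Union>i\<in>{..J}. A i t) \<union> (\<Union>i\<in>{..J}. B i t)) \<union>
     ((\<Union>i\<in>{..<J}. C i t) \<union> (\<Union>i\<in>{..<J}. D i t))" for t
  have bad: "vanishing ?S Bad F"
    unfolding Bad_def by (intro vanishing_Un vanishing_UN vT vV vA vB vC vD) auto
  have "vanishing ?S (\<lambda>t. snd -` {w. lpp0 w (N t) (M t) \<le> x * \<tau> t}) F"
  proof (rule vanishing_subset[OF bad], rule eventually_mono[OF \<tau>_pos], rule subsetI, rule ccontr)
    fix t and s :: "((nat \<Rightarrow> bool) \<times> (nat \<Rightarrow> bool)) \<times> (nat \<times> nat \<Rightarrow> bool)"
    assume \<tau>: "\<tau> t > 0" and s: "s \<in> snd -` {w. lpp0 w (N t) (M t) \<le> x * \<tau> t}" and good: "s \<notin> Bad t"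
    obtain u v w where suvw: "s = ((u, v), w)" by (metis surj_pair)
    let ?Su = "\<lambda>k. card {l. l < k \<and> u l}" and ?Lu = "\<lambda>k. lpp0 (\<lambda>(x, y). w (x + k, y)) (N t - k) (M t)"
    let ?Sv = "\<lambda>k. card {l. l < k \<and> v l}" and ?Lv = "\<lambda>k. lpp0 (\<lambda>(x, y). w (x, y + k)) (N t) (M t - k)"
    have "s \<notin> T t" "s \<notin> V t" using good by (auto simp: Bad_def)
    then have "(g - \<epsilon>) * \<tau> t < card {i. i < N t \<and> hstep u v w i (M t)}"
      and "(g - \<epsilon>) * \<tau> t < card {j. j < M t \<and> v j}"
      by (simp_all add: suvw T_def V_def not_le)
    then have "(g - \<epsilon>) * \<tau> t + (g - \<epsilon>) * \<tau> t < lpp u v w (N t) (M t)"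
      unfolding lpp_eq_sum_hstep of_nat_add by linarith
    then have tot: "(2 * g - 2 * \<epsilon>) * \<tau> t < lpp u v w (N t) (M t)" by (simp add: algebra_simps)
    have "(2 * g - 2 * g * \<sigma>) * \<tau> t < lpp0 w (N t) (M t)"
      using lpp_exit_point[of "N t" u v w "M t"]
    proof (elim disjE exE conjE)
      fix k assume k: "k \<le> N t" "lpp u v w (N t) (M t) \<le> ?Su k + ?Lu k"
      have "(2 * g - 2 * g * \<sigma>) * \<tau> t < ?Lu 0"
      proof (rule exit_point_near_corner[OF mono_count antimono_lpp_shift(1) k(1) g \<tau> J(1) \<sigma>(1,2) J(2) \<epsilon>_def])
        show "?Su (i * N t div J) < (g * (i / J) + \<epsilon>) * \<tau> t" if "i \<le> J" for i
          using good that by (force simp: Bad_def A_def suvw not_le)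
        show "?Lu (i * N t div J) < (2 * g * sqrt (1 - i / J) + \<epsilon>) * \<tau> t" if "i < J" for i
        proof -
          have "s \<notin> C i t" using good that by (auto simp: Bad_def)
          moreover have "lpp0 (\<lambda>c. c \<in> grid (N t - i * N t div J) (M t) \<and> w (fst c + i * N t div J, snd c)) (N t - i * N t div J) (M t)
             = ?Lu (i * N t div J)" by (rule lpp_cong) auto
          ultimately show ?thesis by (simp add: C_def suvw not_le)
        qed
        show "(2 * g - 2 * \<epsilon>) * \<tau> t < real (?Su k + ?Lu k)"
          using tot k(2) by linarith
      qed
      then show ?thesis by simp
    next
      fix k assume k: "k \<le> M t" "lpp u v w (N t) (M t) \<le> ?Sv k + ?Lv k"
      have "(2 * g - 2 * g * \<sigma>) * \<tau> t < ?Lv 0"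
      proof (rule exit_point_near_corner[OF mono_count antimono_lpp_shift(2) k(1) g \<tau> J(1) \<sigma>(1,2) J(2) \<epsilon>_def])
        show "?Sv (i * M t div J) < (g * (i / J) + \<epsilon>) * \<tau> t" if "i \<le> J" for i
          using good that by (force simp: Bad_def B_def suvw not_le)
        show "?Lv (i * M t div J) < (2 * g * sqrt (1 - i / J) + \<epsilon>) * \<tau> t" if "i < J" for i
        proof -
          have "s \<notin> D i t" using good that by (auto simp: Bad_def)
          moreover have "lpp0 (\<lambda>c. c \<in> grid (N t) (M t - i * M t div J) \<and> w (fst c, snd c + i * M t div J)) (N t) (M t - i * M t div J)
             = ?Lv (i * M t div J)" by (rule lpp_cong) auto
          ultimately show ?thesis by (simp add: D_def suvw not_le)
        qed
        show "(2 * g - 2 * \<epsilon>) * \<tau> t < real (?Sv k + ?Lv k)"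
          using tot k(2) by linarith
      qed
      then show ?thesis by simp
    qed
    moreover have "x * \<tau> t \<le> (2 * g - 2 * g * \<sigma>) * \<tau> t" using \<sigma>x \<tau> by (intro mult_right_mono) auto
    ultimately show False using s by (simp add: suvw)
  qed
  then show ?thesis
    by (rule vanishing_le) (auto simp: prob_bulk simp del: vimage_Collect_eq intro!: always_eventually)
qed

end

section \<open>Removing the gap\<close>

lemma prob_pair_pmf:
  "measure_pmf.prob (pair_pmf P Q) {(x, y). R x y} = measure_pmf.expectation P (\<lambda>x. measure_pmf.prob Q {y. R x y})"
proof -
  have "ennreal (measure_pmf.prob (pair_pmf P Q) {(x, y). R x y}) = (\<integral>\<^sup>+z. indicator {(x, y). R x y} z \<partial>measure_pmf (pair_pmf P Q))"
    by (simp add: measure_pmf.emeasure_eq_measure)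
  also have "\<dots> = (\<integral>\<^sup>+x. \<integral>\<^sup>+y. indicator {y. R x y} y \<partial>measure_pmf Q \<partial>measure_pmf P)"
    by (simp add: nn_integral_pair_pmf' indicator_def)
  also have "\<dots> = (\<integral>\<^sup>+x. ennreal (measure_pmf.prob Q {y. R x y}) \<partial>measure_pmf P)"
    by (simp add: measure_pmf.emeasure_eq_measure)
  also have "\<dots> = ennreal (measure_pmf.expectation P (\<lambda>x. measure_pmf.prob Q {y. R x y}))"
    by (intro nn_integral_eq_integral measure_pmf.integrable_const_bound[where B = 1]) auto
  finally show ?thesis by (simp add: integral_nonneg_AE)
qed

lemma prob_pair_pmf_indep:
  "measure_pmf.prob (pair_pmf P Q) {(x, y). X x \<and> Y y} = measure_pmf.prob P {x. X x} * measure_pmf.prob Q {y. Y y}"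
proof -
  have "measure_pmf.prob Q {y. X x \<and> Y y} = indicator {x. X x} x * measure_pmf.prob Q {y. Y y}" for x
    by (simp add: indicator_def)
  then show ?thesis unfolding prob_pair_pmf by simp
qed

text \<open>
  The hypothesis says that \<open>H\<close> is a stopping set: whether \<open>H w = K\<close> can be read off from \<open>w\<close> outside \<open>K\<close>.
  The field inside \<open>H w\<close> is then independent of \<open>H w\<close> and may be replaced by a fresh copy.
\<close>
lemma bernoulli_field_refresh:
  fixes H :: "('c \<Rightarrow> bool) \<Rightarrow> 'c set"
  assumes A: "finite A" and H: "\<And>w K. H w = K \<longleftrightarrow> H (\<lambda>c. w c \<and> c \<notin> K) = K"
  shows "map_pmf (\<lambda>w. (H w, {c. w c} \<inter> H w)) (bernoulli_field A p) =
         map_pmf (\<lambda>(w, w'). (H w, {c. w' c} \<inter> H w)) (pair_pmf (bernoulli_field A p) (bernoulli_field A p))"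
proof (rule pmf_eqI)
  fix x :: "'c set \<times> 'c set"
  obtain K Y where x: "x = (K, Y)" by fastforce
  define P P1 P2 where P: "P = bernoulli_field A p" "P1 = bernoulli_field (A - K) p" "P2 = bernoulli_field (A \<inter> K) p"
  let ?merge = "\<lambda>(f, g) c. if c \<in> A - K then f c else g c"
  have merge: "P = map_pmf ?merge (pair_pmf P1 P2)"
  proof -
    have "(A - K) \<inter> (A \<inter> K) = {}" "(A - K) \<union> (A \<inter> K) = A" by auto
    then show ?thesis
      using Pi_pmf_union[of "A - K" "A \<inter> K" False "\<lambda>_. bernoulli_pmf p"] A by (simp only: P finite_Diff finite_Int simp_thms)
  qed
  have supp1: "\<not> f c" if "f \<in> set_pmf P1" "c \<notin> A - K" for f c
    using that set_Pi_pmf_subset[of "A - K" False "\<lambda>_. bernoulli_pmf p"] A by (auto simp: P)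
  have supp2: "\<not> f c" if "f \<in> set_pmf P2" "c \<notin> A \<inter> K" for f c
    using that set_Pi_pmf_subset[of "A \<inter> K" False "\<lambda>_. bernoulli_pmf p"] A by (auto simp: P)
  have split: "measure_pmf.prob P {w. X (\<lambda>c. w c \<and> c \<notin> K) \<and> Z ({c. w c} \<inter> K)} =
     measure_pmf.prob P1 {w. X w} * measure_pmf.prob P2 {w. Z {c. w c}}" for X Z
  proof -
    let ?E = "{w. X (\<lambda>c. w c \<and> c \<notin> K) \<and> Z ({c. w c} \<inter> K)}"
    have "measure_pmf.prob P ?E =
      measure_pmf.prob (pair_pmf P1 P2) (?merge -` ?E)"
      unfolding merge by simp
    also have "\<dots> = measure_pmf.prob (pair_pmf P1 P2) {(f, g). X f \<and> Z {c. g c}}"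
    proof (intro measure_pmf.finite_measure_eq_AE AE_pmfI)
      fix z assume "z \<in> set_pmf (pair_pmf P1 P2)"
      then obtain f g where z: "z = (f, g)" "f \<in> set_pmf P1" "g \<in> set_pmf P2" by auto
      have "(\<lambda>c. ?merge (f, g) c \<and> c \<notin> K) = f" "{c. ?merge (f, g) c} \<inter> K = {c. g c}"
        using supp1[OF z(2)] supp2[OF z(3)] by auto
      then show "z \<in> ?merge -` ?E \<longleftrightarrow>
          z \<in> {(f, g). X f \<and> Z {c. g c}}"
        using z(1) by simp
    qed auto
    also have "\<dots> = measure_pmf.prob P1 {w. X w} * measure_pmf.prob P2 {w. Z {c. w c}}"
      by (rule prob_pair_pmf_indep)
    finally show ?thesis .
  qed
  have HK: "{w. H w = K} = {w. H (\<lambda>c. w c \<and> c \<notin> K) = K \<and> True}" using H by auto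
  have "pmf (map_pmf (\<lambda>w. (H w, {c. w c} \<inter> H w)) P) x = measure_pmf.prob P {w. H (\<lambda>c. w c \<and> c \<notin> K) = K \<and> {c. w c} \<inter> K = Y}"
    using H by (auto simp: pmf_map x vimage_def intro!: arg_cong[where f = "measure_pmf.prob P"])
  also have "\<dots> = measure_pmf.prob P1 {w. H w = K} * measure_pmf.prob P2 {w. {c. w c} = Y}"
    by (rule split)
  also have "measure_pmf.prob P1 {w. H w = K} = measure_pmf.prob P {w. H w = K}"
    unfolding HK using split[of "\<lambda>w. H w = K" "\<lambda>_. True"] H by simp
  also have "measure_pmf.prob P2 {w. {c. w c} = Y} = measure_pmf.prob P {w. {c. w c} \<inter> K = Y}"
    using split[of "\<lambda>w. True" "\<lambda>z. z = Y"] by simp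
  also have "measure_pmf.prob P {w. H w = K} * measure_pmf.prob P {w. {c. w c} \<inter> K = Y} =
     measure_pmf.prob (pair_pmf P P) {(w, w'). H w = K \<and> {c. w' c} \<inter> K = Y}"
    by (rule prob_pair_pmf_indep[symmetric])
  also have "\<dots> = pmf (map_pmf (\<lambda>(w, w'). (H w, {c. w' c} \<inter> H w)) (pair_pmf P P)) x"
    by (auto simp: pmf_map x vimage_def intro!: arg_cong[where f = "measure_pmf.prob (pair_pmf P P)"])
  finally show "pmf (map_pmf (\<lambda>w. (H w, {c. w c} \<inter> H w)) (bernoulli_field A p)) x =
     pmf (map_pmf (\<lambda>(w, w'). (H w, {c. w' c} \<inter> H w)) (pair_pmf (bernoulli_field A p) (bernoulli_field A p))) x"
    unfolding P .
qed

text \<open>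
  The region from which a chain starting in \<open>S\<close> can be continued.
\<close>
definition beyond :: "nat \<Rightarrow> (nat \<times> nat) set \<Rightarrow> (nat \<times> nat) set" where
  "beyond m S = {c. \<exists>q\<in>S. grel m q c}"

definition up_closed :: "(nat \<times> nat) set \<Rightarrow> bool" where
  "up_closed U \<longleftrightarrow> (\<forall>q\<in>U. \<forall>c. grel 0 q c \<longrightarrow> c \<in> U)"

lemma grel_trans: "grel m p q \<Longrightarrow> grel n q r \<Longrightarrow> grel m p r" "grel m p q \<Longrightarrow> grel n q r \<Longrightarrow> grel n p r"
  by (auto simp: grel_def)

lemma grel_0: "grel m p q \<Longrightarrow> grel 0 p q"
  by (auto simp: grel_def)

lemma up_closed_beyond: "up_closed (beyond m S)"
  by (auto simp: up_closed_def beyond_def intro: grel_trans)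

text \<open>
  At least two points are needed: the second point certifies that the remaining chain lies beyond some
  point of \<open>S \<inter> U\<close>, which may then be put in front.
\<close>
lemma has_chain_Suc_Suc:
  assumes "up_closed U"
  shows "has_chain m (Suc (Suc n)) (S \<inter> U) \<longleftrightarrow> has_chain m (Suc n) (S \<inter> beyond m (S \<inter> U))"
proof
  assume "has_chain m (Suc (Suc n)) (S \<inter> U)"
  then obtain qs where qs: "set qs \<subseteq> S \<inter> U" "sorted_wrt (grel m) qs" "length qs = Suc (Suc n)"
    by (auto simp: has_chain_def)
  moreover obtain q ps where "qs = q # ps" using qs(3) by (cases qs) auto
  ultimately have "set (q # ps) \<subseteq> S \<inter> U" "sorted_wrt (grel m) (q # ps)" "length ps = Suc n" by simp_all
  then show "has_chain m (Suc n) (S \<inter> beyond m (S \<inter> U))"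
    unfolding has_chain_def beyond_def by (intro exI[of _ ps]) auto
next
  assume "has_chain m (Suc n) (S \<inter> beyond m (S \<inter> U))"
  then obtain qs where qs: "set qs \<subseteq> S \<inter> beyond m (S \<inter> U)" "sorted_wrt (grel m) qs" "length qs = Suc n"
    by (auto simp: has_chain_def)
  moreover obtain c ps where "qs = c # ps" using qs(3) by (cases qs) auto
  ultimately have ps: "set (c # ps) \<subseteq> S \<inter> beyond m (S \<inter> U)" "sorted_wrt (grel m) (c # ps)" "length ps = n" by simp_all
  then obtain q where q: "q \<in> S" "q \<in> U" "grel m q c" by (auto simp: beyond_def)
  have "beyond m (S \<inter> U) \<subseteq> U" using assms by (auto simp: beyond_def up_closed_def dest: grel_0)
  then have "set (q # c # ps) \<subseteq> S \<inter> U" "sorted_wrt (grel m) (q # c # ps)"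
    using ps q by (auto intro: grel_trans)
  then show "has_chain m (Suc (Suc n)) (S \<inter> U)"
    using ps(3) unfolding has_chain_def by (intro exI[of _ "q # c # ps"]) auto
qed

text \<open>
  A point of \<open>S\<close> that lies itself beyond \<open>S\<close> adds nothing new, as a point of \<open>S\<close> with smallest first
  coordinate below a given cell shows; this needs \<open>m \<ge> 1\<close>.
\<close>
lemma beyond_stopping:
  assumes m: "m \<ge> 1"
  shows "beyond m S = K \<longleftrightarrow> beyond m (S - K) = K"
proof -
  have up: "\<exists>q\<in>S - beyond m S. grel m q c" if "c \<in> beyond m S" for c
  proof -
    (* descend to a point of S with the smallest first coordinate *)
    define P where "P k = (\<exists>q\<in>S. grel m q c \<and> fst q = k)" for k
    have "\<exists>k. P k" using that by (auto simp: beyond_def P_def)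
    then obtain k where k: "P k" "\<And>k'. k' < k \<Longrightarrow> \<not> P k'" using exists_least_iff[of P] by auto
    then obtain q where q: "q \<in> S" "grel m q c" "fst q = k" by (auto simp: P_def)
    have "q \<notin> beyond m S"
    proof
      assume "q \<in> beyond m S"
      then obtain q' where q': "q' \<in> S" "grel m q' q" by (auto simp: beyond_def)
      then have "fst q' < k" using m q(3) by (auto simp: grel_def)
      moreover have "P (fst q')" using q' q(2) by (auto simp: P_def intro: grel_trans)
      ultimately show False using k(2) by blast
    qed
    with q show ?thesis by blast
  qed
  have 1: "beyond m (S - beyond m S) = beyond m S"
    using up by (auto simp: beyond_def)
  have 2: "beyond m S = K" if "beyond m (S - K) = K"
  proof
    have "beyond m (S - K) \<subseteq> beyond m S" by (auto simp: beyond_def)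
    then show "K \<subseteq> beyond m S" using that by simp
    show "beyond m S \<subseteq> K"
    proof
      fix c assume "c \<in> beyond m S"
      then obtain q where q: "q \<in> S" "grel m q c" by (auto simp: beyond_def)
      show "c \<in> K"
      proof (cases "q \<in> K")
        case True
        then show ?thesis by (metis grel_0 q(2) that up_closed_beyond up_closed_def)
      next
        case False
        then have "c \<in> beyond m (S - K)" using q by (auto simp: beyond_def)
        then show ?thesis by (simp add: that)
      qed
    qed
  qed
  show ?thesis using 1 2 by metis
qed

definition chain_prob :: "real \<Rightarrow> nat \<Rightarrow> nat \<Rightarrow> (nat \<times> nat) set \<Rightarrow> nat \<Rightarrow> nat \<Rightarrow> real" where
  "chain_prob p m n U N M = measure_pmf.prob (bernoulli_field (grid N M) p) {w. has_chain m n ({c. w c} \<inter> grid N M \<inter> U)}"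

text \<open>
  After the first level has been found, the remaining chain lives in an independent environment.
\<close>
lemma chain_prob_Suc_Suc:
  assumes "m \<ge> 1" "up_closed U"
  shows "chain_prob p m (Suc (Suc n)) U N M =
    measure_pmf.expectation (bernoulli_field (grid N M) p)
      (\<lambda>w. chain_prob p m (Suc n) (beyond m ({c. w c} \<inter> grid N M \<inter> U)) N M)"
proof -
  let ?P = "bernoulli_field (grid N M) p"
  let ?H = "\<lambda>w. beyond m ({c. w c} \<inter> grid N M \<inter> U)"
  let ?Q = "\<lambda>(K, Y). has_chain m (Suc n) (Y \<inter> grid N M)"
  have st: "?H w = K \<longleftrightarrow> ?H (\<lambda>c. w c \<and> c \<notin> K) = K" for w K
  proof -
    have "{c. w c \<and> c \<notin> K} \<inter> grid N M \<inter> U = {c. w c} \<inter> grid N M \<inter> U - K" by auto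
    then show ?thesis using beyond_stopping[OF assms(1), of "{c. w c} \<inter> grid N M \<inter> U" K] by simp
  qed
  have "chain_prob p m (Suc (Suc n)) U N M = measure_pmf.prob (map_pmf (\<lambda>w. (?H w, {c. w c} \<inter> ?H w)) ?P) {z. ?Q z}"
    unfolding chain_prob_def has_chain_Suc_Suc[OF assms(2), of m n] by (simp add: Int_ac)
  also have "\<dots> = measure_pmf.prob (map_pmf (\<lambda>(w, w'). (?H w, {c. w' c} \<inter> ?H w)) (pair_pmf ?P ?P)) {z. ?Q z}"
    by (subst bernoulli_field_refresh) (use st in auto)
  also have "\<dots> = measure_pmf.prob (pair_pmf ?P ?P) {(w, w'). has_chain m (Suc n) ({c. w' c} \<inter> grid N M \<inter> ?H w)}"
    by (simp add: Int_ac case_prod_unfold)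
  finally show ?thesis unfolding prob_pair_pmf chain_prob_def .
qed

lemma chain_prob_shift:
  "chain_prob p m n (beyond (Suc d) S) (N + d) (M + d) = chain_prob p m n (beyond 1 S) N M"
proof -
  let ?f = "\<lambda>c :: nat \<times> nat. (fst c + d, snd c + d)"
  have field: "bernoulli_field (grid N M) p = map_pmf (\<lambda>w c. c \<in> grid N M \<and> w (?f c)) (bernoulli_field (grid (N + d) (M + d)) p)"
    by (intro bernoulli_field_reindex[symmetric]) (auto simp: grid_def inj_on_def)
  have "has_chain m n ({c. w c} \<inter> grid (N + d) (M + d) \<inter> beyond (Suc d) S) \<longleftrightarrow>
        has_chain m n ({c. c \<in> grid N M \<and> w (?f c)} \<inter> grid N M \<inter> beyond 1 S)" (is "has_chain m n ?A \<longleftrightarrow> has_chain m n ?B") for w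
  proof -
    have mem: "c \<in> ?B \<longleftrightarrow> ?f c \<in> ?A" for c
    proof -
      have "grel 1 q c \<longleftrightarrow> grel (Suc d) q (?f c)" for q by (auto simp: grel_def)
      then have "c \<in> beyond 1 S \<longleftrightarrow> ?f c \<in> beyond (Suc d) S" by (simp add: beyond_def)
      moreover have "c \<in> grid N M \<longleftrightarrow> ?f c \<in> grid (N + d) (M + d)" by (cases c) (simp add: grid_def)
      ultimately show ?thesis by blast
    qed
    show ?thesis
    proof
      assume "has_chain m n ?A"
      then obtain ps where ps: "set ps \<subseteq> ?A" "sorted_wrt (grel m) ps" "length ps = n" by (auto simp: has_chain_def)
      have big: "d \<le> fst c \<and> d \<le> snd c" if "c \<in> set ps" for c using ps(1) that by (auto simp: beyond_def grel_def)
      define qs where "qs = map (\<lambda>c. (fst c - d, snd c - d)) ps"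
      have "?f (fst c - d, snd c - d) = c" if "c \<in> set ps" for c using big[OF that] by simp
      then have "set qs \<subseteq> ?B" unfolding subset_iff mem using ps(1) by (auto simp only: qs_def set_map image_iff)
      moreover have "sorted_wrt (grel m) qs"
        unfolding qs_def sorted_wrt_map using ps(2) big by (auto simp: grel_def elim!: sorted_wrt_mono_rel[rotated])
      ultimately show "has_chain m n ?B" using ps(3) unfolding has_chain_def by (intro exI[of _ qs]) (simp add: qs_def)
    next
      assume "has_chain m n ?B"
      then obtain ps where ps: "set ps \<subseteq> ?B" "sorted_wrt (grel m) ps" "length ps = n" by (auto simp: has_chain_def)
      define qs where "qs = map ?f ps"
      have "set qs \<subseteq> ?A" using ps(1) unfolding qs_def subset_iff mem by (auto simp only: set_map image_iff)
      moreover have "sorted_wrt (grel m) qs"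
        unfolding qs_def sorted_wrt_map using ps(2) by (auto simp: grel_def elim!: sorted_wrt_mono_rel[rotated])
      ultimately show "has_chain m n ?A" using ps(3) unfolding has_chain_def by (intro exI[of _ qs]) (simp add: qs_def)
    qed
  qed
  then show ?thesis unfolding chain_prob_def field by simp
qed

text \<open>
  By the preceding recursion each of the first \<open>n\<close> points of the chain costs \<open>d + 1\<close> cells in either
  direction instead of one.  The shift by \<open>d\<close> is invisible to a fresh environment, so it can be
  undone at every level at the price of \<open>d\<close> rows and columns.
\<close>
lemma chain_prob_gap:
  assumes "up_closed U"
  shows "chain_prob p (Suc d) (Suc n) U (N + n * d) (M + n * d) = chain_prob p 1 (Suc n) U N M"
  using assms
proof (induction n arbitrary: U)
  case 0
  have "has_chain m (Suc 0) S \<longleftrightarrow> S \<noteq> {}" for m S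
  proof
    show "S \<noteq> {}" if "has_chain m (Suc 0) S"
      using that by (auto simp: has_chain_def length_Suc_conv)
    show "has_chain m (Suc 0) S" if "S \<noteq> {}"
    proof -
      obtain c where "c \<in> S" using \<open>S \<noteq> {}\<close> by blast
      then show ?thesis unfolding has_chain_def by (intro exI[of _ "[c]"]) simp
    qed
  qed
  then show ?case by (simp add: chain_prob_def)
next
  case (Suc n)
  let ?N = "N + Suc n * d" and ?M = "M + Suc n * d"
  let ?B = "\<lambda>w N M. beyond 1 ({c. w c} \<inter> grid N M \<inter> U)"
  have "chain_prob p (Suc d) (Suc (Suc n)) U ?N ?M =
     measure_pmf.expectation (bernoulli_field (grid ?N ?M) p)
      (\<lambda>w. chain_prob p (Suc d) (Suc n) (beyond (Suc d) ({c. w c} \<inter> grid ?N ?M \<inter> U)) ((N + n * d) + d) ((M + n * d) + d))"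
    using Suc.prems by (subst chain_prob_Suc_Suc) (simp_all add: algebra_simps)
  also have "\<dots> = measure_pmf.expectation (bernoulli_field (grid ?N ?M) p) (\<lambda>w. chain_prob p 1 (Suc n) (?B w ?N ?M) N M)"
    unfolding chain_prob_shift using Suc.IH up_closed_beyond by simp
  also have "\<dots> = measure_pmf.expectation (bernoulli_field (grid ?N ?M) p) (\<lambda>w. chain_prob p 1 (Suc n) (?B (\<lambda>c. c \<in> grid N M \<and> w c) N M) N M)"
  proof -
    have "grid N M \<inter> ?B w ?N ?M = grid N M \<inter> ?B (\<lambda>c. c \<in> grid N M \<and> w c) N M" for w
      by (fastforce simp: beyond_def grel_def grid_def)
    then show ?thesis unfolding chain_prob_def Int_assoc by simp
  qed
  also have "\<dots> = measure_pmf.expectation (map_pmf (\<lambda>w c. c \<in> grid N M \<and> w c) (bernoulli_field (grid ?N ?M) p)) (\<lambda>w. chain_prob p 1 (Suc n) (?B w N M) N M)"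
    by simp
  also have "map_pmf (\<lambda>w c. c \<in> grid N M \<and> w c) (bernoulli_field (grid ?N ?M) p) = bernoulli_field (grid N M) p"
    by (intro bernoulli_field_reindex[where f = "\<lambda>c. c"]) (auto simp: grid_def)
  also have "measure_pmf.expectation (bernoulli_field (grid N M) p) (\<lambda>w. chain_prob p 1 (Suc n) (?B w N M) N M) = chain_prob p 1 (Suc (Suc n)) U N M"
    using Suc.prems by (subst chain_prob_Suc_Suc[of 1 U]) simp_all
  finally show ?case .
qed

lemma gap_removal:
  "measure_pmf.prob (bernoulli_field (grid (N + n * d) (M + n * d)) p) {w. has_chain (Suc d) (Suc n) ({c. w c} \<inter> grid (N + n * d) (M + n * d))} =
   measure_pmf.prob (bernoulli_field (grid N M) p) {w. n < lpp0 w N M}"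
  using chain_prob_gap[of UNIV p d n N M] by (simp add: chain_prob_def up_closed_def has_chain_iff_lpp[unfolded One_nat_def] Suc_le_eq)

section \<open>Discretising the Poisson process\<close>

definition cell :: "real \<Rightarrow> nat \<times> nat \<Rightarrow> (real \<times> real) set" where
  "cell \<delta> c = {\<delta> * real (fst c)<..\<delta> * (real (fst c) + 1)} \<times>
     {\<delta> * real (snd c)<..\<delta> * (real (snd c) + 1)}"

definition occupied :: "real \<Rightarrow> (real \<times> real) set \<Rightarrow> (nat \<times> nat) set" where
  "occupied \<delta> X = {c. X \<inter> cell \<delta> c \<noteq> {}}"

definition cell_of :: "real \<Rightarrow> real \<times> real \<Rightarrow> nat \<times> nat" where
  "cell_of \<delta> y = (nat (\<lceil>fst y / \<delta>\<rceil> - 1), nat (\<lceil>snd y / \<delta>\<rceil> - 1))"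

lemma borel_rectangle:
  fixes a b c d :: real
  shows "{a<..b} \<times> {c<..d} \<in> sets borel" "bounded ({a<..b} \<times> {c<..d})"
    "a \<le> b \<Longrightarrow> c \<le> d \<Longrightarrow> measure lborel ({a<..b} \<times> {c<..d}) = (b - a) * (d - c)"
proof -
  show "{a<..b} \<times> {c<..d} \<in> sets borel"
    unfolding borel_prod[symmetric] by (intro pair_measureI) auto
  show "bounded ({a<..b} \<times> {c<..d})"
    by (intro bounded_Times bounded_subset[OF bounded_closed_interval, of _ a b] bounded_subset[OF bounded_closed_interval, of _ c d]) auto
  assume "a \<le> b" "c \<le> d"
  have "emeasure lborel ({a<..b} \<times> {c<..d}) = emeasure lborel {a<..b} * emeasure lborel {c<..d}"
    unfolding lborel_prod[symmetric] by (intro lborel.emeasure_pair_measure_Times) auto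
  then show "measure lborel ({a<..b} \<times> {c<..d}) = (b - a) * (d - c)"
    using \<open>a \<le> b\<close> \<open>c \<le> d\<close> by (simp add: measure_def enn2real_mult)
qed

lemma cell_properties:
  assumes "\<delta> > 0"
  shows "cell \<delta> c \<in> sets borel" "bounded (cell \<delta> c)" "measure lborel (cell \<delta> c) = \<delta>\<^sup>2" "cell \<delta> c \<subseteq> open_quadrant"
proof -
  show "cell \<delta> c \<in> sets borel" "bounded (cell \<delta> c)" unfolding cell_def by (rule borel_rectangle)+
  show "measure lborel (cell \<delta> c) = \<delta>\<^sup>2"
    unfolding cell_def using assms by (subst borel_rectangle) (auto simp: power2_eq_square algebra_simps)
  show "cell \<delta> c \<subseteq> open_quadrant"
  proof
    fix z assume "z \<in> cell \<delta> c"
    moreover have "0 \<le> \<delta> * fst c" "0 \<le> \<delta> * snd c" using assms by auto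
    ultimately show "z \<in> open_quadrant" unfolding cell_def open_quadrant_def by (auto simp: mem_Times_iff)
  qed
qed

lemma in_cell_of:
  assumes "\<delta> > 0" "fst y > 0" "snd y > 0"
  shows "y \<in> cell \<delta> (cell_of \<delta> y)"
proof -
  have *: "\<delta> * real (nat (\<lceil>x / \<delta>\<rceil> - 1)) < x \<and> x \<le> \<delta> * (real (nat (\<lceil>x / \<delta>\<rceil> - 1)) + 1)" if "x > 0" for x
  proof -
    have "\<lceil>x / \<delta>\<rceil> \<ge> 1" using that assms by (simp add: one_le_ceiling)
    then have e: "real (nat (\<lceil>x / \<delta>\<rceil> - 1)) = of_int \<lceil>x / \<delta>\<rceil> - 1" by simp
    have "of_int \<lceil>x / \<delta>\<rceil> - 1 < x / \<delta>" "x / \<delta> \<le> of_int \<lceil>x / \<delta>\<rceil>" by linarith+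
    then have "(of_int \<lceil>x / \<delta>\<rceil> - 1) * \<delta> < x" "x \<le> of_int \<lceil>x / \<delta>\<rceil> * \<delta>"
      using assms(1) by (simp_all only: pos_divide_le_eq pos_less_divide_eq)
    then show ?thesis unfolding e by (simp add: mult.commute)
  qed
  show ?thesis using *[OF assms(2)] *[OF assms(3)] by (simp add: cell_def cell_of_def mem_Times_iff)
qed

lemma inj_cell:
  assumes "\<delta> > 0" shows "inj (cell \<delta>)" "c \<noteq> c' \<Longrightarrow> cell \<delta> c \<inter> cell \<delta> c' = {}"
proof -
  have *: "i = j" if "\<delta> * real i < x" "x \<le> \<delta> * (real i + 1)" "\<delta> * real j < x" "x \<le> \<delta> * (real j + 1)" for i j :: nat and x
  proof -
    have "\<delta> * real i < \<delta> * (real j + 1)" "\<delta> * real j < \<delta> * (real i + 1)" using that by linarith+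
    then show "i = j" using assms by simp
  qed
  show 1: "cell \<delta> c \<inter> cell \<delta> c' = {}" if "c \<noteq> c'" for c c'
  proof (rule ccontr)
    assume "cell \<delta> c \<inter> cell \<delta> c' \<noteq> {}"
    then obtain y where y: "y \<in> cell \<delta> c" "y \<in> cell \<delta> c'" by blast
    then have "fst c = fst c'" "snd c = snd c'"
      unfolding cell_def mem_Times_iff greaterThanAtMost_iff by (metis *)+
    with that show False by (simp add: prod_eq_iff)
  qed
  show "inj (cell \<delta>)"
  proof (rule injI, rule ccontr)
    fix c c' assume eq: "cell \<delta> c = cell \<delta> c'" and "c \<noteq> c'"
    then have "cell \<delta> c = {}" using 1 by blast
    moreover have "(\<delta> * (real (fst c) + 1), \<delta> * (real (snd c) + 1)) \<in> cell \<delta> c" using assms by (auto simp: cell_def)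
    ultimately show False by simp
  qed
qed

lemma bernoulli_field_trace:
  assumes "finite A" "q \<in> {0..1}" "B \<subseteq> A"
  shows "measure_pmf.prob (bernoulli_field A q) {w. {c. w c} \<inter> A = B} = (\<Prod>c\<in>A. if c \<in> B then q else 1 - q)"
proof -
  have "{w. {c. w c} \<inter> A = B} = Pi A (\<lambda>c. {c \<in> B})" using assms(3) by (auto simp: Pi_iff)
  then have "measure_pmf.prob (bernoulli_field A q) {w. {c. w c} \<inter> A = B} = (\<Prod>c\<in>A. measure_pmf.prob (bernoulli_pmf q) {c \<in> B})"
    using assms by (simp add: measure_Pi_pmf_Pi)
  also have "\<dots> = (\<Prod>c\<in>A. if c \<in> B then q else 1 - q)"
    using assms by (intro prod.cong) (auto simp: measure_pmf_single)
  finally show ?thesis .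
qed

context poisson_process_quadrant
begin

lemma finite_cell: "\<omega> \<in> space M \<Longrightarrow> \<delta> > 0 \<Longrightarrow> finite (Xi \<omega> \<inter> cell \<delta> c)"
  using locally_finite cell_properties by blast

lemma occupied_trace:
  assumes \<delta>: "\<delta> > 0" and A: "finite A" and B: "B \<subseteq> A"
  shows "{\<omega> \<in> space M. occupied \<delta> (Xi \<omega>) \<inter> A = B} \<in> events"
    and "prob {\<omega> \<in> space M. occupied \<delta> (Xi \<omega>) \<inter> A = B} =
      (\<Prod>c\<in>A. if c \<in> B then 1 - exp (- (lam * \<delta>\<^sup>2)) else exp (- (lam * \<delta>\<^sup>2)))"
proof -
  let ?cnt = "\<lambda>C \<omega>. card (Xi \<omega> \<inter> C)"
  define T where "T C = (if C \<in> cell \<delta> ` B then {0<..} else {0::nat})" for C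
  have T: "T (cell \<delta> c) = (if c \<in> B then {0<..} else {0})" for c
    using inj_cell(1)[OF \<delta>] by (simp add: T_def inj_image_mem_iff)
  have occ: "c \<in> occupied \<delta> (Xi \<omega>) \<longleftrightarrow> ?cnt (cell \<delta> c) \<omega> > 0" if "\<omega> \<in> space M" for c \<omega>
    using finite_cell[OF that \<delta>, of c] by (auto simp: occupied_def card_gt_0_iff)
  have ev: "?cnt (cell \<delta> c) -` S \<inter> space M \<in> events" for c S
    using count_measurable[of "cell \<delta> c"] cell_properties[OF \<delta>, of c] by (auto intro: measurable_sets)
  have eq: "{\<omega> \<in> space M. occupied \<delta> (Xi \<omega>) \<inter> A = B} = (\<Inter>c\<in>A. ?cnt (cell \<delta> c) -` T (cell \<delta> c) \<inter> space M)" if "A \<noteq> {}"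
  proof -
    have "occupied \<delta> (Xi \<omega>) \<inter> A = B \<longleftrightarrow> (\<forall>c\<in>A. ?cnt (cell \<delta> c) \<omega> \<in> T (cell \<delta> c))" if "\<omega> \<in> space M" for \<omega>
    proof -
      have "occupied \<delta> (Xi \<omega>) \<inter> A = B \<longleftrightarrow> (\<forall>c\<in>A. c \<in> occupied \<delta> (Xi \<omega>) \<longleftrightarrow> c \<in> B)" using B by blast
      then show ?thesis unfolding occ[OF that] T by auto
    qed
    then show ?thesis using that by auto
  qed
  show "{\<omega> \<in> space M. occupied \<delta> (Xi \<omega>) \<inter> A = B} \<in> events"
  proof (cases "A = {}")
    case True
    then show ?thesis using B by simp
  next
    case False
    then show ?thesis unfolding eq[OF False] using A ev by (intro sets.finite_INT) auto
  qed
  show "prob {\<omega> \<in> space M. occupied \<delta> (Xi \<omega>) \<inter> A = B} =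
      (\<Prod>c\<in>A. if c \<in> B then 1 - exp (- (lam * \<delta>\<^sup>2)) else exp (- (lam * \<delta>\<^sup>2)))"
  proof (cases "A = {}")
    case True
    then show ?thesis using B by (simp add: prob_space)
  next
    case False
    have ind: "indep_vars (\<lambda>_. count_space UNIV) ?cnt (cell \<delta> ` A)"
    proof (rule count_indep)
      show "disjoint (cell \<delta> ` A)" unfolding disjoint_def
        using inj_cell(2)[OF \<delta>] by (metis imageE)
      show "C \<in> sets borel \<and> bounded C \<and> C \<subseteq> open_quadrant" if "C \<in> cell \<delta> ` A" for C
        using that cell_properties[OF \<delta>] by blast
    qed (use A in simp)
    have "prob {\<omega> \<in> space M. occupied \<delta> (Xi \<omega>) \<inter> A = B} = prob (\<Inter>C\<in>cell \<delta> ` A. ?cnt C -` T C \<inter> space M)"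
      unfolding eq[OF False] by simp
    also have "\<dots> = (\<Prod>C\<in>cell \<delta> ` A. prob (?cnt C -` T C \<inter> space M))"
      using A False by (intro indep_varsD[OF ind]) auto
    also have "\<dots> = (\<Prod>c\<in>A. prob (?cnt (cell \<delta> c) -` T (cell \<delta> c) \<inter> space M))"
      using inj_cell(1)[OF \<delta>] by (subst prod.reindex) (auto intro: inj_on_subset)
    also have "\<dots> = (\<Prod>c\<in>A. if c \<in> B then 1 - exp (- (lam * \<delta>\<^sup>2)) else exp (- (lam * \<delta>\<^sup>2)))"
    proof (intro prod.cong refl)
      fix c
      have e: "?cnt (cell \<delta> c) -` {0} \<inter> space M = {\<omega> \<in> space M. ?cnt (cell \<delta> c) \<omega> = 0}" by auto
      have z: "prob (?cnt (cell \<delta> c) -` {0} \<inter> space M) = exp (- (lam * \<delta>\<^sup>2))"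
        unfolding e using count_poisson[of "cell \<delta> c" 0] cell_properties[OF \<delta>, of c] by simp
      have "?cnt (cell \<delta> c) -` {0<..} \<inter> space M = space M - (?cnt (cell \<delta> c) -` {0} \<inter> space M)" by auto
      then have "prob (?cnt (cell \<delta> c) -` {0<..} \<inter> space M) = 1 - exp (- (lam * \<delta>\<^sup>2))"
        using prob_compl[OF ev[of c "{0}"]] z by simp
      with z show "prob (?cnt (cell \<delta> c) -` T (cell \<delta> c) \<inter> space M) = (if c \<in> B then 1 - exp (- (lam * \<delta>\<^sup>2)) else exp (- (lam * \<delta>\<^sup>2)))"
        by (simp add: T)
    qed
    finally show ?thesis .
  qed
qed

lemma occupied_law:
  assumes \<delta>: "\<delta> > 0" and A: "finite A"
  shows "{\<omega> \<in> space M. Q (occupied \<delta> (Xi \<omega>) \<inter> A)} \<in> events"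
    and "prob {\<omega> \<in> space M. Q (occupied \<delta> (Xi \<omega>) \<inter> A)} =
      measure_pmf.prob (bernoulli_field A (1 - exp (- (lam * \<delta>\<^sup>2)))) {w. Q ({c. w c} \<inter> A)}"
proof -
  define \<B> where "\<B> = {B. B \<subseteq> A \<and> Q B}"
  let ?q = "1 - exp (- (lam * \<delta>\<^sup>2))"
  have fin: "finite \<B>" using A by (simp add: \<B>_def)
  have q: "?q \<in> {0..1}" using intensity_pos by simp
  have eq: "{\<omega> \<in> space M. Q (occupied \<delta> (Xi \<omega>) \<inter> A)} = (\<Union>B\<in>\<B>. {\<omega> \<in> space M. occupied \<delta> (Xi \<omega>) \<inter> A = B})"
    by (auto simp: \<B>_def)
  have eq': "{w. Q ({c. w c} \<inter> A)} = (\<Union>B\<in>\<B>. {w. {c. w c} \<inter> A = B})"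
    by (auto simp: \<B>_def)
  have ev: "{\<omega> \<in> space M. occupied \<delta> (Xi \<omega>) \<inter> A = B} \<in> events" if "B \<in> \<B>" for B
    using that \<delta> A by (intro occupied_trace) (auto simp: \<B>_def)
  show "{\<omega> \<in> space M. Q (occupied \<delta> (Xi \<omega>) \<inter> A)} \<in> events"
    unfolding eq using fin ev by (intro sets.finite_UN) auto
  have "prob {\<omega> \<in> space M. Q (occupied \<delta> (Xi \<omega>) \<inter> A)} = (\<Sum>B\<in>\<B>. prob {\<omega> \<in> space M. occupied \<delta> (Xi \<omega>) \<inter> A = B})"
    unfolding eq using fin ev by (intro finite_measure_finite_Union) (auto simp: disjoint_family_on_def)
  also have "\<dots> = (\<Sum>B\<in>\<B>. measure_pmf.prob (bernoulli_field A ?q) {w. {c. w c} \<inter> A = B})"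
    using occupied_trace(2)[OF \<delta> A] bernoulli_field_trace[OF A q]
    by (intro sum.cong) (auto simp: \<B>_def cong: if_cong)
  also have "\<dots> = measure_pmf.prob (bernoulli_field A ?q) {w. Q ({c. w c} \<inter> A)}"
    unfolding eq' using fin by (intro measure_pmf.finite_measure_finite_Union[symmetric]) (auto simp: disjoint_family_on_def)
  finally show "prob {\<omega> \<in> space M. Q (occupied \<delta> (Xi \<omega>) \<inter> A)} =
      measure_pmf.prob (bernoulli_field A ?q) {w. Q ({c. w c} \<inter> A)}" .
qed

end

text \<open>
  Strict inequalities make the existence of a chain stable under a small perturbation of the points,
  which the weak inequalities in the definition of a chain with gap do not.  This is what allows
  discretisation and yields measurability.
\<close>
definition strict_chain :: "real \<Rightarrow> nat \<Rightarrow> (real \<times> real) set \<Rightarrow> real \<Rightarrow> real \<Rightarrow> bool" where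
  "strict_chain g n X a b \<longleftrightarrow> (\<exists>ps. set ps \<subseteq> X \<inter> ({0<..<a} \<times> {0<..<b}) \<and>
     sorted_wrt (\<lambda>p q. fst p + g < fst q \<and> snd p + g < snd q) ps \<and> length ps = n)"

text \<open>
  Number of cells kept along a side of length \<open>a\<close>.  Subtracting \<open>1\<close> keeps the closed upper ends of the
  cells strictly below \<open>a\<close>.
\<close>
definition cells :: "real \<Rightarrow> real \<Rightarrow> nat" where
  "cells \<delta> a = nat \<lfloor>a / \<delta>\<rfloor> - 1"

definition gap_cells :: "real \<Rightarrow> real \<Rightarrow> nat" where
  "gap_cells \<delta> g = nat \<lceil>g / \<delta>\<rceil>"

text \<open>
  One more cell than the rounded gap is required, so that any choice of points in the cells of a chain
  satisfies the gap condition.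
\<close>
definition cell_chain where
  "cell_chain \<delta> g n X a b \<longleftrightarrow> has_chain (Suc (gap_cells \<delta> g)) n (occupied \<delta> X \<inter> grid (cells \<delta> a) (cells \<delta> b))"

lemma cell_chain_imp_strict_chain:
  assumes \<delta>: "\<delta> > 0" and g: "g \<ge> 0" and c: "cell_chain \<delta> g n X a b"
  shows "strict_chain g n X a b"
proof -
  let ?S = "occupied \<delta> X \<inter> grid (cells \<delta> a) (cells \<delta> b)"
  obtain cs where cs: "set cs \<subseteq> ?S" "sorted_wrt (grel (Suc (gap_cells \<delta> g))) cs" "length cs = n"
    using c by (auto simp: cell_chain_def has_chain_def)
  define f where "f c = (SOME y. y \<in> X \<inter> cell \<delta> c)" for c
  have f: "f c \<in> X" "f c \<in> cell \<delta> c" if "c \<in> ?S" for c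
  proof -
    have "\<exists>y. y \<in> X \<inter> cell \<delta> c" using that unfolding occupied_def by blast
    then have "f c \<in> X \<inter> cell \<delta> c" unfolding f_def by (rule someI_ex)
    then show "f c \<in> X" "f c \<in> cell \<delta> c" by auto
  qed
  have inside: "x < a'" if "x \<le> \<delta> * (real i + 1)" "i < cells \<delta> a'" for x a' i
  proof -
    have k: "0 < nat \<lfloor>a' / \<delta>\<rfloor>" "i + 1 < nat \<lfloor>a' / \<delta>\<rfloor>" using that(2) unfolding cells_def by linarith+
    then have "real (nat \<lfloor>a' / \<delta>\<rfloor>) = of_int \<lfloor>a' / \<delta>\<rfloor>" by simp
    then have "real i + 1 < a' / \<delta>" using k(2) by linarith
    then have "\<delta> * (real i + 1) < a'" using \<delta> by (simp add: field_simps)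
    with that show ?thesis by simp
  qed
  have pos: "0 < x" if "\<delta> * real i < x" for x and i :: nat
  proof -
    have "0 \<le> \<delta> * real i" using \<delta> by simp
    then show ?thesis using that by linarith
  qed
  have gap: "x + g < y" if "x \<le> \<delta> * (real i + 1)" "\<delta> * real j < y" "i + Suc (gap_cells \<delta> g) \<le> j" for x y i j
  proof -
    have "g / \<delta> \<le> real (gap_cells \<delta> g)" using g \<delta> by (simp add: gap_cells_def real_nat_ceiling_ge)
    then have "g \<le> \<delta> * real (gap_cells \<delta> g)" using \<delta> by (simp add: field_simps)
    moreover have "\<delta> * (real i + 1 + real (gap_cells \<delta> g)) \<le> \<delta> * real j" using that(3) \<delta> by (intro mult_left_mono) auto
    ultimately show ?thesis using that(1,2) by (simp add: algebra_simps)
  qed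
  have "set (map f cs) \<subseteq> X \<inter> ({0<..<a} \<times> {0<..<b})"
  proof
    fix y assume "y \<in> set (map f cs)"
    then obtain c where c: "c \<in> ?S" "y = f c" using cs(1) by auto
    from c(1) have i: "fst c < cells \<delta> a" "snd c < cells \<delta> b" by (auto simp: grid_def mem_Times_iff)
    have "y \<in> X" and y: "\<delta> * real (fst c) < fst y" "fst y \<le> \<delta> * (real (fst c) + 1)"
      "\<delta> * real (snd c) < snd y" "snd y \<le> \<delta> * (real (snd c) + 1)"
      using f[OF c(1)] by (auto simp: c(2) cell_def mem_Times_iff)
    then show "y \<in> X \<inter> ({0<..<a} \<times> {0<..<b})"
      using pos[OF y(1)] pos[OF y(3)] inside[OF y(2) i(1)] inside[OF y(4) i(2)] by (simp add: mem_Times_iff)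
  qed
  moreover have "sorted_wrt (\<lambda>p q. fst p + g < fst q \<and> snd p + g < snd q) (map f cs)"
    unfolding sorted_wrt_map
  proof (rule sorted_wrt_mono_rel[OF _ cs(2)])
    fix c d assume "c \<in> set cs" "d \<in> set cs" and r: "grel (Suc (gap_cells \<delta> g)) c d"
    then have "f c \<in> cell \<delta> c" "f d \<in> cell \<delta> d" using f(2) cs(1) by blast+
    then show "fst (f c) + g < fst (f d) \<and> snd (f c) + g < snd (f d)"
      using r by (auto simp: cell_def grel_def mem_Times_iff intro: gap)
  qed
  ultimately show ?thesis using cs(3) unfolding strict_chain_def by (intro exI[of _ "map f cs"]) auto
qed

text \<open>
  The finitely many strict inequalities of a chain leave some room, which eventually exceeds three cells:
  this pays for rounding the two positions and the gap.
\<close>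
lemma eventually_cell_chain:
  assumes g: "g \<ge> 0" and c: "strict_chain g n X a b"
  shows "\<forall>\<^sub>F \<delta> in at_right 0. cell_chain \<delta> g n X a b"
proof -
  obtain ps where ps: "set ps \<subseteq> X \<inter> ({0<..<a} \<times> {0<..<b})"
     "sorted_wrt (\<lambda>p q. fst p + g < fst q \<and> snd p + g < snd q) ps" "length ps = n"
    using c by (auto simp: strict_chain_def)
  let ?i = "\<lambda>\<delta> x. nat (\<lceil>x / \<delta>\<rceil> - 1)"
  have inside: "\<forall>\<^sub>F \<delta> in at_right 0. ?i \<delta> x < cells \<delta> a'" if "0 < x" "x < a'" for x a' :: real
  proof -
    have "\<forall>\<^sub>F \<delta> in at_right 0. \<delta> < (a' - x) / 3" using that by (intro order_tendstoD(2)[OF tendsto_ident_at]) auto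
    moreover have "\<forall>\<^sub>F \<delta> in at_right 0. (0::real) < \<delta>" by (simp add: eventually_at_right_less)
    ultimately show ?thesis
    proof eventually_elim
      case (elim \<delta>)
      have "(x + 3 * \<delta>) / \<delta> < a' / \<delta>" using elim by (intro divide_strict_right_mono) auto
      then have "x / \<delta> + 3 < a' / \<delta>" using elim by (simp add: add_divide_distrib)
      moreover have "0 < x / \<delta>" using elim that by simp
      ultimately have "\<lceil>x / \<delta>\<rceil> - 1 < \<lfloor>a' / \<delta>\<rfloor> - 1 \<and> 1 \<le> \<lceil>x / \<delta>\<rceil>" by linarith
      then show ?case unfolding cells_def by linarith
    qed
  qed
  have gap: "\<forall>\<^sub>F \<delta> in at_right 0. ?i \<delta> x + Suc (gap_cells \<delta> g) \<le> ?i \<delta> y" if "0 < x" "x + g < y" for x y :: real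
  proof -
    have "\<forall>\<^sub>F \<delta> in at_right 0. \<delta> < (y - x - g) / 3" using that by (intro order_tendstoD(2)[OF tendsto_ident_at]) auto
    moreover have "\<forall>\<^sub>F \<delta> in at_right 0. (0::real) < \<delta>" by (simp add: eventually_at_right_less)
    ultimately show ?thesis
    proof eventually_elim
      case (elim \<delta>)
      have "(x + g + 3 * \<delta>) / \<delta> < y / \<delta>" using elim by (intro divide_strict_right_mono) auto
      then have "x / \<delta> + g / \<delta> + 3 < y / \<delta>" using elim by (simp add: add_divide_distrib)
      moreover have "0 < x / \<delta>" "0 \<le> g / \<delta>" using elim that g by simp_all
      ultimately have "\<lceil>x / \<delta>\<rceil> - 1 + (1 + \<lceil>g / \<delta>\<rceil>) \<le> \<lceil>y / \<delta>\<rceil> - 1 \<and> 1 \<le> \<lceil>x / \<delta>\<rceil> \<and> 0 \<le> \<lceil>g / \<delta>\<rceil>" by linarith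
      then show ?case unfolding gap_cells_def by linarith
    qed
  qed
  have "\<forall>\<^sub>F \<delta> in at_right 0. \<forall>p\<in>set ps. cell_of \<delta> p \<in> grid (cells \<delta> a) (cells \<delta> b)"
  proof (intro eventually_ball_finite finite_set ballI)
    fix p assume "p \<in> set ps"
    then have "0 < fst p" "fst p < a" "0 < snd p" "snd p < b" using ps(1) by auto
    then have "\<forall>\<^sub>F \<delta> in at_right 0. ?i \<delta> (fst p) < cells \<delta> a \<and> ?i \<delta> (snd p) < cells \<delta> b"
      by (intro eventually_conj inside)
    then show "\<forall>\<^sub>F \<delta> in at_right 0. cell_of \<delta> p \<in> grid (cells \<delta> a) (cells \<delta> b)"
      by (simp add: cell_of_def grid_def)
  qed
  moreover have "\<forall>\<^sub>F \<delta> in at_right 0. \<forall>p\<in>set ps. \<forall>q\<in>set ps. fst p + g < fst q \<and> snd p + g < snd q \<longrightarrow>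
     grel (Suc (gap_cells \<delta> g)) (cell_of \<delta> p) (cell_of \<delta> q)"
  proof (intro eventually_ball_finite finite_set ballI)
    fix p q assume "p \<in> set ps" "q \<in> set ps"
    then have pos: "0 < fst p" "0 < snd p" using ps(1) by auto
    show "\<forall>\<^sub>F \<delta> in at_right 0. fst p + g < fst q \<and> snd p + g < snd q \<longrightarrow>
     grel (Suc (gap_cells \<delta> g)) (cell_of \<delta> p) (cell_of \<delta> q)"
    proof (cases "fst p + g < fst q \<and> snd p + g < snd q")
      case True
      then have "\<forall>\<^sub>F \<delta> in at_right 0. ?i \<delta> (fst p) + Suc (gap_cells \<delta> g) \<le> ?i \<delta> (fst q) \<and> ?i \<delta> (snd p) + Suc (gap_cells \<delta> g) \<le> ?i \<delta> (snd q)"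
        using pos by (intro eventually_conj gap) auto
      then show ?thesis by eventually_elim (simp add: grel_def cell_of_def)
    next
      case False
      then show ?thesis by (intro always_eventually) blast
    qed
  qed
  moreover have "\<forall>\<^sub>F \<delta> in at_right 0. (0::real) < \<delta>" by (simp add: eventually_at_right_less)
  ultimately show ?thesis
  proof eventually_elim
    case (elim \<delta>)
    have "cell_of \<delta> p \<in> occupied \<delta> X" if "p \<in> set ps" for p
    proof -
      have "p \<in> X" "p \<in> cell \<delta> (cell_of \<delta> p)" using that ps(1) elim(3) by (auto intro!: in_cell_of)
      then show ?thesis by (auto simp: occupied_def)
    qed
    then have "set (map (cell_of \<delta>) ps) \<subseteq> occupied \<delta> X \<inter> grid (cells \<delta> a) (cells \<delta> b)" using elim(1) by auto
    moreover have "sorted_wrt (grel (Suc (gap_cells \<delta> g))) (map (cell_of \<delta>) ps)"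
      unfolding sorted_wrt_map using elim(2) by (intro sorted_wrt_mono_rel[OF _ ps(2)]) auto
    ultimately show ?case using ps(3) unfolding cell_chain_def has_chain_def by (intro exI[of _ "map (cell_of \<delta>) ps"]) auto
  qed
qed

context poisson_process_quadrant
begin

lemma cell_chain_event: "\<delta> > 0 \<Longrightarrow> {\<omega> \<in> space M. cell_chain \<delta> g n (Xi \<omega>) a b} \<in> events"
  unfolding cell_chain_def by (intro occupied_law) auto

lemma cell_chain_prob:
  assumes "\<delta> > 0"
  shows "prob {\<omega> \<in> space M. cell_chain \<delta> g n (Xi \<omega>) a b} =
    measure_pmf.prob (bernoulli_field (grid (cells \<delta> a) (cells \<delta> b)) (1 - exp (- (lam * \<delta>\<^sup>2))))
      {w. has_chain (Suc (gap_cells \<delta> g)) n ({c. w c} \<inter> grid (cells \<delta> a) (cells \<delta> b))}"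
  unfolding cell_chain_def using assms by (intro occupied_law) auto

text \<open>
  The event is both the union and the limit inferior of the events of having a chain of cells at the mesh
  sizes \<open>1 / (k + 1)\<close>.  The first gives measurability, and the second an arbitrarily fine mesh at which
  the discrete probability is almost as large.
\<close>
lemma strict_chain_approx:
  assumes g: "g \<ge> 0"
  shows "{\<omega> \<in> space M. strict_chain g n (Xi \<omega>) a b} \<in> events"
    and "e > 0 \<Longrightarrow> r > 0 \<Longrightarrow> \<exists>\<delta>>0. \<delta> \<le> r \<and> prob {\<omega> \<in> space M. strict_chain g n (Xi \<omega>) a b} \<le> prob {\<omega> \<in> space M. cell_chain \<delta> g n (Xi \<omega>) a b} + e"
proof -
  let ?S = "{\<omega> \<in> space M. strict_chain g n (Xi \<omega>) a b}"
  let ?d = "\<lambda>k. inverse (real (Suc k))"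
  define D where "D k = {\<omega> \<in> space M. cell_chain (?d k) g n (Xi \<omega>) a b}" for k
  define E where "E j = (\<Inter>k\<in>{j..}. D k)" for j
  have D: "D k \<in> events" for k unfolding D_def by (intro cell_chain_event) simp
  have E: "E j \<in> events" for j unfolding E_def using D by (intro sets.countable_INT') auto
  have U: "?S = (\<Union>j. E j)"
  proof (intro equalityI subsetI)
    fix \<omega> assume \<omega>: "\<omega> \<in> ?S"
    have "filterlim ?d (at_right 0) sequentially"
      by (rule filterlim_compose[OF filterlim_inverse_at_right_top filterlim_compose[OF filterlim_real_sequentially filterlim_Suc]])
    then have "\<forall>\<^sub>F k in sequentially. cell_chain (?d k) g n (Xi \<omega>) a b"
      using \<omega> by (intro eventually_compose_filterlim[OF eventually_cell_chain[OF g]]) auto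
    then obtain j where "\<forall>k\<ge>j. cell_chain (?d k) g n (Xi \<omega>) a b" by (auto simp: eventually_sequentially)
    then show "\<omega> \<in> (\<Union>j. E j)" using \<omega> by (auto simp: E_def D_def)
  next
    fix \<omega> assume "\<omega> \<in> (\<Union>j. E j)"
    then obtain j where "\<omega> \<in> D j" by (auto simp: E_def)
    then show "\<omega> \<in> ?S"
      using g by (auto simp: D_def intro: cell_chain_imp_strict_chain[of "?d j"])
  qed
  show "?S \<in> events" unfolding U using E by auto
  assume "e > 0" "r > 0"
  have "(\<lambda>j. prob (E j)) \<longlonglongrightarrow> prob ?S"
    unfolding U using E by (intro finite_Lim_measure_incseq) (auto simp: incseq_def E_def)
  then have "\<forall>\<^sub>F j in sequentially. prob ?S - e < prob (E j)"
    using \<open>e > 0\<close> by (intro order_tendstoD) auto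
  moreover have "\<forall>\<^sub>F j in sequentially. ?d j < r"
    using LIMSEQ_inverse_real_of_nat \<open>r > 0\<close> by (rule order_tendstoD)
  ultimately have "\<forall>\<^sub>F j in sequentially. prob ?S - e < prob (E j) \<and> ?d j < r"
    by eventually_elim simp
  then obtain j where j: "prob ?S - e < prob (E j)" "?d j < r"
    by (auto simp: eventually_sequentially)
  have "prob (E j) \<le> prob (D j)" using D by (intro finite_measure_mono) (auto simp: E_def)
  with j show "\<exists>\<delta>>0. \<delta> \<le> r \<and> prob ?S \<le> prob {\<omega> \<in> space M. cell_chain \<delta> g n (Xi \<omega>) a b} + e"
    by (intro exI[of _ "?d j"]) (auto simp: D_def)
qed

end

section \<open>The limit shape and the gapped grid\<close>

text \<open>
  Rationalising the numerator removes the apparent singularity at \<open>c = 1 / 2\<close>.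
\<close>
lemma limit_shape_alt:
  assumes "a > 0" "b > 0" "c \<ge> 0"
  shows "limit_shape c a b = 2 * a * b / (c * (a + b) + sqrt (c\<^sup>2 * (a - b)\<^sup>2 + a * b))"
proof -
  define R where "R = sqrt (c\<^sup>2 * (a - b)\<^sup>2 + a * b)"
  have ab: "a * b > 0" using assms by simp
  have R: "R > 0" "R\<^sup>2 = c\<^sup>2 * (a - b)\<^sup>2 + a * b" using ab by (auto simp: R_def add_nonneg_pos)
  have D: "c * (a + b) + R > 0" using assms R by (intro add_nonneg_pos) auto
  show ?thesis
  proof (cases "c = 1 / 2")
    case True
    have "c\<^sup>2 * (a - b)\<^sup>2 + a * b = ((a + b) / 2)\<^sup>2" unfolding True by (simp add: power2_eq_square field_simps)
    then have "R = (a + b) / 2" using assms unfolding R_def by simp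
    then have den: "c * (a + b) + R = a + b" unfolding True by (simp add: field_simps)
    show ?thesis by (simp only: limit_shape_def if_P[OF True] R_def[symmetric] den)
  next
    case False
    have ne: "4 * c\<^sup>2 - 1 \<noteq> 0"
    proof
      assume "4 * c\<^sup>2 - 1 = 0"
      then have "(2 * c)\<^sup>2 = 1\<^sup>2" by (simp add: power_mult_distrib)
      then have "2 * c = 1" using assms(3) by (subst (asm) power2_eq_iff_nonneg) auto
      with False show False by simp
    qed
    have "(c * (a + b) - R) * (c * (a + b) + R) = (c * (a + b))\<^sup>2 - R\<^sup>2" by (simp add: power2_eq_square algebra_simps)
    also have "\<dots> = a * b * (4 * c\<^sup>2 - 1)" unfolding R by (simp add: power2_eq_square algebra_simps)
    finally have "(c * (a + b) - R) / (4 * c\<^sup>2 - 1) = a * b / (c * (a + b) + R)"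
      using ne D by (simp add: field_simps)
    then have "2 * ((c * (a + b) - R) / (4 * c\<^sup>2 - 1)) = 2 * a * b / (c * (a + b) + R)" by simp
    then show ?thesis using False by (simp add: limit_shape_def diff_divide_distrib flip: R_def)
  qed
qed

text \<open>
  A chain of length \<open>f\<close> with gaps \<open>c\<close> uses up \<open>c f\<close> of either side and must fit, without gaps, into the rest.
\<close>
lemma limit_shape_fixed_point:
  assumes ab: "a > 0" "b > 0" and c: "c \<ge> 0"
  defines "f \<equiv> limit_shape c a b"
  shows "f > 0" "c * f < min a b" "f = 2 * sqrt ((a - c * f) * (b - c * f))"
proof -
  define R where "R = sqrt (c\<^sup>2 * (a - b)\<^sup>2 + a * b)"
  define D where "D = c * (a + b) + R"
  have ab': "a * b > 0" using ab by simp
  have R: "R > 0" "R\<^sup>2 = c\<^sup>2 * (a - b)\<^sup>2 + a * b" using ab' by (auto simp: R_def add_nonneg_pos)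
  have D: "D > 0" unfolding D_def using ab c R by (intro add_nonneg_pos) auto
  have f: "f = 2 * a * b / D" unfolding f_def D_def R_def by (rule limit_shape_alt[OF ab c])
  have "(c * \<bar>a - b\<bar>)\<^sup>2 < R\<^sup>2" unfolding R using ab' by (simp add: power_mult_distrib)
  then have "c * \<bar>a - b\<bar> < R" using R(1) by (rule power_less_imp_less_base[OF _ less_imp_le])
  then have "c * (a - b) < R" "c * (b - a) < R"
    using mult_left_mono[OF abs_ge_self, of c "a - b"] mult_left_mono[OF abs_ge_minus_self, of c "a - b"] c by auto
  then have pos: "D - 2 * b * c > 0" "D - 2 * a * c > 0" by (auto simp: D_def algebra_simps)
  show "f > 0" using f ab D by simp
  have a1: "a - c * f = a * (D - 2 * b * c) / D" and b1: "b - c * f = b * (D - 2 * a * c) / D"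
    using D by (auto simp: f field_simps)
  have "a - c * f > 0" "b - c * f > 0" unfolding a1 b1 using ab pos D by simp_all
  then show "c * f < min a b" by simp
  have "(D - 2 * b * c) * (D - 2 * a * c) = R\<^sup>2 - c\<^sup>2 * (a - b)\<^sup>2" by (simp add: D_def power2_eq_square algebra_simps)
  then have e: "(D - 2 * b * c) * (D - 2 * a * c) = a * b" unfolding R by simp
  have "(a - c * f) * (b - c * f) = a * b * ((D - 2 * b * c) * (D - 2 * a * c)) / (D * D)"
    unfolding a1 b1 by simp
  also have "\<dots> = (a * b / D)\<^sup>2" unfolding e by (simp add: power2_eq_square)
  finally show "f = 2 * sqrt ((a - c * f) * (b - c * f))" using ab D by (simp add: f)
qed

lemma tendsto_sqrt_one_minus_exp: "((\<lambda>y::real. sqrt (1 - exp (- y\<^sup>2)) / y) \<longlongrightarrow> 1) (at_right 0)"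
  by real_asymp

lemma cells_bounds:
  assumes "\<delta> > 0" "a \<ge> 0"
  shows "a / \<delta> - 2 \<le> cells \<delta> a" "cells \<delta> a \<le> a / \<delta>"
proof -
  have "0 \<le> a / \<delta>" using assms by simp
  then have f: "0 \<le> \<lfloor>a / \<delta>\<rfloor>" by simp
  then have n: "real (nat \<lfloor>a / \<delta>\<rfloor>) = of_int \<lfloor>a / \<delta>\<rfloor>" by simp
  have "real (nat \<lfloor>a / \<delta>\<rfloor>) - 1 \<le> cells \<delta> a" "cells \<delta> a \<le> real (nat \<lfloor>a / \<delta>\<rfloor>)" by (auto simp: cells_def)
  then show "a / \<delta> - 2 \<le> cells \<delta> a" "cells \<delta> a \<le> a / \<delta>" unfolding n by linarith+
qed

lemma gap_cells_bounds:
  assumes "\<delta> > 0" "g \<ge> 0"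
  shows "g / \<delta> \<le> gap_cells \<delta> g" "gap_cells \<delta> g \<le> g / \<delta> + 1"
proof -
  have "0 \<le> g / \<delta>" using assms by simp
  then have "real (gap_cells \<delta> g) = of_int \<lceil>g / \<delta>\<rceil>" by (simp add: gap_cells_def)
  then show "g / \<delta> \<le> gap_cells \<delta> g" "gap_cells \<delta> g \<le> g / \<delta> + 1" by linarith+
qed

definition grid_chain_prob :: "real \<Rightarrow> real \<Rightarrow> real \<Rightarrow> nat \<Rightarrow> real \<Rightarrow> real \<Rightarrow> real" where
  "grid_chain_prob lam \<delta> g n a b =
     measure_pmf.prob (bernoulli_field (grid (cells \<delta> a) (cells \<delta> b)) (1 - exp (- (lam * \<delta>\<^sup>2))))
      {w. has_chain (Suc (gap_cells \<delta> g)) n ({c. w c} \<inter> grid (cells \<delta> a) (cells \<delta> b))}"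

text \<open>
  Removing the gap from a chain of about \<open>x \<tau>\<close> cells shortens the sides \<open>a\<close> and \<open>b\<close> to \<open>a - c x\<close> and
  \<open>b - c x\<close>, and the law of large numbers without gaps decides whether the chain exists.
\<close>
lemma grid_chain_asymptotics:
  fixes F :: "'i filter" and \<delta> lam g T :: "'i \<Rightarrow> real"
  defines "\<tau> \<equiv> \<lambda>t. sqrt (lam t) * T t"
  assumes pos: "\<forall>\<^sub>F t in F. \<delta> t > 0 \<and> lam t > 0 \<and> T t > 0 \<and> g t \<ge> 0"
    and \<tau>: "filterlim \<tau> at_top F"
    and fine: "((\<lambda>t. sqrt (lam t) * \<delta> t) \<longlongrightarrow> 0) F"
    and gap: "((\<lambda>t. sqrt (lam t) * g t) \<longlongrightarrow> c) F"
    and x: "x > 0" "c * x < min a b" and ab: "a > 0" "b > 0"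
  defines "P \<equiv> \<lambda>t. grid_chain_prob (lam t) (\<delta> t) (g t) (nat \<lceil>x * \<tau> t\<rceil>) (a * T t) (b * T t)"
  shows "x > 2 * sqrt ((a - c * x) * (b - c * x)) \<Longrightarrow> (P \<longlongrightarrow> 0) F"
    and "x < 2 * sqrt ((a - c * x) * (b - c * x)) \<Longrightarrow> (P \<longlongrightarrow> 1) F"
proof -
  (* the mesh in units of the typical distance 1 / sqrt lam between points; sqrt p is asymptotic to y *)
  define y where "y t = sqrt (lam t) * \<delta> t" for t
  define p where "p t = 1 - exp (- (lam t * (\<delta> t)\<^sup>2))" for t
  define n where "n t = nat \<lceil>x * \<tau> t\<rceil> - 1" for t
  define d where "d t = gap_cells (\<delta> t) (g t)" for t
  define N where "N a t = cells (\<delta> t) (a * T t)" for a t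
  have \<tau>pos: "\<forall>\<^sub>F t in F. \<tau> t > 0" using \<tau> by (simp add: filterlim_at_top_dense)
  have y0: "(y \<longlongrightarrow> 0) F" unfolding y_def by (rule fine)
  have ypos: "\<forall>\<^sub>F t in F. y t > 0" using pos by eventually_elim (simp add: y_def)
  have p_y: "\<forall>\<^sub>F t in F. p t = 1 - exp (- (y t)\<^sup>2)" using pos by eventually_elim (simp add: p_def y_def power_mult_distrib)
  have "filterlim y (at_right 0) F" using y0 ypos by (auto simp: filterlim_at elim: eventually_mono)
  from filterlim_compose[OF tendsto_sqrt_one_minus_exp this]
  have "((\<lambda>t. sqrt (1 - exp (- (y t)\<^sup>2)) / y t) \<longlongrightarrow> 1) F" by simp
  then have \<rho>: "((\<lambda>t. sqrt (p t) / y t) \<longlongrightarrow> 1) F"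
    by (rule Lim_transform_eventually) (use p_y in \<open>auto elim: eventually_mono\<close>)
  have "((\<lambda>t. 1 - exp (- (y t)\<^sup>2)) \<longlongrightarrow> 1 - exp (- 0\<^sup>2)) F" by (intro tendsto_intros y0)
  then have p0: "(p \<longlongrightarrow> 0) F"
    by simp (rule Lim_transform_eventually, assumption, use p_y in \<open>auto elim: eventually_mono\<close>)
  have ppos: "\<forall>\<^sub>F t in F. p t > 0" using p_y ypos by eventually_elim auto
  interpret thin_grid F p \<tau> by unfold_locales fact+
  have y\<tau>: "((\<lambda>t. y t * inverse (\<tau> t)) \<longlongrightarrow> 0) F"
    using tendsto_mult[OF y0 tendsto_inverse_0_at_top[OF \<tau>]] by simp
  have cells_lim: "((\<lambda>t. y t * N a' t / \<tau> t) \<longlongrightarrow> a') F" if "a' > 0" for a'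
  proof (rule tendsto_sandwich)
    have "\<forall>\<^sub>F t in F. a' - 2 * (y t * inverse (\<tau> t)) \<le> y t * N a' t / \<tau> t \<and> y t * N a' t / \<tau> t \<le> a'"
      using pos \<tau>pos ypos
    proof eventually_elim
      case (elim t)
      have q: "y t / \<tau> t = \<delta> t / T t" using elim by (simp add: y_def \<tau>_def)
      have "a' * T t / \<delta> t - 2 \<le> N a' t" "N a' t \<le> a' * T t / \<delta> t"
        unfolding N_def using elim that by (intro cells_bounds; simp)+
      then have "y t / \<tau> t * (a' * T t / \<delta> t - 2) \<le> y t / \<tau> t * N a' t" "y t / \<tau> t * N a' t \<le> y t / \<tau> t * (a' * T t / \<delta> t)"
        using elim by (intro mult_left_mono; simp)+
      moreover have eq: "y t / \<tau> t * (a' * T t / \<delta> t) = a'" unfolding q using elim by simp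
      moreover have "y t / \<tau> t * (a' * T t / \<delta> t - 2) = a' - 2 * (y t * inverse (\<tau> t))"
        unfolding right_diff_distrib eq by (simp add: divide_inverse)
      ultimately show ?case by simp
    qed
    then show "\<forall>\<^sub>F t in F. a' - 2 * (y t * inverse (\<tau> t)) \<le> y t * N a' t / \<tau> t"
      "\<forall>\<^sub>F t in F. y t * N a' t / \<tau> t \<le> a'" by (auto elim: eventually_mono)
    show "((\<lambda>t. a' - 2 * (y t * inverse (\<tau> t))) \<longlongrightarrow> a') F"
      using tendsto_diff[OF tendsto_const[of a'] tendsto_mult[OF tendsto_const[of 2] y\<tau>]] by simp
  qed simp
  have d_lim: "((\<lambda>t. y t * d t) \<longlongrightarrow> c) F"
  proof (rule tendsto_sandwich)
    have "\<forall>\<^sub>F t in F. sqrt (lam t) * g t \<le> y t * d t \<and> y t * d t \<le> sqrt (lam t) * g t + y t"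
      using pos ypos
    proof eventually_elim
      case (elim t)
      have "y t * (g t / \<delta> t) \<le> y t * d t" "y t * d t \<le> y t * (g t / \<delta> t + 1)"
        unfolding d_def using elim by (intro mult_left_mono gap_cells_bounds; simp)+
      moreover have "y t * (g t / \<delta> t) = sqrt (lam t) * g t" using elim by (simp add: y_def)
      ultimately show ?case by (simp add: algebra_simps)
    qed
    then show "\<forall>\<^sub>F t in F. sqrt (lam t) * g t \<le> y t * d t"
      "\<forall>\<^sub>F t in F. y t * d t \<le> sqrt (lam t) * g t + y t" by (auto elim: eventually_mono)
    show "((\<lambda>t. sqrt (lam t) * g t + y t) \<longlongrightarrow> c) F" using tendsto_add[OF gap y0] by simp
  qed (rule gap)
  have n_bd: "\<forall>\<^sub>F t in F. x * \<tau> t - 1 \<le> n t \<and> n t \<le> x * \<tau> t \<and> Suc (n t) = nat \<lceil>x * \<tau> t\<rceil> \<and> x * \<tau> t \<le> Suc (n t)"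
    using \<tau>pos
  proof eventually_elim
    case (elim t)
    have "x * \<tau> t > 0" using elim x by simp
    then have "\<lceil>x * \<tau> t\<rceil> \<ge> 1" by (simp add: one_le_ceiling)
    then have S: "Suc (n t) = nat \<lceil>x * \<tau> t\<rceil>" and "real (nat \<lceil>x * \<tau> t\<rceil>) = of_int \<lceil>x * \<tau> t\<rceil>"
      unfolding n_def by linarith+
    then have "real (n t) + 1 = of_int \<lceil>x * \<tau> t\<rceil>" by (simp flip: S)
    with S show ?case by linarith
  qed
  have n_lim: "((\<lambda>t. n t / \<tau> t) \<longlongrightarrow> x) F"
  proof (rule tendsto_sandwich)
    have "\<forall>\<^sub>F t in F. x - inverse (\<tau> t) \<le> n t / \<tau> t \<and> n t / \<tau> t \<le> x"
      using n_bd \<tau>pos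
    proof eventually_elim
      case (elim t)
      have "(x * \<tau> t - 1) / \<tau> t \<le> n t / \<tau> t" "n t / \<tau> t \<le> x * \<tau> t / \<tau> t"
        using elim by (intro divide_right_mono; simp)+
      moreover have "(x * \<tau> t - 1) / \<tau> t = x - inverse (\<tau> t)" "x * \<tau> t / \<tau> t = x"
        using elim by (simp_all add: diff_divide_distrib inverse_eq_divide)
      ultimately show ?case by simp
    qed
    then show "\<forall>\<^sub>F t in F. x - inverse (\<tau> t) \<le> n t / \<tau> t" "\<forall>\<^sub>F t in F. n t / \<tau> t \<le> x" by (auto elim: eventually_mono)
    show "((\<lambda>t. x - inverse (\<tau> t)) \<longlongrightarrow> x) F"
      using tendsto_diff[OF tendsto_const[of x] tendsto_inverse_0_at_top[OF \<tau>]] by simp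
  qed simp
  have rest: "scales (\<lambda>t. N a' t - n t * d t) (a' - c * x) \<and> (\<forall>\<^sub>F t in F. n t * d t \<le> N a' t)" if a': "a' > 0" "c * x < a'" for a'
  proof -
    have "((\<lambda>t. sqrt (p t) / y t * (y t * N a' t / \<tau> t - n t / \<tau> t * (y t * d t))) \<longlongrightarrow> 1 * (a' - x * c)) F"
      by (intro tendsto_intros \<rho> cells_lim n_lim d_lim a')
    moreover have "\<forall>\<^sub>F t in F. sqrt (p t) / y t * (y t * N a' t / \<tau> t - n t / \<tau> t * (y t * d t)) = sqrt (p t) * (real (N a' t) - real (n t * d t)) / \<tau> t"
      using ypos
    proof eventually_elim
      case (elim t)
      have "y t * N a' t / \<tau> t - n t / \<tau> t * (y t * d t) = y t * ((real (N a' t) - real (n t * d t)) / \<tau> t)"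
        by (simp add: diff_divide_distrib right_diff_distrib)
      then show ?case using elim by simp
    qed
    ultimately have lim: "((\<lambda>t. sqrt (p t) * (real (N a' t) - real (n t * d t)) / \<tau> t) \<longlongrightarrow> a' - c * x) F"
      by (simp add: mult.commute) (rule Lim_transform_eventually)
    have "\<forall>\<^sub>F t in F. 0 < sqrt (p t) * (real (N a' t) - real (n t * d t)) / \<tau> t"
      using lim by (rule order_tendstoD) (use a' in simp)
    then have ev: "\<forall>\<^sub>F t in F. n t * d t \<le> N a' t"
      using ppos \<tau>pos by eventually_elim (simp add: zero_less_divide_iff zero_less_mult_iff flip: of_nat_mult)
    have "scales (\<lambda>t. N a' t - n t * d t) (a' - c * x)"
      unfolding scales_def using lim
      by (rule Lim_transform_eventually) (use ev in eventually_elim, simp add: of_nat_diff)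
    with ev show ?thesis by blast
  qed
  let ?N = "\<lambda>t. N a t - n t * d t" and ?M = "\<lambda>t. N b t - n t * d t"
  have sc: "scales ?N (a - c * x)" "scales ?M (b - c * x)" using rest ab x by auto
  have pos': "a - c * x > 0" "b - c * x > 0" using x by auto
  let ?Q = "\<lambda>t. bernoulli_field (grid (?N t) (?M t)) (p t)"
  let ?hit = "\<lambda>t. {w. n t < lpp0 w (?N t) (?M t)}" and ?miss = "\<lambda>t. {w. lpp0 w (?N t) (?M t) \<le> n t}"
  have big: "\<forall>\<^sub>F t in F. n t * d t \<le> N a t" "\<forall>\<^sub>F t in F. n t * d t \<le> N b t"
    using rest[of a] rest[of b] ab x by auto
  have PQ: "\<forall>\<^sub>F t in F. P t = measure_pmf.prob (?Q t) (?hit t)"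
    using big n_bd
  proof eventually_elim
    case (elim t)
    then have e: "?N t + n t * d t = N a t" "?M t + n t * d t = N b t" by auto
    show ?case
      using gap_removal[of "?N t" "n t" "d t" "?M t" "p t"] elim unfolding e
      by (simp add: P_def grid_chain_prob_def p_def N_def d_def)
  qed
  show "(P \<longlongrightarrow> 0) F" if "x > 2 * sqrt ((a - c * x) * (b - c * x))"
  proof -
    have "vanishing ?Q ?hit F"
    proof (rule vanishing_subset[OF lpp_upper_tail[OF sc pos' that]])
      show "\<forall>\<^sub>F t in F. (?hit t) \<subseteq> {w. x * \<tau> t \<le> lpp0 w (?N t) (?M t)}"
        using n_bd by eventually_elim auto
    qed
    then show ?thesis unfolding vanishing_def
      by (rule Lim_transform_eventually) (use PQ in \<open>auto elim: eventually_mono\<close>)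
  qed
  show "(P \<longlongrightarrow> 1) F" if "x < 2 * sqrt ((a - c * x) * (b - c * x))"
  proof -
    have "vanishing ?Q ?miss F"
    proof (rule vanishing_subset[OF lpp_lower_tail[OF sc pos' that]])
      show "\<forall>\<^sub>F t in F. (?miss t) \<subseteq> {w. lpp0 w (?N t) (?M t) \<le> x * \<tau> t}"
        using n_bd by eventually_elim auto
    qed
    then have "((\<lambda>t. 1 - measure_pmf.prob (?Q t) (?miss t)) \<longlongrightarrow> 1 - 0) F"
      unfolding vanishing_def by (intro tendsto_intros)
    moreover have "measure_pmf.prob (?Q t) (?hit t) = 1 - measure_pmf.prob (?Q t) (?miss t)" for t
    proof -
      have "(?hit t) = UNIV - (?miss t)" by auto
      then show ?thesis using measure_pmf.prob_compl[of "(?miss t)" "?Q t"] by simp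
    qed
    ultimately have "((\<lambda>t. measure_pmf.prob (?Q t) (?hit t)) \<longlongrightarrow> 1) F" by simp
    then show ?thesis by (rule Lim_transform_eventually) (use PQ in \<open>auto elim: eventually_mono\<close>)
  qed
qed

section \<open>Maximal chains of the Poisson process\<close>

abbreviation rectangle :: "real \<Rightarrow> real \<Rightarrow> (real \<times> real) set" where
  "rectangle a b \<equiv> {0<..<a} \<times> {0<..<b}"

definition gap_less :: "real \<Rightarrow> real \<times> real \<Rightarrow> real \<times> real \<Rightarrow> bool" where
  "gap_less h p q \<longleftrightarrow> fst p < fst q \<and> snd p < snd q \<and> hprec (h, h) p q"

lemma hchain_iff_sorted:
  assumes "h \<ge> 0"
  shows "hchain (h, h) X (a, b) ps \<longleftrightarrow> set ps \<subseteq> X \<inter> rectangle a b \<and> sorted_wrt (gap_less h) ps"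
proof -
  have "transp (gap_less h)" using assms by (auto simp: transp_def gap_less_def hprec_def)
  then show ?thesis
    by (simp add: hchain_def successively_conv_sorted_wrt flip: gap_less_def)
qed

lemma le_max_chain_iff:
  assumes fin: "finite (X \<inter> rectangle a b)" and h: "h \<ge> 0"
  shows "n \<le> max_chain (h, h) X (a, b) \<longleftrightarrow>
    (\<exists>ps. set ps \<subseteq> X \<inter> rectangle a b \<and> sorted_wrt (gap_less h) ps \<and> length ps = n)"
proof -
  define P where "P n = (\<exists>ps. hchain (h, h) X (a, b) ps \<and> length ps = n)" for n
  have P: "P n \<longleftrightarrow> (\<exists>ps. set ps \<subseteq> X \<inter> rectangle a b \<and> sorted_wrt (gap_less h) ps \<and> length ps = n)" for n
    by (simp add: P_def hchain_iff_sorted[OF h])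
  have bound: "k \<le> card (X \<inter> rectangle a b)" if Pk: "P k" for k
  proof -
    obtain ps where ps: "set ps \<subseteq> X \<inter> rectangle a b" "sorted_wrt (gap_less h) ps" "length ps = k"
      using Pk[unfolded P] by blast
    have "sorted_wrt (\<lambda>p q. p \<noteq> q) ps" by (rule sorted_wrt_mono_rel[OF _ ps(2)]) (auto simp: gap_less_def)
    then have "distinct ps" by (induction ps) auto
    then have "card (set ps) = k" using ps(3) by (simp add: distinct_card)
    then show ?thesis using card_mono[OF fin ps(1)] by simp
  qed
  have max: "max_chain (h, h) X (a, b) = Greatest P" by (simp add: max_chain_def P_def[abs_def])
  have "P 0" unfolding P by auto
  then have "P (Greatest P)" using bound by (rule GreatestI_nat) auto
  then obtain ps where ps: "set ps \<subseteq> X \<inter> rectangle a b" "sorted_wrt (gap_less h) ps" "length ps = Greatest P"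
    unfolding P by blast
  have "P n" if "n \<le> Greatest P"
    unfolding P using that ps by (intro exI[of _ "take n ps"]) (auto dest: in_set_takeD simp: sorted_wrt_take)
  moreover have "n \<le> Greatest P" if "P n" using that bound by (rule Greatest_le_nat) auto
  ultimately show ?thesis unfolding max P[symmetric] by metis
qed

lemma strict_chain_le_max_chain:
  assumes "finite (X \<inter> rectangle a b)" "h \<ge> 0" "strict_chain h n X a b"
  shows "n \<le> max_chain (h, h) X (a, b)"
proof -
  obtain ps where ps: "set ps \<subseteq> X \<inter> rectangle a b"
     "sorted_wrt (\<lambda>p q. fst p + h < fst q \<and> snd p + h < snd q) ps" "length ps = n"
    using assms(3) by (auto simp: strict_chain_def)
  have "sorted_wrt (gap_less h) ps"
    by (rule sorted_wrt_mono_rel[OF _ ps(2)]) (use assms(2) in \<open>auto simp: gap_less_def hprec_def\<close>)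
  with ps show ?thesis unfolding le_max_chain_iff[OF assms(1,2)] by blast
qed

text \<open>
  If \<open>h = 0\<close>, the strictness comes from the definition of a chain; otherwise from shrinking the gap.
\<close>
lemma max_chain_strict_chain:
  assumes "finite (X \<inter> rectangle a b)" "h \<ge> 0" "n \<le> max_chain (h, h) X (a, b)" and s: "0 < s" "s \<le> 1"
  shows "strict_chain (h * (1 - s)) n X a b"
proof -
  obtain ps where ps: "set ps \<subseteq> X \<inter> rectangle a b" "sorted_wrt (gap_less h) ps" "length ps = n"
    using assms(3) unfolding le_max_chain_iff[OF assms(1,2)] by blast
  have "h = 0 \<or> h * (1 - s) < h" using assms(2) s by (cases "h = 0") (auto simp: algebra_simps)
  then have "sorted_wrt (\<lambda>p q. fst p + h * (1 - s) < fst q \<and> snd p + h * (1 - s) < snd q) ps"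
    by (intro sorted_wrt_mono_rel[OF _ ps(2)]) (auto simp: gap_less_def hprec_def)
  with ps show ?thesis unfolding strict_chain_def by blast
qed

lemma max_chain_length_bound:
  assumes fin: "finite (X \<inter> rectangle a b)" and h: "h \<ge> 0" and n: "Suc n \<le> max_chain (h, h) X (a, b)"
  shows "n * h < min a b"
proof -
  obtain ps where ps: "set ps \<subseteq> X \<inter> rectangle a b" "sorted_wrt (gap_less h) ps" "length ps = Suc n"
    using n unfolding le_max_chain_iff[OF fin h] by blast
  have "fst (ps ! 0) + k * h \<le> fst (ps ! k) \<and> snd (ps ! 0) + k * h \<le> snd (ps ! k)" if "k \<le> n" for k
    using that
  proof (induction k)
    case (Suc k)
    have "gap_less h (ps ! k) (ps ! Suc k)" using sorted_wrt_nth_less[OF ps(2), of k "Suc k"] ps(3) Suc.prems by simp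
    then show ?case using Suc by (simp add: gap_less_def hprec_def algebra_simps)
  qed simp
  from this[of n] have "fst (ps ! 0) + n * h \<le> fst (ps ! n)" "snd (ps ! 0) + n * h \<le> snd (ps ! n)" by auto
  moreover have "ps ! 0 \<in> rectangle a b" "ps ! n \<in> rectangle a b" using ps(1,3) nth_mem[of _ ps] by (metis IntE lessI subsetD zero_less_Suc)+
  ultimately show ?thesis by (auto simp: mem_Times_iff)
qed

context poisson_process_quadrant
begin

lemma finite_rectangle: "\<omega> \<in> space M \<Longrightarrow> finite (Xi \<omega> \<inter> rectangle a b)"
proof (rule locally_finite)
  have "bounded {0<..<x}" for x :: real by (rule bounded_subset[OF bounded_closed_interval, of _ 0 x]) auto
  then show "bounded (rectangle a b)" by (intro bounded_Times)
qed

text \<open>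
  Among finitely many points, no difference of coordinates lies strictly between \<open>h - h / (k + 1)\<close> and \<open>h\<close>
  once \<open>k\<close> is large.  So chains exist for gap \<open>h\<close> if they exist for all these smaller gaps, and for those
  strict chains suffice.
\<close>
lemma max_chain_event:
  assumes h: "h \<ge> 0"
  shows "{\<omega> \<in> space M. n \<le> max_chain (h, h) (Xi \<omega>) (a, b)} \<in> events"
proof -
  let ?s = "\<lambda>k. inverse (real (Suc k))"
  have "{\<omega> \<in> space M. n \<le> max_chain (h, h) (Xi \<omega>) (a, b)} =
     (\<Inter>k. {\<omega> \<in> space M. strict_chain (h * (1 - ?s k)) n (Xi \<omega>) a b})"
  proof (intro equalityI subsetI INT_I)
    fix \<omega> k assume "\<omega> \<in> {\<omega> \<in> space M. n \<le> max_chain (h, h) (Xi \<omega>) (a, b)}"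
    then show "\<omega> \<in> {\<omega> \<in> space M. strict_chain (h * (1 - ?s k)) n (Xi \<omega>) a b}"
      using max_chain_strict_chain[OF finite_rectangle h, of \<omega> n a b "?s k"] by (simp add: field_simps)
  next
    fix \<omega> assume all: "\<omega> \<in> (\<Inter>k. {\<omega> \<in> space M. strict_chain (h * (1 - ?s k)) n (Xi \<omega>) a b})"
    then have \<omega>: "\<omega> \<in> space M" by auto
    let ?Y = "Xi \<omega> \<inter> rectangle a b"
    let ?rounds = "\<lambda>k p q. (fst p + h * (1 - ?s k) < fst q \<longrightarrow> fst p + h \<le> fst q) \<and>
      (snd p + h * (1 - ?s k) < snd q \<longrightarrow> snd p + h \<le> snd q)"
    note fin = finite_rectangle[OF \<omega>, of a b]
    have ev: "\<forall>\<^sub>F k in sequentially. x + h * (1 - ?s k) < y \<longrightarrow> x + h \<le> y" for x y :: real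
    proof (cases "x + h \<le> y")
      case False
      have "(\<lambda>k. x + h * (1 - ?s k)) \<longlonglongrightarrow> x + h * (1 - 0)"
        by (intro tendsto_intros LIMSEQ_inverse_real_of_nat)
      then have "\<forall>\<^sub>F k in sequentially. y < x + h * (1 - ?s k)"
        by (rule order_tendstoD) (use False in simp)
      then show ?thesis by eventually_elim simp
    qed simp
    have "\<forall>\<^sub>F k in sequentially. \<forall>p\<in>?Y. \<forall>q\<in>?Y.
       ?rounds k p q"
      by (intro eventually_ball_finite ballI fin eventually_conj ev)
    then obtain k where k: "\<And>p q. p \<in> ?Y \<Longrightarrow> q \<in> ?Y \<Longrightarrow>
       ?rounds k p q"
      unfolding eventually_sequentially by blast
    have "strict_chain (h * (1 - ?s k)) n (Xi \<omega>) a b" using all by blast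
    then obtain ps where ps: "set ps \<subseteq> ?Y" "length ps = n"
      "sorted_wrt (\<lambda>p q. fst p + h * (1 - ?s k) < fst q \<and> snd p + h * (1 - ?s k) < snd q) ps"
      unfolding strict_chain_def by blast
    have nn: "0 \<le> h * (1 - ?s k)" using h by (intro mult_nonneg_nonneg) (auto simp: field_simps)
    have "sorted_wrt (gap_less h) ps"
    proof (rule sorted_wrt_mono_rel[OF _ ps(3)])
      fix p q assume "p \<in> set ps" "q \<in> set ps" and r: "fst p + h * (1 - ?s k) < fst q \<and> snd p + h * (1 - ?s k) < snd q"
      then have "p \<in> ?Y" "q \<in> ?Y" using ps(1) by auto
      from k[OF this] r nn show "gap_less h p q" by (simp add: gap_less_def hprec_def)
    qed
    then have "n \<le> max_chain (h, h) (Xi \<omega>) (a, b)"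
      unfolding le_max_chain_iff[OF fin h] using ps by blast
    with \<omega> show "\<omega> \<in> {\<omega> \<in> space M. n \<le> max_chain (h, h) (Xi \<omega>) (a, b)}" by simp
  qed
  also have "\<dots> \<in> events"
    using h by (intro sets.countable_INT') (auto intro!: strict_chain_approx(1) mult_nonneg_nonneg simp: field_simps)
  finally show ?thesis .
qed

text \<open>
  Consecutive squares of side \<open>\<eta> h\<close> on the diagonal are separated by \<open>h\<close>, so one point from each
  occupied square gives a chain.  The expected proportion of empty squares is
  \<open>exp (- lam (\<eta> h)\<^sup>2)\<close>, and Markov's inequality applies.
\<close>
lemma diagonal_squares:
  assumes h: "h > 0" and \<eta>: "\<eta> > 0" and K: "K * ((1 + \<eta>) * h) \<le> min a b" and \<epsilon>: "\<epsilon> > 0"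
  shows "prob {\<omega> \<in> space M. max_chain (h, h) (Xi \<omega>) (a, b) < (1 - \<epsilon>) * real K} \<le> exp (- (lam * (\<eta> * h)\<^sup>2)) / \<epsilon>"
proof (cases "K = 0")
  case True
  then show ?thesis using \<epsilon> by simp
next
  case False
  let ?short = "{\<omega> \<in> space M. max_chain (h, h) (Xi \<omega>) (a, b) < (1 - \<epsilon>) * real K}"
  define l where "l = (1 + \<eta>) * h"
  have l: "l > 0" "l = \<eta> * h + h" using h \<eta> by (auto simp: l_def algebra_simps intro: add_pos_pos)
  define I where "I k = {real k * l<..real k * l + \<eta> * h}" for k
  define Q where "Q k = I k \<times> I k" for k
  have Q: "Q k \<in> sets borel" "bounded (Q k)" "Q k \<subseteq> open_quadrant" "measure lborel (Q k) = (\<eta> * h)\<^sup>2" for k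
  proof -
    show "Q k \<in> sets borel" "bounded (Q k)" unfolding Q_def I_def by (rule borel_rectangle)+
    show "measure lborel (Q k) = (\<eta> * h)\<^sup>2"
      unfolding Q_def I_def using h \<eta> by (subst borel_rectangle) (auto simp: power2_eq_square)
    have "0 < y" if "y \<in> I k" for y
    proof -
      have "0 \<le> real k * l" using l(1) by simp
      moreover have "real k * l < y" using that by (simp add: I_def)
      ultimately show ?thesis by linarith
    qed
    then show "Q k \<subseteq> open_quadrant" by (auto simp: Q_def open_quadrant_def)
  qed
  define E where "E k = {\<omega> \<in> space M. card (Xi \<omega> \<inter> Q k) = 0}" for k
  have E: "E k \<in> events" for k
  proof -
    have "E k = (\<lambda>\<omega>. card (Xi \<omega> \<inter> Q k)) -` {0} \<inter> space M" by (auto simp: E_def)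
    then show ?thesis using count_measurable[of "Q k"] Q[of k] by (auto intro: measurable_sets)
  qed
  have pE: "prob (E k) = exp (- (lam * (\<eta> * h)\<^sup>2))" for k
    unfolding E_def using count_poisson[of "Q k" 0] Q[of k] by simp
  define Z where "Z \<omega> = (\<Sum>k<K. indicator (E k) \<omega> :: real)" for \<omega>
  have int: "integrable M Z" unfolding Z_def using E by (intro Bochner_Integration.integrable_sum) (simp add: integrable_indicator_iff emeasure_eq_measure)
  have EZ: "expectation Z = K * exp (- (lam * (\<eta> * h)\<^sup>2))"
    unfolding Z_def using E pE by (subst Bochner_Integration.integral_sum) (auto simp: integrable_indicator_iff emeasure_eq_measure)
  have chain: "K - Z \<omega> \<le> max_chain (h, h) (Xi \<omega>) (a, b)" if \<omega>: "\<omega> \<in> space M" for \<omega>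
  proof -
    define ks where "ks = filter (\<lambda>k. Xi \<omega> \<inter> Q k \<noteq> {}) [0..<K]"
    define f where "f k = (SOME y. y \<in> Xi \<omega> \<inter> Q k)" for k
    have f: "f k \<in> Xi \<omega> \<and> f k \<in> Q k \<and> k < K" if "k \<in> set ks" for k
    proof -
      have "\<exists>y. y \<in> Xi \<omega> \<inter> Q k" "k < K" using that by (auto simp: ks_def)
      then show ?thesis using someI_ex[of "\<lambda>y. y \<in> Xi \<omega> \<inter> Q k"] by (auto simp: f_def)
    qed
    have low: "0 < y \<and> y < min a b" if "y \<in> I k" "k < K" for y k
    proof -
      have "0 \<le> real k * l" using l by simp
      moreover have "(real k + 1) * l \<le> real K * l" using that l by (intro mult_right_mono) auto
      moreover have "real K * l \<le> min a b" using K by (simp only: l_def)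
      moreover have "real k * l < y" "y \<le> real k * l + \<eta> * h" using that(1) by (auto simp: I_def)
      moreover have "(real k + 1) * l = real k * l + (\<eta> * h + h)" unfolding distrib_right using l(2) by linarith
      ultimately show ?thesis using h by linarith
    qed
    have step: "x + h < y" if "x \<in> I j" "y \<in> I k" "j < k" for x y j k
    proof -
      have "(real j + 1) * l \<le> real k * l" using that l by (intro mult_right_mono) auto
      moreover have "x \<le> real j * l + \<eta> * h" "real k * l < y" using that by (auto simp: I_def)
      moreover have "(real j + 1) * l = real j * l + (\<eta> * h + h)" unfolding distrib_right using l(2) by linarith
      ultimately show ?thesis by linarith
    qed
    have "strict_chain h (length ks) (Xi \<omega>) a b"
      unfolding strict_chain_def
    proof (intro exI conjI)
      show "set (map f ks) \<subseteq> Xi \<omega> \<inter> rectangle a b"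
      proof
        fix y assume "y \<in> set (map f ks)"
        then obtain k where "k \<in> set ks" "y = f k" by auto
        then have "y \<in> Xi \<omega>" "fst y \<in> I k" "snd y \<in> I k" "k < K" using f[of k] by (auto simp: Q_def mem_Times_iff)
        then show "y \<in> Xi \<omega> \<inter> rectangle a b" using low[of "fst y" k] low[of "snd y" k] by (auto simp: mem_Times_iff)
      qed
      have "sorted_wrt (<) ks" by (simp add: ks_def sorted_wrt_filter)
      then show "sorted_wrt (\<lambda>p q. fst p + h < fst q \<and> snd p + h < snd q) (map f ks)"
        unfolding sorted_wrt_map
      proof (rule sorted_wrt_mono_rel[rotated])
        fix j k assume "j \<in> set ks" "k \<in> set ks" "j < k"
        then show "fst (f j) + h < fst (f k) \<and> snd (f j) + h < snd (f k)"
          using f[of j] f[of k] step by (auto simp: Q_def mem_Times_iff)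
      qed
    qed simp
    then have "length ks \<le> max_chain (h, h) (Xi \<omega>) (a, b)"
      using h by (intro strict_chain_le_max_chain finite_rectangle \<omega>) auto
    moreover have "Z \<omega> = (\<Sum>k<K. if Xi \<omega> \<inter> Q k = {} then 1 else 0)"
      unfolding Z_def using \<omega> locally_finite[OF \<omega> Q(2)] by (intro sum.cong) (auto simp: E_def indicator_def)
    then have "Z \<omega> = card {k. k < K \<and> Xi \<omega> \<inter> Q k = {}}"
      by (simp add: sum.If_cases Int_def)
    moreover have "length ks = card {k. k < K \<and> Xi \<omega> \<inter> Q k \<noteq> {}}"
      unfolding ks_def by (simp add: distinct_length_filter Int_def conj_commute)
    moreover have "card {k. k < K \<and> Xi \<omega> \<inter> Q k \<noteq> {}} + card {k. k < K \<and> Xi \<omega> \<inter> Q k = {}} = K"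
    proof -
      have "card ({k. k < K \<and> Xi \<omega> \<inter> Q k \<noteq> {}} \<union> {k. k < K \<and> Xi \<omega> \<inter> Q k = {}}) =
        card {k. k < K \<and> Xi \<omega> \<inter> Q k \<noteq> {}} + card {k. k < K \<and> Xi \<omega> \<inter> Q k = {}}"
        by (intro card_Un_disjoint) auto
      moreover have "{k. k < K \<and> Xi \<omega> \<inter> Q k \<noteq> {}} \<union> {k. k < K \<and> Xi \<omega> \<inter> Q k = {}} = {..<K}" by auto
      ultimately show ?thesis by simp
    qed
    ultimately show ?thesis by linarith
  qed
  have Z0: "0 \<le> Z \<omega>" for \<omega> by (simp add: Z_def sum_nonneg)
  have "prob ?short \<le> prob {\<omega> \<in> space M. \<epsilon> * K \<le> Z \<omega>}"
  proof (rule finite_measure_mono)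
    show "{\<omega> \<in> space M. \<epsilon> * K \<le> Z \<omega>} \<in> events" using int by measurable
    show "?short \<subseteq> {\<omega> \<in> space M. \<epsilon> * K \<le> Z \<omega>}"
    proof
      fix \<omega> assume "\<omega> \<in> ?short"
      then have "\<omega> \<in> space M" "max_chain (h, h) (Xi \<omega>) (a, b) < (1 - \<epsilon>) * real K" by auto
      then show "\<omega> \<in> {\<omega> \<in> space M. \<epsilon> * K \<le> Z \<omega>}" using chain[of \<omega>] by (simp add: algebra_simps)
    qed
  qed
  also have "\<dots> \<le> expectation Z / (\<epsilon> * K)"
    using int \<epsilon> False by (intro integral_Markov_inequality_measure[where A = "{}"]) (auto simp: Z0)
  also have "\<dots> = exp (- (lam * (\<eta> * h)\<^sup>2)) / \<epsilon>" unfolding EZ using False by simp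
  finally show ?thesis .
qed

end

text \<open>
  The upper tail is needed only near the limit: beyond it the probability is monotone.  For the gapped
  model the asymptotics is available only there, where the chain still fits into the rectangle.
\<close>
lemma tendsto_in_prob_from_tails:
  fixes L :: "'i \<Rightarrow> 'a \<Rightarrow> nat" and s :: "'i \<Rightarrow> real"
  assumes M: "\<forall>\<^sub>F t in F. prob_space (M t)"
    and ev: "\<forall>\<^sub>F t in F. \<forall>n. {\<omega> \<in> space (M t). n \<le> L t \<omega>} \<in> sets (M t)"
    and s: "\<forall>\<^sub>F t in F. s t > 0" and l: "l > 0" and \<eta>: "\<eta> > 0"
    and upper: "\<And>x. l < x \<Longrightarrow> x < l + \<eta> \<Longrightarrow> ((\<lambda>t. measure (M t) {\<omega> \<in> space (M t). nat \<lceil>x * s t\<rceil> \<le> L t \<omega>}) \<longlongrightarrow> 0) F"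
    and lower: "\<And>x. 0 < x \<Longrightarrow> x < l \<Longrightarrow> ((\<lambda>t. measure (M t) {\<omega> \<in> space (M t). nat \<lceil>x * s t\<rceil> \<le> L t \<omega>}) \<longlongrightarrow> 1) F"
  shows "tendsto_in_prob M (\<lambda>t \<omega>. real (L t \<omega>) / s t) l F"
  unfolding tendsto_in_prob_def
proof (intro conjI allI impI)
  show "\<forall>\<^sub>F t in F. (\<lambda>\<omega>. real (L t \<omega>) / s t) \<in> borel_measurable (M t)"
    using ev
  proof eventually_elim
    case (elim t)
    have "(\<lambda>\<omega>. real (L t \<omega>)) \<in> borel_measurable (M t)"
      unfolding borel_measurable_iff_ge
    proof
      fix r
      have "{\<omega> \<in> space (M t). r \<le> real (L t \<omega>)} = {\<omega> \<in> space (M t). nat \<lceil>r\<rceil> \<le> L t \<omega>}"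
        by (simp add: nat_ceiling_le_eq)
      then show "{\<omega> \<in> space (M t). r \<le> real (L t \<omega>)} \<in> sets (M t)" using elim by metis
    qed
    then show ?case by simp
  qed
  fix \<epsilon> :: real assume "\<epsilon> > 0"
  let ?far = "\<lambda>t. {\<omega> \<in> space (M t). \<epsilon> < \<bar>real (L t \<omega>) / s t - l\<bar>}"
  define x where "x = l + min \<epsilon> \<eta> / 2"
  define y where "y = max (l / 2) (l - \<epsilon> / 2)"
  have x: "l < x" "x < l + \<eta>" "x < l + \<epsilon>" using \<open>\<epsilon> > 0\<close> \<eta> by (auto simp: x_def min_def)
  have y: "0 < y" "y < l" "l - \<epsilon> < y" using \<open>\<epsilon> > 0\<close> l by (auto simp: y_def max_def)
  let ?U = "\<lambda>t. {\<omega> \<in> space (M t). nat \<lceil>x * s t\<rceil> \<le> L t \<omega>}" and ?V = "\<lambda>t. {\<omega> \<in> space (M t). nat \<lceil>y * s t\<rceil> \<le> L t \<omega>}"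
  show "((\<lambda>t. measure (M t) (?far t)) \<longlongrightarrow> 0) F"
  proof (rule tendsto_sandwich[of "\<lambda>_. 0"])
    have "((\<lambda>t. measure (M t) (?U t) + (1 - measure (M t) (?V t))) \<longlongrightarrow> 0 + (1 - 1)) F"
      by (intro tendsto_add tendsto_diff tendsto_const upper[OF x(1,2)] lower[OF y(1,2)])
    then show "((\<lambda>t. measure (M t) (?U t) + (1 - measure (M t) (?V t))) \<longlongrightarrow> 0) F" by simp
    show "\<forall>\<^sub>F t in F. measure (M t) (?far t) \<le> measure (M t) (?U t) + (1 - measure (M t) (?V t))"
      using M ev s
    proof eventually_elim
      case (elim t)
      interpret prob_space "M t" by fact
      have UV: "?U t \<in> events" "?V t \<in> events" using elim(2) by blast+
      have "(?far t) \<subseteq> ?U t \<union> (space (M t) - ?V t)"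
      proof
        fix \<omega> assume "\<omega> \<in> (?far t)"
        then have \<omega>: "\<omega> \<in> space (M t)" and "l + \<epsilon> < real (L t \<omega>) / s t \<or> real (L t \<omega>) / s t < l - \<epsilon>" by (auto simp: abs_real_def split: if_splits)
        then have "x < real (L t \<omega>) / s t \<or> real (L t \<omega>) / s t < y" using x y by linarith
        then have "x * s t \<le> real (L t \<omega>) \<or> real (L t \<omega>) < y * s t"
          using elim(3) by (auto simp: pos_less_divide_eq pos_divide_less_eq)
        then have "nat \<lceil>x * s t\<rceil> \<le> L t \<omega> \<or> \<not> nat \<lceil>y * s t\<rceil> \<le> L t \<omega>"
          by (auto simp: nat_ceiling_le_eq)
        with \<omega> show "\<omega> \<in> ?U t \<union> (space (M t) - ?V t)" by auto
      qed
      then have "prob (?far t) \<le> prob (?U t \<union> (space (M t) - ?V t))"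
        using UV by (intro finite_measure_mono) auto
      also have "\<dots> \<le> prob (?U t) + prob (space (M t) - ?V t)" using UV by (intro measure_Un_le) auto
      finally show ?case using prob_compl[OF UV(2)] by simp
    qed
  qed (auto intro!: always_eventually)
qed

section \<open>The three regimes\<close>

text \<open>
  Upper tails pass to the slightly smaller gap \<open>h (1 - 1 / t)\<close>, which has the same limit \<open>c\<close>, and to a
  mesh at which the discrete probability is \<open>1 / t\<close>-close.  For lower tails every fine mesh will do, since
  a chain of cells always yields a chain of points.
\<close>
lemma finite_gap_limit:
  fixes a b c :: real and h lam :: "real \<Rightarrow> real" and M :: "real \<Rightarrow> 'a measure"
  assumes ab: "a > 0" "b > 0" and h: "\<And>t. t > 0 \<Longrightarrow> h t \<ge> 0" and lam: "\<And>t. t > 0 \<Longrightarrow> lam t > 0"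
    and poisson: "\<And>t. t > 0 \<Longrightarrow> poisson_process_quadrant (M t) (lam t) (Xi t)"
    and gap: "((\<lambda>t. h t * sqrt (lam t)) \<longlongrightarrow> c) at_top" and c: "c \<ge> 0"
    and \<tau>: "filterlim (\<lambda>t. sqrt (lam t) * t) at_top at_top"
  shows "tendsto_in_prob M (\<lambda>t \<omega>. real (max_chain (h t, h t) (Xi t \<omega>) (a * t, b * t)) / (sqrt (lam t) * t))
    (limit_shape c a b) at_top"
proof -
  define l where "l = limit_shape c a b"
  note fp = limit_shape_fixed_point[OF ab c, folded l_def]
  define \<tau>' where "\<tau>' t = sqrt (lam t) * t" for t
  have mono: "sqrt ((a - c * x) * (b - c * x)) \<le> sqrt ((a - c * y) * (b - c * y))" if "y \<le> x" "c * x < min a b" for x y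
  proof -
    have "c * y \<le> c * x" using that c by (intro mult_left_mono) auto
    then show ?thesis using that by (intro real_sqrt_le_mono mult_mono) auto
  qed
  let ?L = "\<lambda>t \<omega>. max_chain (h t, h t) (Xi t \<omega>) (a * t, b * t)"
  (* room above l in which a chain of length x still fits: c x < min a b *)
  define \<eta> where "\<eta> = (min a b - c * l) / (c + 1)"
  have \<eta>: "\<eta> > 0" using fp(2) c by (simp add: \<eta>_def)
  have small: "c * x < min a b" if "x < l + \<eta>" for x
  proof -
    have "c * x \<le> c * (l + \<eta>)" using that c by (intro mult_left_mono) auto
    also have "\<dots> < c * l + (c + 1) * \<eta>" using \<eta> by (simp add: algebra_simps)
    also have "\<dots> = min a b" using c by (simp add: \<eta>_def)
    finally show ?thesis .
  qed
  have pos: "\<forall>\<^sub>F t in at_top. t > (0::real)" by (rule eventually_gt_at_top)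
  have upper: "((\<lambda>t. measure (M t) {\<omega> \<in> space (M t). nat \<lceil>x * \<tau>' t\<rceil> \<le> ?L t \<omega>}) \<longlongrightarrow> 0) at_top"
    if x: "l < x" "x < l + \<eta>" for x
  proof -
    let ?n = "\<lambda>t. nat \<lceil>x * \<tau>' t\<rceil>"
    define g where "g t = h t * (1 - 1 / t)" for t
    let ?S = "\<lambda>t. {\<omega> \<in> space (M t). strict_chain (g t) (?n t) (Xi t \<omega>) (a * t) (b * t)}"
    define good where "good t \<delta> \<longleftrightarrow> \<delta> > 0 \<and> \<delta> \<le> 1 / (sqrt (lam t) * t) \<and>
       measure (M t) (?S t) \<le>
       grid_chain_prob (lam t) \<delta> (g t) (?n t) (a * t) (b * t) + 1 / t" for t \<delta>
    have ex: "\<exists>\<delta>. good t \<delta>" if "t > 1" for t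
    proof -
      interpret poisson_process_quadrant "M t" "lam t" "Xi t" using poisson that by simp
      have g: "g t \<ge> 0" using h[of t] that by (simp add: g_def)
      have "1 / t > 0" "1 / (sqrt (lam t) * t) > 0" using that lam[of t] by auto
      from strict_chain_approx(2)[OF g this, of "?n t" "a * t" "b * t"]
      obtain \<delta> where \<delta>: "\<delta> > 0" "\<delta> \<le> 1 / (sqrt (lam t) * t)"
        "prob (?S t) \<le>
         prob {\<omega> \<in> space (M t). cell_chain \<delta> (g t) (?n t) (Xi t \<omega>) (a * t) (b * t)} + 1 / t"
        by blast
      show ?thesis
        using \<delta>(1,2) \<delta>(3)[unfolded cell_chain_prob[OF \<delta>(1)], folded grid_chain_prob_def]
        by (intro exI[of _ \<delta>]) (simp add: good_def)
    qed
    define \<delta> where "\<delta> t = (SOME d. good t d)" for t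
    let ?G = "\<lambda>t. grid_chain_prob (lam t) (\<delta> t) (g t) (?n t) (a * t) (b * t)"
    have "good t (\<delta> t)" if "t > 1" for t unfolding \<delta>_def by (rule someI_ex[OF ex[OF that]])
    then have \<delta>: "\<And>t. t > 1 \<Longrightarrow> \<delta> t > 0" "\<And>t. t > 1 \<Longrightarrow> \<delta> t \<le> 1 / (sqrt (lam t) * t)"
      "\<And>t. t > 1 \<Longrightarrow> measure (M t) (?S t) \<le>
       ?G t + 1 / t"
      by (simp_all add: good_def)
    have inv: "((\<lambda>t::real. 1 / t) \<longlongrightarrow> 0) at_top" by real_asymp
    have "((\<lambda>t. ?G t) \<longlongrightarrow> 0) at_top"
      unfolding \<tau>'_def
    proof (rule grid_chain_asymptotics(1))
      show "\<forall>\<^sub>F t in at_top. \<delta> t > 0 \<and> lam t > 0 \<and> t > 0 \<and> g t \<ge> 0"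
        using eventually_gt_at_top[of 1] by eventually_elim (use \<delta>(1) lam h in \<open>auto simp: g_def\<close>)
      show "((\<lambda>t. sqrt (lam t) * \<delta> t) \<longlongrightarrow> 0) at_top"
      proof (rule tendsto_sandwich[OF _ _ tendsto_const inv])
        show "\<forall>\<^sub>F t in at_top. 0 \<le> sqrt (lam t) * \<delta> t"
          using eventually_gt_at_top[of 1] by eventually_elim (use \<delta>(1) lam in \<open>auto intro!: mult_nonneg_nonneg less_imp_le\<close>)
        show "\<forall>\<^sub>F t in at_top. sqrt (lam t) * \<delta> t \<le> 1 / t"
          using eventually_gt_at_top[of 1]
        proof eventually_elim
          case (elim t)
          have s: "sqrt (lam t) > 0" using lam elim by simp
          then have "sqrt (lam t) * \<delta> t \<le> sqrt (lam t) * (1 / (sqrt (lam t) * t))"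
            using \<delta>(2)[OF elim] by (intro mult_left_mono) auto
          with s show ?case by simp
        qed
      qed
      have "((\<lambda>t. h t * sqrt (lam t) * (1 - 1 / t)) \<longlongrightarrow> c * (1 - 0)) at_top" by (intro tendsto_mult tendsto_diff tendsto_const gap inv)
      then show "((\<lambda>t. sqrt (lam t) * g t) \<longlongrightarrow> c) at_top" by (simp add: g_def mult_ac)
      show "2 * sqrt ((a - c * x) * (b - c * x)) < x"
        using mono[of l x] fp(3) x small[of x] by linarith
    qed (use \<tau> x small fp ab in auto)
    from tendsto_add[OF this inv] have lim: "((\<lambda>t. ?G t + 1 / t) \<longlongrightarrow> 0) at_top" by simp
    show ?thesis
    proof (rule tendsto_sandwich[OF _ _ tendsto_const lim])
      show "\<forall>\<^sub>F t in at_top. measure (M t) {\<omega> \<in> space (M t). ?n t \<le> ?L t \<omega>} \<le>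
        ?G t + 1 / t"
        using eventually_gt_at_top[of 1]
      proof eventually_elim
        case (elim t)
        interpret poisson_process_quadrant "M t" "lam t" "Xi t" using poisson elim by simp
        have ht: "h t \<ge> 0" and g: "g t \<ge> 0" using h[of t] elim by (auto simp: g_def)
        have "prob {\<omega> \<in> space (M t). ?n t \<le> ?L t \<omega>} \<le>
          prob (?S t)"
          using strict_chain_approx(1)[OF g] elim
          by (intro finite_measure_mono) (auto simp: g_def intro!: max_chain_strict_chain finite_rectangle ht)
        with \<delta>(3)[OF elim] show ?case by linarith
      qed
    qed (simp add: always_eventually)
  qed
  have lower: "((\<lambda>t. measure (M t) {\<omega> \<in> space (M t). nat \<lceil>x * \<tau>' t\<rceil> \<le> ?L t \<omega>}) \<longlongrightarrow> 1) at_top"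
    if x: "0 < x" "x < l" for x
  proof -
    let ?n = "\<lambda>t. nat \<lceil>x * \<tau>' t\<rceil>"
    define \<delta> where "\<delta> t = 1 / (sqrt (lam t) * t)" for t
    have inv: "((\<lambda>t::real. 1 / t) \<longlongrightarrow> 0) at_top" by real_asymp
    have lim: "((\<lambda>t. grid_chain_prob (lam t) (\<delta> t) (h t) (?n t) (a * t) (b * t)) \<longlongrightarrow> 1) at_top"
      unfolding \<tau>'_def
    proof (rule grid_chain_asymptotics(2))
      show "\<forall>\<^sub>F t in at_top. \<delta> t > 0 \<and> lam t > 0 \<and> t > 0 \<and> h t \<ge> 0"
        using pos by eventually_elim (use lam h in \<open>auto simp: \<delta>_def\<close>)
      have "\<forall>\<^sub>F t in at_top. 1 / t = sqrt (lam t) * \<delta> t"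
        using pos
      proof eventually_elim
        case (elim t)
        then show ?case using lam[of t] by (simp add: \<delta>_def)
      qed
      with inv show "((\<lambda>t. sqrt (lam t) * \<delta> t) \<longlongrightarrow> 0) at_top" by (rule Lim_transform_eventually)
      show "((\<lambda>t. sqrt (lam t) * h t) \<longlongrightarrow> c) at_top" using gap by (simp add: mult.commute)
      show cx: "c * x < min a b" using small[of x] x \<eta> by simp
      show "x < 2 * sqrt ((a - c * x) * (b - c * x))"
        using mono[of x l] fp x by linarith
    qed (use \<tau> x ab in auto)
    show ?thesis
    proof (rule tendsto_sandwich[OF _ _ lim tendsto_const])
      show "\<forall>\<^sub>F t in at_top. grid_chain_prob (lam t) (\<delta> t) (h t) (?n t) (a * t) (b * t) \<le>
        measure (M t) {\<omega> \<in> space (M t). ?n t \<le> ?L t \<omega>}"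
        using pos
      proof eventually_elim
        case (elim t)
        interpret poisson_process_quadrant "M t" "lam t" "Xi t" using poisson elim by simp
        have ht: "h t \<ge> 0" and d: "\<delta> t > 0" using h lam elim by (auto simp: \<delta>_def)
        show ?case
          unfolding grid_chain_prob_def cell_chain_prob[OF d, symmetric]
        proof (rule finite_measure_mono[OF _ max_chain_event[OF ht]])
          show "{\<omega> \<in> space (M t). cell_chain (\<delta> t) (h t) (?n t) (Xi t \<omega>) (a * t) (b * t)} \<subseteq>
            {\<omega> \<in> space (M t). ?n t \<le> ?L t \<omega>}"
            using cell_chain_imp_strict_chain[OF d ht] strict_chain_le_max_chain[OF finite_rectangle ht] by blast
        qed
      qed
      show "\<forall>\<^sub>F t in at_top. measure (M t) {\<omega> \<in> space (M t). ?n t \<le> ?L t \<omega>} \<le> 1"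
        using pos
      proof eventually_elim
        case (elim t)
        interpret poisson_process_quadrant "M t" "lam t" "Xi t" using poisson elim by simp
        show ?case by simp
      qed
    qed
  qed
  have "tendsto_in_prob M (\<lambda>t \<omega>. real (?L t \<omega>) / \<tau>' t) l at_top"
  proof (rule tendsto_in_prob_from_tails[OF _ _ _ fp(1) \<eta> upper lower])
    show "\<forall>\<^sub>F t in at_top. prob_space (M t)"
      using pos by eventually_elim (use poisson in \<open>auto simp: poisson_process_quadrant_def\<close>)
    show "\<forall>\<^sub>F t in at_top. \<forall>n. {\<omega> \<in> space (M t). n \<le> ?L t \<omega>} \<in> sets (M t)"
      using pos by eventually_elim (use poisson_process_quadrant.max_chain_event[OF poisson h] in auto)
    show "\<forall>\<^sub>F t in at_top. \<tau>' t > 0"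
      using pos by eventually_elim (use lam in \<open>auto simp: \<tau>'_def\<close>)
  qed
  then show ?thesis by (simp add: l_def \<tau>'_def)
qed

text \<open>
  The upper tail is deterministic.  For the lower tail, squares of side \<open>\<eta> h\<close> contain
  about \<open>\<eta>\<^sup>2 h\<^sup>2 lam\<close> points, which tends to infinity.
\<close>
lemma infinite_gap_limit:
  fixes a b :: real and h lam :: "real \<Rightarrow> real" and M :: "real \<Rightarrow> 'a measure"
  assumes ab: "a > 0" "b > 0" and h: "\<And>t. t > 0 \<Longrightarrow> h t \<ge> 0" and lam: "\<And>t. t > 0 \<Longrightarrow> lam t > 0"
    and poisson: "\<And>t. t > 0 \<Longrightarrow> poisson_process_quadrant (M t) (lam t) (Xi t)"
    and gap: "filterlim (\<lambda>t. h t * sqrt (lam t)) at_top at_top"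
    and th: "filterlim (\<lambda>t. t / h t) at_top at_top"
  shows "tendsto_in_prob M (\<lambda>t \<omega>. real (max_chain (h t, h t) (Xi t \<omega>) (a * t, b * t)) / (t / h t)) (min a b) at_top"
proof -
  let ?L = "\<lambda>t \<omega>. max_chain (h t, h t) (Xi t \<omega>) (a * t, b * t)"
  let ?m = "min a b"
  let ?long = "\<lambda>x t. {\<omega> \<in> space (M t). nat \<lceil>x * (t / h t)\<rceil> \<le> ?L t \<omega>}"
  have pos: "\<forall>\<^sub>F t in at_top. t > 0 \<and> h t > 0"
  proof -
    have "\<forall>\<^sub>F t in at_top. h t * sqrt (lam t) > 0" using gap by (simp add: filterlim_at_top_dense)
    then show ?thesis using eventually_gt_at_top[of 0]
    proof eventually_elim
      case (elim t)
      then show ?case using h[of t] by (cases "h t = 0") auto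
    qed
  qed
  show ?thesis
  proof (rule tendsto_in_prob_from_tails[where \<eta> = 1])
    show "\<forall>\<^sub>F t in at_top. prob_space (M t)"
      using pos by eventually_elim (use poisson in \<open>auto simp: poisson_process_quadrant_def\<close>)
    show "\<forall>\<^sub>F t in at_top. \<forall>n. {\<omega> \<in> space (M t). n \<le> ?L t \<omega>} \<in> sets (M t)"
      using pos by eventually_elim (use poisson_process_quadrant.max_chain_event[OF poisson h] in auto)
    show "\<forall>\<^sub>F t in at_top. t / h t > 0" using pos by eventually_elim simp
    show "?m > 0" using ab by simp
  next
    fix x assume x: "?m < x"
    have "\<forall>\<^sub>F t in at_top. 1 / (x - ?m) < t / h t" using th by (simp add: filterlim_at_top_dense)
    then have "\<forall>\<^sub>F t in at_top. measure (M t) (?long x t) = 0"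
      using pos
    proof eventually_elim
      case (elim t)
      interpret poisson_process_quadrant "M t" "lam t" "Xi t" using poisson elim by simp
      have "\<not> nat \<lceil>x * (t / h t)\<rceil> \<le> ?L t \<omega>" if \<omega>: "\<omega> \<in> space (M t)" for \<omega>
      proof
        assume le: "nat \<lceil>x * (t / h t)\<rceil> \<le> ?L t \<omega>"
        define n where "n = nat \<lceil>x * (t / h t)\<rceil> - 1"
        have "x * (t / h t) > 0" using x ab elim by simp
        then have "\<lceil>x * (t / h t)\<rceil> \<ge> 1" by (simp add: one_le_ceiling)
        then have n: "Suc n = nat \<lceil>x * (t / h t)\<rceil>" by (simp add: n_def)
        have "n * h t < min (a * t) (b * t)"
          using le elim by (intro max_chain_length_bound[OF finite_rectangle[OF \<omega>]]) (auto simp: n)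
        also have "\<dots> = ?m * t" using elim by (simp add: min_mult_distrib_right)
        finally have "n < ?m * (t / h t)" using elim by (simp add: field_simps)
        moreover have "x * (t / h t) \<le> real (Suc n)" unfolding n by (rule real_nat_ceiling_ge)
        ultimately have "(x - ?m) * (t / h t) < 1" by (simp add: algebra_simps)
        moreover have "1 < (x - ?m) * (t / h t)" using elim(1) x by (simp add: pos_divide_less_eq mult.commute)
        ultimately show False by simp
      qed
      then have none: "(?long x t) = {}" by blast
      show ?case unfolding none by simp
    qed
    then show "((\<lambda>t. measure (M t) (?long x t)) \<longlongrightarrow> 0) at_top"
      by (rule tendsto_eventually)
  next
    fix x assume x: "0 < x" "x < ?m"
    define y where "y = (x + ?m) / 2"
    define z where "z = (x + y) / 2"
    define \<eta> where "\<eta> = ?m / y - 1"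
    (* x < z < y < min a b: y is the density of squares, z that of the occupied ones *)
    define \<epsilon> where "\<epsilon> = 1 - z / y"
    have xy: "x < z" "z < y" "y < ?m" "0 < y" using x by (auto simp: y_def z_def)
    have \<eta>: "\<eta> > 0" using xy by (simp add: \<eta>_def)
    have \<epsilon>: "\<epsilon> > 0" "\<epsilon> \<le> 1" using xy x by (auto simp: \<epsilon>_def)
    define K where "K t = nat \<lfloor>y * (t / h t)\<rfloor>" for t
    let ?short = "\<lambda>t. {\<omega> \<in> space (M t). ?L t \<omega> < (1 - \<epsilon>) * real (K t)}"
    have "filterlim (\<lambda>t. (h t * sqrt (lam t))\<^sup>2) at_top at_top" using gap by (intro filterlim_pow_at_top) auto
    then have "filterlim (\<lambda>t. \<eta>\<^sup>2 * (h t * sqrt (lam t))\<^sup>2) at_top at_top"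
      using \<eta> by (intro filterlim_tendsto_pos_mult_at_top[OF tendsto_const]) auto
    then have "((\<lambda>t. exp (- (\<eta>\<^sup>2 * (h t * sqrt (lam t))\<^sup>2)) / \<epsilon>) \<longlongrightarrow> 0 / \<epsilon>) at_top"
      using \<epsilon> by (intro tendsto_divide tendsto_const filterlim_compose[OF exp_at_bot] filterlim_compose[OF filterlim_uminus_at_bot_at_top]) auto
    then have "((\<lambda>t. 1 - exp (- (\<eta>\<^sup>2 * (h t * sqrt (lam t))\<^sup>2)) / \<epsilon>) \<longlongrightarrow> 1 - 0 / \<epsilon>) at_top"
      by (intro tendsto_diff tendsto_const)
    then have lim: "((\<lambda>t. 1 - exp (- (\<eta>\<^sup>2 * (h t * sqrt (lam t))\<^sup>2)) / \<epsilon>) \<longlongrightarrow> 1) at_top" by simp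
    show "((\<lambda>t. measure (M t) (?long x t)) \<longlongrightarrow> 1) at_top"
    proof (rule tendsto_sandwich[OF _ _ lim tendsto_const])
      have "\<forall>\<^sub>F t in at_top. 2 / (z - x) < t / h t" using th by (simp add: filterlim_at_top_dense)
      then show "\<forall>\<^sub>F t in at_top. 1 - exp (- (\<eta>\<^sup>2 * (h t * sqrt (lam t))\<^sup>2)) / \<epsilon> \<le>
        measure (M t) (?long x t)"
        using pos
      proof eventually_elim
        case (elim t)
        interpret poisson_process_quadrant "M t" "lam t" "Xi t" using poisson elim by simp
        have ht: "h t > 0" "h t \<ge> 0" and t: "t > 0" using elim by auto
        let ?s = "t / h t"
        have "0 \<le> y * ?s" using xy ht t by simp
        then have K: "real (K t) \<le> y * ?s" "y * ?s - 1 \<le> real (K t)" unfolding K_def by linarith+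
        have "K t * ((1 + \<eta>) * h t) \<le> y * ?s * ((1 + \<eta>) * h t)" using K(1) \<eta> ht by (intro mult_right_mono) auto
        also have "\<dots> = ?m * t" using xy ht by (simp add: \<eta>_def)
        also have "\<dots> = min (a * t) (b * t)" using t by (simp add: min_mult_distrib_right)
        finally have "prob (?short t) \<le> exp (- (lam t * (\<eta> * h t)\<^sup>2)) / \<epsilon>"
          by (intro diagonal_squares ht \<eta> \<epsilon>)
        also have "lam t * (\<eta> * h t)\<^sup>2 = \<eta>\<^sup>2 * (h t * sqrt (lam t))\<^sup>2"
          using lam[OF t] by (simp add: power_mult_distrib)
        finally have bad: "prob (?short t) \<le> exp (- (\<eta>\<^sup>2 * (h t * sqrt (lam t))\<^sup>2)) / \<epsilon>" .
        have "(1 - \<epsilon>) * (y * ?s - 1) \<le> (1 - \<epsilon>) * real (K t)" using K \<epsilon> by (intro mult_left_mono) auto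
        moreover have "(1 - \<epsilon>) * (y * ?s - 1) = z * ?s - (1 - \<epsilon>)" using xy by (simp add: \<epsilon>_def algebra_simps)
        moreover have "2 < (z - x) * ?s" using elim(1) xy by (simp add: pos_divide_less_eq mult.commute)
        then have "2 < z * ?s - x * ?s" by (simp only: left_diff_distrib)
        ultimately have big: "x * ?s + 1 \<le> (1 - \<epsilon>) * real (K t)" using \<epsilon> by linarith
        let ?G = "{\<omega> \<in> space (M t). nat \<lceil>x * ?s\<rceil> \<le> ?L t \<omega>}"
        have G: "?G \<in> events" by (rule max_chain_event[OF ht(2)])
        have "space (M t) - ?G \<subseteq> (?short t)"
          using big by (auto simp: nat_ceiling_le_eq)
        moreover have "(?short t) \<in> events"
        proof -
          have "(?short t) =
            space (M t) - {\<omega> \<in> space (M t). nat \<lceil>(1 - \<epsilon>) * real (K t)\<rceil> \<le> ?L t \<omega>}" by (auto simp: nat_ceiling_le_eq)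
          then show ?thesis by (simp only:) (intro sets.Diff sets.top max_chain_event[OF ht(2)])
        qed
        ultimately have "prob (space (M t) - ?G) \<le> prob (?short t)"
          by (rule finite_measure_mono)
        with bad prob_compl[OF G] show ?case by linarith
      qed
      show "\<forall>\<^sub>F t in at_top. measure (M t) (?long x t) \<le> 1"
        using pos
      proof eventually_elim
        case (elim t)
        interpret poisson_process_quadrant "M t" "lam t" "Xi t" using poisson elim by simp
        show ?case by simp
      qed
    qed
  qed simp
qed

theorem theorem14:
  fixes a b :: real
    and h lam :: "real \<Rightarrow> real"
    and M :: "real \<Rightarrow> 'a measure"
    and Xi :: "real \<Rightarrow> 'a \<Rightarrow> (real \<times> real) set"
    and c :: ereal
  assumes "a > 0" and "b > 0"
    and "\<And>t. t > 0 \<Longrightarrow> h t \<ge> 0"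
    and "\<And>t. t > 0 \<Longrightarrow> lam t > 0"
    and "\<And>t. t > 0 \<Longrightarrow> poisson_process_quadrant (M t) (lam t) (Xi t)"
    and "((\<lambda>t. ereal (h t * sqrt (lam t))) \<longlongrightarrow> c) at_top"
  shows
    "(c = 0 \<and> filterlim (\<lambda>t. sqrt (lam t) * t) at_top at_top \<longrightarrow>
        tendsto_in_prob M
          (\<lambda>t \<omega>. 1 / (sqrt (lam t) * t) * real (max_chain (h t, h t) (Xi t \<omega>) (a * t, b * t)))
          (limit_shape 0 a b) at_top) \<and>
     (0 < c \<and> c < \<infinity> \<and> filterlim (\<lambda>t. sqrt (lam t) * t) at_top at_top \<longrightarrow>
        tendsto_in_prob M
          (\<lambda>t \<omega>. 1 / (sqrt (lam t) * t) * real (max_chain (h t, h t) (Xi t \<omega>) (a * t, b * t)))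
          (limit_shape (real_of_ereal c) a b) at_top) \<and>
     (c = \<infinity> \<and> filterlim (\<lambda>t. t / h t) at_top at_top \<longrightarrow>
        tendsto_in_prob M
          (\<lambda>t \<omega>. h t / t * real (max_chain (h t, h t) (Xi t \<omega>) (a * t, b * t)))
          (min a b) at_top)"
proof -
  have finite: "tendsto_in_prob M
          (\<lambda>t \<omega>. 1 / (sqrt (lam t) * t) * real (max_chain (h t, h t) (Xi t \<omega>) (a * t, b * t)))
          (limit_shape r a b) at_top"
    if "c = ereal r" "r \<ge> 0" "filterlim (\<lambda>t. sqrt (lam t) * t) at_top at_top" for r
  proof -
    have "((\<lambda>t. h t * sqrt (lam t)) \<longlongrightarrow> r) at_top" using assms(6) that(1) by simp
    from finite_gap_limit[OF assms(1-5) this that(2,3)] show ?thesis by simp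
  qed
  show ?thesis
  proof (intro conjI impI)
    assume "c = 0 \<and> filterlim (\<lambda>t. sqrt (lam t) * t) at_top at_top"
    then show "tendsto_in_prob M
          (\<lambda>t \<omega>. 1 / (sqrt (lam t) * t) * real (max_chain (h t, h t) (Xi t \<omega>) (a * t, b * t)))
          (limit_shape 0 a b) at_top" by (intro finite) (auto simp: zero_ereal_def)
  next
    assume c: "0 < c \<and> c < \<infinity> \<and> filterlim (\<lambda>t. sqrt (lam t) * t) at_top at_top"
    then obtain r where "c = ereal r" "r > 0" by (cases c) auto
    then show "tendsto_in_prob M
          (\<lambda>t \<omega>. 1 / (sqrt (lam t) * t) * real (max_chain (h t, h t) (Xi t \<omega>) (a * t, b * t)))
          (limit_shape (real_of_ereal c) a b) at_top" using c finite[of r] by simp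
  next
    assume c: "c = \<infinity> \<and> filterlim (\<lambda>t. t / h t) at_top at_top"
    have "filterlim (\<lambda>t. h t * sqrt (lam t)) at_top at_top"
      using assms(6) c by (simp add: tendsto_PInfty_eq_at_top)
    from infinite_gap_limit[OF assms(1-5) this] c
    show "tendsto_in_prob M
          (\<lambda>t \<omega>. h t / t * real (max_chain (h t, h t) (Xi t \<omega>) (a * t, b * t)))
          (min a b) at_top" by (simp add: mult.commute)
  qed
qed

end
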